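(* For computable metric spaces $\mathbf{X}$, $\mathbf{Y}$, the maps $\textnormal{id} : \Delta_2^0(\mathbf{X}, \mathbf{Y}) \to \mathcal{C}^{\mathcal{A}-pw}(\mathbf{X}, \mathbf{Y})$ and $\textnormal{id} : \mathcal{C}^{\mathcal{A}-pw}(\mathbf{X}, \mathbf{Y}) \to \Delta_2^0(\mathbf{X}, \mathbf{Y})$ are well-defined and computable.
   Context: Work in computable analysis: represented spaces are sets with partial surjections from $\{0,1\}^\mathbb{N}$; computable metric spaces carry their Cauchy representation; $\mathcal{O}(\mathbf{X})$, $\mathcal{A}(\mathbf{X})$ are the represented spaces of open and closed subsets (closed sets represented by names of their complements), $\mathcal{C}(\cdot,\cdot)$ the represented spaces of continuous functions. $\Delta_2^0(\mathbf{X})$: a sequence $(A_i, U_i)_{i} \in \mathcal{C}(\mathbb{N}, \mathcal{A}(\mathbf{X}) \times \mathcal{O}(\mathbf{X}))$ names the set $\bigcup_i A_i = \bigcap_i U_i$ (and nothing if these differ). $\Delta_2^0(\mathbf{X}, \mathbf{Y})$ is the subspace of $\mathcal{C}(\mathcal{O}(\mathbf{Y}), \Delta_2^0(\mathbf{X}))$ of maps of the form $U\mapsto f^{-1}(U)$ for a function $f:\mathbf{X}\to\mathbf{Y}$, identified with $f$. $\mathcal{C}^{\mathcal{A}-pw}(\mathbf{X}, \mathbf{Y})$: a function $f : \mathbf{X} \to \mathbf{Y}$ is named by a computable-in-$i$ sequence $(A_i, f_i)_{i}$ with $A_i \in \mathcal{A}(\mathbf{X})$, $f_i \in \mathcal{C}(\mathbf{A}_i,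 \mathbf{Y})$, $X = \bigcup_i A_i$ and $f_i = f_{|A_i}$. *)

theory Defs
  imports "HOL-Analysis.Analysis" "HOL-Library.Nat_Bijection"
begin

section \<open>Oracle machines\<close>

type_synonym cantor = "nat \<Rightarrow> bool"

text \<open>
  The machine model is that of the partial recursive functions relative to an oracle.  All
  functions are unary; tuples are handled by \<^const>\<open>prod_encode\<close>.
\<close>

datatype code =
    CZero | CSucc | CFst | CSnd | COracle
  | CPair code code
  | CComp code code
  | CPrec code code
  | CMu code

text \<open>
  \<open>evals p c n m\<close>: the program \<open>c\<close> with oracle \<open>p\<close> halts on input \<open>n\<close> with output \<open>m\<close>.
\<close>

inductive evals :: "cantor \<Rightarrow> code \<Rightarrow> nat \<Rightarrow> nat \<Rightarrow> bool" for p :: cantor where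
  zero: "evals p CZero n 0"
| succ: "evals p CSucc n (Suc n)"
| fst: "evals p CFst n (fst (prod_decode n))"
| snd: "evals p CSnd n (snd (prod_decode n))"
| query: "evals p COracle n (of_bool (p n))"
| pair: "evals p f n x \<Longrightarrow> evals p g n y \<Longrightarrow> evals p (CPair f g) n (prod_encode (x, y))"
| comp: "evals p g n x \<Longrightarrow> evals p f x y \<Longrightarrow> evals p (CComp f g) n y"
| prec_0: "evals p f x y \<Longrightarrow> evals p (CPrec f g) (prod_encode (x, 0)) y"
| prec_Suc: "evals p (CPrec f g) (prod_encode (x, k)) z \<Longrightarrow>
    evals p g (prod_encode (x, prod_encode (k, z))) y \<Longrightarrow>
    evals p (CPrec f g) (prod_encode (x, Suc k)) y"
| mu: "evals p f (prod_encode (n, k)) 0 \<Longrightarrow>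
    (\<And>j. j < k \<Longrightarrow> \<exists>y. y \<noteq> 0 \<and> evals p f (prod_encode (n, j)) y) \<Longrightarrow>
    evals p (CMu f) n k"

lemma evals_det: "evals p c n x \<Longrightarrow> evals p c n y \<Longrightarrow> x = y"
proof (induction arbitrary: y rule: evals.induct)
  case (pair f n x g z)
  from pair.prems show ?case by cases (use pair.IH in auto)
next
  case (comp g n x f z)
  from comp.prems show ?case by cases (use comp.IH in auto)
next
  case (prec_0 f x z g)
  from prec_0.prems show ?case by cases (use prec_0.IH in auto)
next
  case (prec_Suc f g x k z w)
  from prec_Suc.prems show ?case by cases (use prec_Suc.IH in auto)
next
  case (mu f n k)
  from mu.prems show ?case
  proof cases
    case mu': mu
    show ?thesis
    proof (rule linorder_cases[of k y])
      assume "k < y"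
      then show ?thesis using mu'(2) mu.IH(1) by metis
    next
      assume "y < k"
      then show ?thesis using mu.IH(2) mu'(1) by metis
    qed
  qed
qed (auto elim: evals.cases)

fun code_index :: "code \<Rightarrow> nat" where
  "code_index CZero = 0"
| "code_index CSucc = 1"
| "code_index CFst = 2"
| "code_index CSnd = 3"
| "code_index COracle = 4"
| "code_index (CPair f g) = 5 + 4 * prod_encode (code_index f, code_index g)"
| "code_index (CComp f g) = 6 + 4 * prod_encode (code_index f, code_index g)"
| "code_index (CPrec f g) = 7 + 4 * prod_encode (code_index f, code_index g)"
| "code_index (CMu f) = 8 + 4 * code_index f"

lemma code_index_inject: "code_index c = code_index c' \<longleftrightarrow> c = c'"
proof -
  have "code_index c = code_index c' \<Longrightarrow> c = c'"
  proof (induction c arbitrary: c')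
    case (CPair f g) then show ?case by (cases c'; simp; presburger)
  next
    case (CComp f g) then show ?case by (cases c'; simp; presburger)
  next
    case (CPrec f g) then show ?case by (cases c'; simp; presburger)
  next
    case (CMu f) then show ?case by (cases c'; simp; presburger)
  qed (case_tac [!] c', auto)
  then show ?thesis by auto
qed

text \<open>
  The type-2 partial function computed by \<open>c\<close>: on input \<open>p\<close> the infinite output is \<open>q\<close>.
\<close>

definition computes :: "code \<Rightarrow> cantor \<Rightarrow> cantor \<Rightarrow> bool" where
  "computes c p q \<longleftrightarrow> (\<forall>k. evals p c k (of_bool (q k)))"

lemma computes_det: "computes c p q \<Longrightarrow> computes c p q' \<Longrightarrow> q = q'"
  unfolding computes_def by (rule ext) (metis evals_det of_bool_eq_iff)

definition semidecidable :: "nat set \<Rightarrow> bool" where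
  "semidecidable S \<longleftrightarrow> (\<exists>c. \<forall>n. n \<in> S \<longleftrightarrow> (\<exists>m. evals (\<lambda>_. False) c n m))"


section \<open>Represented spaces\<close>

text \<open>
  A represented space is given by its representation, a partial map from Cantor space; the
  underlying set is the range.
\<close>

type_synonym 'a rep = "cantor \<Rightarrow> 'a option"

abbreviation points :: "'a rep \<Rightarrow> 'a set" where
  "points X \<equiv> ran X"

text \<open>
  \<open>rep_of R\<close> is the representation with naming relation \<open>R\<close>.  It is only used for relations in
  which a name determines the object named; this is proved along with the definitions below.
\<close>

definition rep_of :: "(cantor \<Rightarrow> 'a \<Rightarrow> bool) \<Rightarrow> 'a rep" where
  "rep_of R p = (if \<exists>!x. R p x then Some (THE x. R p x) else None)"

lemma rep_of_eq_Some_iff: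
  assumes "\<And>x y. R p x \<Longrightarrow> R p y \<Longrightarrow> x = y"
  shows "rep_of R p = Some x \<longleftrightarrow> R p x"
  unfolding rep_of_def using assms by (auto intro: theI)

definition computable_map :: "'a rep \<Rightarrow> 'b rep \<Rightarrow> ('a \<Rightarrow> 'b) \<Rightarrow> bool" where
  "computable_map X Y f \<longleftrightarrow>
    (\<exists>c. \<forall>p x. X p = Some x \<longrightarrow> (\<exists>q. computes c p q \<and> Y q = Some (f x)))"

definition subspace_rep :: "'a rep \<Rightarrow> 'a set \<Rightarrow> 'a rep" where
  "subspace_rep X A p = (case X p of None \<Rightarrow> None | Some x \<Rightarrow> if x \<in> A then Some x else None)"

definition interleave :: "cantor \<Rightarrow> cantor \<Rightarrow> cantor" where
  "interleave p q k = (if even k then p (k div 2) else q (k div 2))"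

definition evens :: "cantor \<Rightarrow> cantor" where
  "evens p k = p (2 * k)"

definition odds :: "cantor \<Rightarrow> cantor" where
  "odds p k = p (2 * k + 1)"

lemma evens_interleave [simp]: "evens (interleave p q) = p"
  and odds_interleave [simp]: "odds (interleave p q) = q"
  by (auto simp: evens_def odds_def interleave_def)

definition prod_rep :: "'a rep \<Rightarrow> 'b rep \<Rightarrow> ('a \<times> 'b) rep" where
  "prod_rep X Y p =
    (case (X (evens p), Y (odds p)) of (Some x, Some y) \<Rightarrow> Some (x, y) | _ \<Rightarrow> None)"

text \<open>The sequence \<open>0\<^sup>n 1 q\<close>.\<close>

definition unary_prefix :: "nat \<Rightarrow> cantor \<Rightarrow> cantor" where
  "unary_prefix n q k = (if k < n then False else if k = n then True else q (k - n - 1))"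

lemma unary_prefix_inject:
  assumes "unary_prefix m p = unary_prefix n q"
  shows "m = n \<and> p = q"
proof -
  have least: "(LEAST k. unary_prefix n q k) = n" for n q
    by (rule Least_equality) (auto simp: unary_prefix_def split: if_splits intro: leI)
  have "m = n" using least[of m p] least[of n q] assms by simp
  moreover have "p k = q k" for k
    using fun_cong[OF assms, of "n + 1 + k"] \<open>m = n\<close> by (simp add: unary_prefix_def)
  ultimately show ?thesis by auto
qed

definition nat_rep :: "nat rep" where
  "nat_rep = rep_of (\<lambda>p n. p = unary_prefix n (\<lambda>_. False))"

lemma nat_rep_eq_Some_iff: "nat_rep p = Some n \<longleftrightarrow> p = unary_prefix n (\<lambda>_. False)"
  unfolding nat_rep_def by (rule rep_of_eq_Some_iff) (use unary_prefix_inject in blast)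

text \<open>The Sierpinski space, whose points are the truth values.\<close>

definition sierpinski_rep :: "bool rep" where
  "sierpinski_rep p = Some (\<exists>n. p n)"

text \<open>
  The space of continuous functions: \<open>0\<^sup>n 1 q\<close> is a name of \<open>f\<close> if the \<open>n\<close>-th machine with
  additional oracle \<open>q\<close> computes a realizer of \<open>f\<close>.  Functions are undefined outside the
  underlying set of \<open>X\<close>.
\<close>

definition names_fun :: "'a rep \<Rightarrow> 'b rep \<Rightarrow> cantor \<Rightarrow> ('a \<Rightarrow> 'b) \<Rightarrow> bool" where
  "names_fun X Y p f \<longleftrightarrow>
    f \<in> points X \<rightarrow>\<^sub>E points Y \<and>
    (\<exists>c q. p = unary_prefix (code_index c) q \<and>
      (\<forall>r x. X r = Some x \<longrightarrow> (\<exists>s. computes c (interleave r q) s \<and> Y s = Some (f x))))"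

definition fun_rep :: "'a rep \<Rightarrow> 'b rep \<Rightarrow> ('a \<Rightarrow> 'b) rep" where
  "fun_rep X Y = rep_of (names_fun X Y)"

lemma names_fun_unique:
  assumes f: "names_fun X Y p f" and g: "names_fun X Y p g"
  shows "f = g"
proof -
  obtain c q where p: "p = unary_prefix (code_index c) q"
    and F: "\<And>r x. X r = Some x \<Longrightarrow> \<exists>s. computes c (interleave r q) s \<and> Y s = Some (f x)"
    using f unfolding names_fun_def by blast
  obtain c' q' where p': "p = unary_prefix (code_index c') q'"
    and G: "\<And>r x. X r = Some x \<Longrightarrow> \<exists>s. computes c' (interleave r q') s \<and> Y s = Some (g x)"
    using g unfolding names_fun_def by blast
  have "c' = c" "q' = q"
    using unary_prefix_inject p p' code_index_inject by metis+
  then have "f x = g x" if "X r = Some x" for r x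
    using F[OF that] G[OF that] computes_det by fastforce
  then show ?thesis
    using f g unfolding names_fun_def by (intro PiE_ext[of f "points X" _ g]) (auto simp: ran_def)
qed

lemma fun_rep_eq_Some_iff: "fun_rep X Y p = Some f \<longleftrightarrow> names_fun X Y p f"
  unfolding fun_rep_def by (rule rep_of_eq_Some_iff) (rule names_fun_unique)

definition open_rep :: "'a rep \<Rightarrow> 'a set rep" where
  "open_rep X p = map_option (\<lambda>h. {x \<in> points X. h x}) (fun_rep X sierpinski_rep p)"

definition closed_rep :: "'a rep \<Rightarrow> 'a set rep" where
  "closed_rep X p = map_option (\<lambda>U. points X - U) (open_rep X p)"

definition Delta2_rep :: "'a rep \<Rightarrow> 'a set rep" where
  "Delta2_rep X p =
    (case fun_rep nat_rep (prod_rep (closed_rep X) (open_rep X)) p of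
      None \<Rightarrow> None
    | Some s \<Rightarrow>
        if (\<Union>i. fst (s i)) = (\<Inter>i. snd (s i)) then Some (\<Union>i. fst (s i)) else None)"

definition preimage_map :: "'a rep \<Rightarrow> 'b rep \<Rightarrow> ('a \<Rightarrow> 'b) \<Rightarrow> 'b set \<Rightarrow> 'a set" where
  "preimage_map X Y f = (\<lambda>U\<in>points (open_rep Y). {x \<in> points X. f x \<in> U})"

definition names_Delta2_fun :: "'a rep \<Rightarrow> 'b rep \<Rightarrow> cantor \<Rightarrow> ('a \<Rightarrow> 'b) \<Rightarrow> bool" where
  "names_Delta2_fun X Y p f \<longleftrightarrow>
    f \<in> points X \<rightarrow>\<^sub>E points Y \<and>
    fun_rep (open_rep Y) (Delta2_rep X) p = Some (preimage_map X Y f)"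

definition Delta2_fun_rep :: "'a rep \<Rightarrow> 'b rep \<Rightarrow> ('a \<Rightarrow> 'b) rep" where
  "Delta2_fun_rep X Y = rep_of (names_Delta2_fun X Y)"

text \<open>
  Identifying \<open>f\<close> with \<open>U \<mapsto> f\<^sup>-\<^sup>1(U)\<close> requires that open sets separate the points of \<open>Y\<close>,
  which they do in computable metric spaces (see \<open>Delta2_fun_rep_eq_Some_iff\<close>).
\<close>

lemma names_Delta2_fun_unique:
  assumes sep: "\<And>y z. y \<in> points Y \<Longrightarrow> z \<in> points Y \<Longrightarrow> y \<noteq> z \<Longrightarrow>
      \<exists>U\<in>points (open_rep Y). y \<in> U \<and> z \<notin> U"
    and f: "names_Delta2_fun X Y p f" and g: "names_Delta2_fun X Y p g"
  shows "f = g"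
proof -
  have fX: "f \<in> points X \<rightarrow>\<^sub>E points Y" and gX: "g \<in> points X \<rightarrow>\<^sub>E points Y"
    and eq: "preimage_map X Y f = preimage_map X Y g"
    using f g by (auto simp: names_Delta2_fun_def)
  have "f x = g x" if x: "x \<in> points X" for x
  proof (rule ccontr)
    assume "f x \<noteq> g x"
    then obtain U where "U \<in> points (open_rep Y)" "f x \<in> U" "g x \<notin> U"
      using sep fX gX x by (meson PiE_mem)
    then show False using fun_cong[OF eq, of U] x by (auto simp: preimage_map_def)
  qed
  then show ?thesis using fX gX by (intro PiE_ext[of f "points X" _ g]) auto
qed

text \<open>A name of a pair \<open>(A, g)\<close> of a closed set \<open>A\<close> and a continuous function \<open>g\<close> on \<open>A\<close>.\<close>

definition closed_piece_rep :: "'a rep \<Rightarrow> 'b rep \<Rightarrow> ('a set \<times> ('a \<Rightarrow> 'b)) rep" where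
  "closed_piece_rep X Y p =
    (case closed_rep X (evens p) of
      None \<Rightarrow> None
    | Some A \<Rightarrow> map_option (\<lambda>g. (A, g)) (fun_rep (subspace_rep X A) Y (odds p)))"

definition names_closed_pw :: "'a rep \<Rightarrow> 'b rep \<Rightarrow> cantor \<Rightarrow> ('a \<Rightarrow> 'b) \<Rightarrow> bool" where
  "names_closed_pw X Y p f \<longleftrightarrow>
    f \<in> points X \<rightarrow>\<^sub>E points Y \<and>
    (\<exists>s. fun_rep nat_rep (closed_piece_rep X Y) p = Some s \<and>
      (\<Union>i. fst (s i)) = points X \<and>
      (\<forall>i. snd (s i) = restrict f (fst (s i))))"

definition closed_pw_rep :: "'a rep \<Rightarrow> 'b rep \<Rightarrow> ('a \<Rightarrow> 'b) rep" where
  "closed_pw_rep X Y = rep_of (names_closed_pw X Y)"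

lemma names_closed_pw_unique:
  assumes f: "names_closed_pw X Y p f" and g: "names_closed_pw X Y p g"
  shows "f = g"
proof -
  obtain s where *: "fun_rep nat_rep (closed_piece_rep X Y) p = Some s"
    and s: "(\<Union>i. fst (s i)) = points X"
    and sf: "\<And>i. snd (s i) = restrict f (fst (s i))"
    using f unfolding names_closed_pw_def by blast
  have sg: "\<And>i. snd (s i) = restrict g (fst (s i))"
    using g * unfolding names_closed_pw_def by auto
  have eq: "restrict f (fst (s i)) = restrict g (fst (s i))" for i
    using sf sg by metis
  have "f x = g x" if x: "x \<in> points X" for x
  proof -
    obtain i where "x \<in> fst (s i)" using s x by blast
    then show ?thesis using fun_cong[OF eq[of i], of x] by simp
  qed
  then show ?thesis
    using f g unfolding names_closed_pw_def by (intro PiE_ext[of f "points X" _ g]) auto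
qed

lemma closed_pw_rep_eq_Some_iff: "closed_pw_rep X Y p = Some f \<longleftrightarrow> names_closed_pw X Y p f"
  unfolding closed_pw_rep_def by (rule rep_of_eq_Some_iff) (rule names_closed_pw_unique)


section \<open>Computable metric spaces\<close>

definition rat_of_nat :: "nat \<Rightarrow> real" where
  "rat_of_nat t = (case prod_decode t of (i, j) \<Rightarrow> of_int (int_decode i) / of_nat (Suc j))"

text \<open>No completeness is required.\<close>

locale computable_metric_space = Metric_space M d
  for M :: "'a set" and d :: "'a \<Rightarrow> 'a \<Rightarrow> real" +
  fixes a :: "nat \<Rightarrow> 'a"
  assumes dense_in: "range a \<subseteq> M"
    and dense: "mtopology closure_of (range a) = M"
    and computable_dist: "semidecidable
      {prod_encode (t, prod_encode (u, prod_encode (v, w))) | t u v w.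
        rat_of_nat t < d (a u) (a v) \<and> d (a u) (a v) < rat_of_nat w}"

text \<open>
  Baire space is embedded into Cantor space by the characteristic functions of graphs.
\<close>

definition graph_of :: "(nat \<Rightarrow> nat) \<Rightarrow> cantor" where
  "graph_of s k = (case prod_decode k of (i, n) \<Rightarrow> s i = n)"

lemma graph_of_inject: "graph_of s = graph_of t \<longleftrightarrow> s = t"
proof
  assume eq: "graph_of s = graph_of t"
  show "s = t"
  proof
    fix i
    show "s i = t i"
      using fun_cong[OF eq, of "prod_encode (i, s i)"] by (simp add: graph_of_def)
  qed
qed simp

definition names_cauchy ::
  "'a set \<Rightarrow> ('a \<Rightarrow> 'a \<Rightarrow> real) \<Rightarrow> (nat \<Rightarrow> 'a) \<Rightarrow> cantor \<Rightarrow> 'a \<Rightarrow> bool" where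
  "names_cauchy M d a p x \<longleftrightarrow>
    (\<exists>s. p = graph_of s \<and>
      (\<forall>i k. i < k \<longrightarrow> d (a (s i)) (a (s k)) \<le> (1/2) ^ i) \<and>
      limitin (Metric_space.mtopology M d) (\<lambda>n. a (s n)) x sequentially)"

definition cauchy_rep :: "'a set \<Rightarrow> ('a \<Rightarrow> 'a \<Rightarrow> real) \<Rightarrow> (nat \<Rightarrow> 'a) \<Rightarrow> 'a rep" where
  "cauchy_rep M d a = rep_of (names_cauchy M d a)"

context computable_metric_space
begin

lemma cauchy_rep_eq_Some_iff: "cauchy_rep M d a p = Some x \<longleftrightarrow> names_cauchy M d a p x"
  unfolding cauchy_rep_def
proof (rule rep_of_eq_Some_iff)
  fix x y assume "names_cauchy M d a p x" "names_cauchy M d a p y"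
  then show "x = y"
    unfolding names_cauchy_def graph_of_inject
    by (metis graph_of_inject limitin_metric_unique trivial_limit_sequentially)
qed

lemma points_cauchy_rep: "points (cauchy_rep M d a) = M"
proof (intro set_eqI iffI)
  fix x assume "x \<in> points (cauchy_rep M d a)"
  then show "x \<in> M"
    by (auto simp: ran_def cauchy_rep_eq_Some_iff names_cauchy_def limitin_mspace)
next
  fix x assume x: "x \<in> M"
  have "\<exists>m. d x (a m) < e" if "e > 0" for e
    using dense x that unfolding metric_closure_of by fastforce
  then have "\<forall>n. \<exists>m. d x (a m) < (1/2) ^ (Suc n)"
    by (metis half_gt_zero_iff zero_less_one zero_less_power)
  then have "\<exists>s. \<forall>n. d x (a (s n)) < (1/2) ^ (Suc n)"
    by (rule choice)
  then obtain s where s: "\<And>n. d x (a (s n)) < (1/2) ^ (Suc n)" by blast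
  have aM: "a n \<in> M" for n using dense_in by auto
  have "d (a (s i)) (a (s k)) \<le> (1/2) ^ i" if "i < k" for i k
  proof -
    have "d (a (s i)) (a (s k)) \<le> d x (a (s i)) + d x (a (s k))"
      using triangle[of "a (s i)" x "a (s k)"] aM x commute by metis
    also have "\<dots> \<le> (1/2) ^ (Suc i) + (1/2) ^ (Suc k)"
      using s[of i] s[of k] by linarith
    also have "(1/2::real) ^ (Suc k) \<le> (1/2) ^ (Suc i)"
      using that by (intro power_decreasing) auto
    finally show ?thesis by simp
  qed
  moreover have "limitin mtopology (\<lambda>n. a (s n)) x sequentially"
    unfolding limitin_metric
  proof (intro conjI x allI impI)
    fix e :: real assume "e > 0"
    then obtain n where n: "(1/2) ^ n < e" using real_arch_pow_inv[of e "1/2"] by auto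
    show "\<forall>\<^sub>F k in sequentially. a (s k) \<in> M \<and> d (a (s k)) x < e"
    proof (rule eventually_sequentiallyI[of n], intro conjI aM)
      fix k assume "n \<le> k"
      then have "(1/2::real) ^ (Suc k) \<le> (1/2) ^ n" by (intro power_decreasing) auto
      then show "d (a (s k)) x < e" using s[of k] n commute[of "a (s k)" x] by linarith
    qed
  qed
  ultimately have "names_cauchy M d a (graph_of s) x"
    unfolding names_cauchy_def by blast
  then show "x \<in> points (cauchy_rep M d a)"
    by (auto simp: ran_def simp flip: cauchy_rep_eq_Some_iff)
qed

text \<open>
  The complement of a point \<open>z\<close> is open: it is accepted with the oracle \<open>q\<close> of those \<open>(i, m)\<close> for
  which \<open>z\<close> is not in the closed ball around \<open>a m\<close> of radius \<open>(1/2)\<^sup>i\<close>.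
\<close>

lemma complement_point_open:
  assumes z: "z \<in> M"
  shows "M - {z} \<in> points (open_rep (cauchy_rep M d a))"
proof -
  let ?X = "cauchy_rep M d a"
  define q where "q k = (case prod_decode k of (i, m) \<Rightarrow> d (a m) z > (1/2) ^ i)" for k
  define twice where "twice = CComp (CPrec CZero (CComp CSucc (CComp CSucc (CComp CSnd CSnd))))
      (CPair CZero (CPair CFst CSnd))"
  define both where "both = CComp (CPrec CZero CFst)
      (CPair (CComp COracle twice) (CComp COracle (CComp CSucc twice)))"
  have step: "evals p (CComp CSucc (CComp CSucc (CComp CSnd CSnd)))
      (prod_encode (x, prod_encode (k, y))) (Suc (Suc y))" for p x k y
  proof -
    have 1: "evals p CSnd (prod_encode (x, prod_encode (k, y))) (prod_encode (k, y))"
      using evals.snd[of p "prod_encode (x, prod_encode (k, y))"] by simp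
    have 2: "evals p CSnd (prod_encode (k, y)) y"
      using evals.snd[of p "prod_encode (k, y)"] by simp
    show ?thesis by (intro evals.comp[OF _ evals.succ] evals.comp[OF 1 2])
  qed
  have rec: "evals p (CPrec CZero (CComp CSucc (CComp CSucc (CComp CSnd CSnd))))
      (prod_encode (x, k)) (2 * k)" for p x k
  proof (induction k)
    case 0
    show ?case using evals.prec_0[OF evals.zero] by simp
  next
    case (Suc k)
    show ?case using evals.prec_Suc[OF Suc step] by simp
  qed
  have ident: "evals p (CPair CFst CSnd) n n" for p n
    using evals.pair[OF evals.fst evals.snd, of p n] by simp
  have twice: "evals p twice k (2 * k)" for p k
    unfolding twice_def by (rule evals.comp[OF evals.pair[OF evals.zero ident] rec])
  have conj: "evals p (CPrec CZero CFst) (prod_encode (of_bool u, of_bool v)) (of_bool (u \<and> v))"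
    for p u v
  proof (cases v)
    case False
    then show ?thesis using evals.prec_0[OF evals.zero] by simp
  next
    case True
    have "evals p CFst (prod_encode (of_bool u, n)) (of_bool u)" for n
      using evals.fst[of p "prod_encode (of_bool u, n)"] by simp
    then show ?thesis
      using True evals.prec_Suc[OF evals.prec_0[OF evals.zero]] by simp
  qed
  have both: "computes both (interleave r q) (\<lambda>k. r k \<and> q k)" for r
    unfolding computes_def
  proof
    fix k
    have 1: "evals (interleave r q) (CComp COracle twice) k (of_bool (r k))"
      using evals.comp[OF twice evals.query, of "interleave r q" k] by (simp add: interleave_def)
    have 2: "evals (interleave r q) (CComp COracle (CComp CSucc twice)) k (of_bool (q k))"
      using evals.comp[OF evals.comp[OF twice evals.succ] evals.query, of "interleave r q" k]
      by (simp add: interleave_def)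
    show "evals (interleave r q) both k (of_bool (r k \<and> q k))"
      unfolding both_def by (rule evals.comp[OF evals.pair[OF 1 2] conj])
  qed
  have aM: "a n \<in> M" for n using dense_in by auto
  have correct: "(\<exists>k. r k \<and> q k) \<longleftrightarrow> x \<noteq> z" if r: "?X r = Some x" for r x
  proof -
    obtain s where s: "r = graph_of s"
      and cauchy: "\<And>i k. i < k \<Longrightarrow> d (a (s i)) (a (s k)) \<le> (1/2) ^ i"
      and lim: "limitin mtopology (\<lambda>n. a (s n)) x sequentially"
      using r unfolding cauchy_rep_eq_Some_iff names_cauchy_def by blast
    have x: "x \<in> M" using lim by (rule limitin_mspace)
    have near: "d (a (s i)) x \<le> (1/2) ^ i" for i
    proof (rule field_le_epsilon)
      fix e :: real assume "e > 0"
      then have "\<forall>\<^sub>F n in sequentially. d (a (s n)) x < e"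
        using lim unfolding limitin_metric by (auto elim: eventually_mono)
      then have "\<forall>\<^sub>F n in sequentially. d (a (s n)) x < e \<and> i < n"
        using eventually_gt_at_top[of i] by (rule eventually_conj)
      then obtain n where "d (a (s n)) x < e" "i < n"
        using eventually_happens trivial_limit_sequentially by blast
      then show "d (a (s i)) x \<le> (1/2) ^ i + e"
        using triangle[OF aM[of "s i"] aM[of "s n"] x] cauchy[of i n] by linarith
    qed
    have "(\<exists>k. r k \<and> q k) \<longleftrightarrow> (\<exists>i. d (a (s i)) z > (1/2) ^ i)"
    proof
      assume "\<exists>k. r k \<and> q k"
      then obtain k where k: "r k" "q k" by blast
      obtain i m where im: "prod_decode k = (i, m)" by fastforce
      have "d (a (s i)) z > (1/2) ^ i"
        using k im unfolding s graph_of_def q_def by simp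
      then show "\<exists>i. d (a (s i)) z > (1/2) ^ i" ..
    next
      assume "\<exists>i. d (a (s i)) z > (1/2) ^ i"
      then obtain i where i: "d (a (s i)) z > (1/2) ^ i" by blast
      show "\<exists>k. r k \<and> q k"
        by (rule exI[of _ "prod_encode (i, s i)"]) (use i in \<open>simp add: s graph_of_def q_def\<close>)
    qed
    also have "\<dots> \<longleftrightarrow> x \<noteq> z"
    proof
      assume "\<exists>i. d (a (s i)) z > (1/2) ^ i"
      then show "x \<noteq> z" using near by (metis not_le)
    next
      assume "x \<noteq> z"
      then have "0 < d x z" using x z by simp
      then obtain i where i: "(1/2) ^ i < d x z / 2"
        using real_arch_pow_inv[of "d x z / 2" "1/2"] by auto
      have "d x z \<le> d (a (s i)) x + d (a (s i)) z"
        using triangle[OF x aM[of "s i"] z] commute[of x "a (s i)"] by linarith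
      then have "d (a (s i)) z > (1/2) ^ i" using near[of i] i by linarith
      then show "\<exists>i. d (a (s i)) z > (1/2) ^ i" ..
    qed
    finally show ?thesis .
  qed
  have S: "points sierpinski_rep = UNIV"
  proof -
    have "sierpinski_rep (\<lambda>_. v) = Some v" for v by (simp add: sierpinski_rep_def)
    then show ?thesis by (auto simp: ran_def)
  qed
  have "\<exists>s. computes both (interleave r q) s \<and> sierpinski_rep s = Some ((\<lambda>x\<in>M. x \<noteq> z) x)"
    if r: "?X r = Some x" for r x
  proof -
    have "x \<in> M" using r points_cauchy_rep by (auto simp: ran_def)
    then show ?thesis using both[of r] correct[OF r] by (auto simp: sierpinski_rep_def)
  qed
  then have "names_fun ?X sierpinski_rep (unary_prefix (code_index both) q) (\<lambda>x\<in>M. x \<noteq> z)"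
    unfolding names_fun_def points_cauchy_rep S by (intro conjI) (simp, blast)
  then have "open_rep ?X (unary_prefix (code_index both) q) = Some (M - {z})"
    unfolding open_rep_def points_cauchy_rep by (auto simp flip: fun_rep_eq_Some_iff)
  then show ?thesis by (auto simp: ran_def)
qed

lemma Delta2_fun_rep_eq_Some_iff:
  "Delta2_fun_rep X (cauchy_rep M d a) p = Some f \<longleftrightarrow> names_Delta2_fun X (cauchy_rep M d a) p f"
  unfolding Delta2_fun_rep_def
proof (rule rep_of_eq_Some_iff)
  fix f g
  assume "names_Delta2_fun X (cauchy_rep M d a) p f" "names_Delta2_fun X (cauchy_rep M d a) p g"
  then show "f = g"
    by (rule names_Delta2_fun_unique[rotated])
      (use complement_point_open points_cauchy_rep in \<open>auto intro!: bexI[of _ "M - {_}"]\<close>)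
qed

end

end

(*
  From Delta-2 to piecewise continuous: from a name of f^-1 we get, for every sequence q of balls of
  Y with union U(q), open sets D(q,i) with intersection f^-1(U(q)), continuously in q.  Given a finite
  set B of balls and an index i, let E(k) be D(B + ball k, i); it contains x whenever ball k contains
  f x.  The x for which no two balls k, k' of equal radius with x in E(k) and E(k') lie far apart form
  a closed set, and on it every k with x in E(k) locates f x up to twice the radius, so f is computable
  there.  By a Baire category argument in the space of sequences q these closed sets cover X.

  From piecewise continuous to Delta-2: the preimage of U is the intersection of the open sets
  (X - A_j) Un f_j^-1(U).  It is also the union of the closed sets of those x in A_j that have a name
  with a prescribed finite beginning on which the machine for f_j^-1(U) already accepts.
*)
theory Submission
  imports Defs
begin

section \<open>Uniformly computable families\<close>

text \<open>The open sets D(q,i) depend on the sequence q and not merely on the union U(q), and a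
  single D(q,i) may be much larger than the preimage. So for arbitrary B and i, membership of x in
  E(k) says nothing reliable about f x. Balls are added only with indices at least n, so that the
  bits fixed earlier, and with them the memberships already forced, survive. Radii are compared only
  when equal: a ball around f x then refutes any misleading ball, and this gives the factor two in
  the error.

  In the other direction the machine for f_j may diverge off A_j, so it is run only for bounded
  time. Demanding half of the permitted error makes this true, because any such word can be
  prolonged by good approximations; the demand is a non-strict bound on distances and hence a closed
  condition.\<close>

abbreviation pe :: "nat \<Rightarrow> nat \<Rightarrow> nat" where
  "pe x y \<equiv> prod_encode (x, y)"

abbreviation pfst :: "nat \<Rightarrow> nat" where
  "pfst n \<equiv> fst (prod_decode n)"

abbreviation psnd :: "nat \<Rightarrow> nat" where
  "psnd n \<equiv> snd (prod_decode n)"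

lemma pe_pfst_psnd [simp]: "pe (pfst n) (psnd n) = n"
  by simp

text \<open>
  In \<open>ucomp W G I F\<close> the set \<open>W\<close> consists of worlds; one program computes, in every world \<open>w\<close>, the
  number \<open>F w\<close> from the oracle \<open>G w\<close> and the input \<open>I w\<close>.  Hypotheses on the oracle and the
  input are expressed by the choice of \<open>W\<close>.
\<close>

definition ucomp :: "'w set \<Rightarrow> ('w \<Rightarrow> cantor) \<Rightarrow> ('w \<Rightarrow> nat) \<Rightarrow> ('w \<Rightarrow> nat) \<Rightarrow> bool" where
  "ucomp W G I F \<longleftrightarrow> (\<exists>c. \<forall>w\<in>W. evals (G w) c (I w) (F w))"

definition bcomp :: "'w set \<Rightarrow> ('w \<Rightarrow> cantor) \<Rightarrow> ('w \<Rightarrow> nat) \<Rightarrow> ('w \<Rightarrow> cantor) \<Rightarrow> bool" where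
  "bcomp W G I u \<longleftrightarrow> (\<exists>c. \<forall>w\<in>W. \<forall>k. evals (G w) c (pe (I w) k) (of_bool (u w k)))"

text \<open>A bit position becomes part of the world. In this way statements about infinite outputs
  reduce to statements about numbers, see \<open>bcomp_iff\<close>.\<close>

abbreviation (input) lift :: "('w \<Rightarrow> 'v) \<Rightarrow> 'w \<times> nat \<Rightarrow> 'v" where
  "lift G \<equiv> \<lambda>v. G (fst v)"

abbreviation (input) lifti :: "('w \<Rightarrow> nat) \<Rightarrow> 'w \<times> nat \<Rightarrow> nat" where
  "lifti I \<equiv> \<lambda>v. pe (I (fst v)) (snd v)"

lemma bcomp_iff:
  "bcomp W G I u \<longleftrightarrow>
    ucomp (W \<times> UNIV) (lift G) (lifti I) (\<lambda>v. of_bool (u (fst v) (snd v)))"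
  unfolding bcomp_def ucomp_def by auto

lemma ucomp_comp:
  assumes "ucomp W G I H" "ucomp W G H F"
  shows "ucomp W G I F"
  using assms unfolding ucomp_def by (meson evals.comp)

lemma ucomp_reindex:
  assumes "ucomp V H J F" "\<And>w. w \<in> W \<Longrightarrow> \<phi> w \<in> V"
    and "\<And>w. w \<in> W \<Longrightarrow> G w = H (\<phi> w)" "\<And>w. w \<in> W \<Longrightarrow> I w = J (\<phi> w)"
  shows "ucomp W G I (\<lambda>w. F (\<phi> w))"
  using assms unfolding ucomp_def by metis

lemma ucomp_cong:
  assumes "ucomp W G I F" "\<And>w. w \<in> W \<Longrightarrow> F' w = F w"
  shows "ucomp W G I F'"
  using assms unfolding ucomp_def by auto

lemma bcomp_cong:
  assumes "bcomp W G I u" "\<And>w. w \<in> W \<Longrightarrow> u' w = u w"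
  shows "bcomp W G I u'"
  using assms unfolding bcomp_def by auto

lemma ucomp_const: "ucomp W G I (\<lambda>w. n)"
proof -
  have "\<exists>c. \<forall>p i. evals p c i n"
  proof (induction n)
    case 0
    show ?case by (meson evals.zero)
  next
    case (Suc n)
    then show ?case by (meson evals.comp evals.succ)
  qed
  then show ?thesis unfolding ucomp_def by meson
qed

lemma ucomp_pair:
  assumes "ucomp W G I A" "ucomp W G I B"
  shows "ucomp W G I (\<lambda>w. pe (A w) (B w))"
  using assms unfolding ucomp_def by (meson evals.pair)

lemma ucomp_basic:
  assumes "ucomp W G I A"
  shows ucomp_Suc: "ucomp W G I (\<lambda>w. Suc (A w))"
    and ucomp_pfst: "ucomp W G I (\<lambda>w. pfst (A w))"
    and ucomp_psnd: "ucomp W G I (\<lambda>w. psnd (A w))"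
    and ucomp_query: "ucomp W G I (\<lambda>w. of_bool (G w (A w)))"
  using assms unfolding ucomp_def
  by (meson evals.comp evals.succ evals.fst evals.snd evals.query)+

lemma ucomp_input: "ucomp W G I I"
proof -
  have "evals p (CPair CFst CSnd) n n" for p n
    using evals.pair[OF evals.fst evals.snd, of p n] by simp
  then show ?thesis unfolding ucomp_def by blast
qed

lemma ucomp_lift_input: "ucomp W G (lifti I) (\<lambda>v. I (fst v))"
  using ucomp_pfst[OF ucomp_input, of W G "lifti I"] by simp

lemma ucomp_snd: "ucomp W G (lifti I) snd"
  using ucomp_psnd[OF ucomp_input, of W G "lifti I"] by simp

lemma ucomp_lift:
  assumes "ucomp W G I F"
  shows "ucomp (W \<times> UNIV) (lift G) (lifti I) (\<lambda>v. F (fst v))"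
proof (rule ucomp_comp[OF ucomp_lift_input])
  show "ucomp (W \<times> UNIV) (lift G) (\<lambda>v. I (fst v)) (\<lambda>v. F (fst v))"
    by (rule ucomp_reindex[OF assms]) auto
qed

lemma bcomp_query:
  assumes "bcomp W G I u" "ucomp W G I K"
  shows "ucomp W G I (\<lambda>w. of_bool (u w (K w)))"
proof (rule ucomp_comp[OF ucomp_pair[OF ucomp_input assms(2)]])
  show "ucomp W G (\<lambda>w. pe (I w) (K w)) (\<lambda>w. of_bool (u w (K w)))"
    using assms(1) unfolding bcomp_def ucomp_def by blast
qed

lemma bcomp_lift:
  assumes "bcomp W G I u"
  shows "bcomp (W \<times> UNIV) (lift G) (lifti I) (\<lambda>v. u (fst v))"
  unfolding bcomp_iff
proof -
  let ?I' = "lifti (lifti I)"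
  have "ucomp ((W \<times> UNIV) \<times> UNIV) (lift (lift G)) ?I'
      (\<lambda>v. pe (I (fst (fst v))) (snd v))"
    using ucomp_pair[OF ucomp_pfst[OF ucomp_pfst[OF ucomp_input]] ucomp_psnd[OF ucomp_input],
        of "(W \<times> UNIV) \<times> UNIV" "lift (lift G)" ?I'] by simp
  moreover have "ucomp ((W \<times> UNIV) \<times> UNIV) (lift (lift G))
      (\<lambda>v. pe (I (fst (fst v))) (snd v)) (\<lambda>v. of_bool (u (fst (fst v)) (snd v)))"
    using assms unfolding bcomp_def ucomp_def by auto
  ultimately show "ucomp ((W \<times> UNIV) \<times> UNIV) (lift (lift G)) ?I'
      (\<lambda>v. of_bool (u (fst (fst v)) (snd v)))"
    by (rule ucomp_comp)
qed

lemma bcomp_oracle: "bcomp W G I G"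
  using ucomp_query[OF ucomp_snd, of "W \<times> UNIV" "lift G" I] unfolding bcomp_iff by simp

text \<open>\<open>CMu\<close> searches for the value 0, whereas a true bit is 1, so the test must
  be negated first. Negation is derived only later from recursion; it enters as a hypothesis and is
  discharged in \<open>ucomp_Least\<close>.\<close>

lemma ucomp_least:
  assumes "bcomp W G I u" "\<And>w. w \<in> W \<Longrightarrow> \<exists>k. u w k"
    and not: "ucomp (UNIV :: (cantor \<times> nat) set) fst snd (\<lambda>w. of_bool (snd w = 0))"
  shows "ucomp W G I (\<lambda>w. LEAST k. u w k)"
proof -
  obtain n where n: "\<And>p k. evals p n k (of_bool (k = 0))"
    using not unfolding ucomp_def by auto
  obtain c where c: "\<And>w k. w \<in> W \<Longrightarrow> evals (G w) c (pe (I w) k) (of_bool (u w k))"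
    using assms(1) unfolding bcomp_def by blast
  have neg: "evals (G w) (CComp n c) (pe (I w) k) (of_bool (\<not> u w k))" if "w \<in> W" for w k
    using evals.comp[OF c[OF that] n, of k] by simp
  have "evals (G w) (CMu (CComp n c)) (I w) (LEAST k. u w k)" if w: "w \<in> W" for w
  proof (rule evals.mu)
    have "u w (LEAST k. u w k)" using assms(2)[OF w] by (rule LeastI_ex)
    then show "evals (G w) (CComp n c) (pe (I w) (LEAST k. u w k)) 0"
      using neg[OF w, of "LEAST k. u w k"] by simp
  next
    fix j assume "j < (LEAST k. u w k)"
    then have "\<not> u w j" by (rule not_less_Least)
    then show "\<exists>y. y \<noteq> 0 \<and> evals (G w) (CComp n c) (pe (I w) j) y"
      using neg[OF w, of j] by auto
  qed
  then show ?thesis unfolding ucomp_def by blast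
qed

text \<open>Iteration of one function on states, where the parameters travel inside the state. The
  arithmetic below is obtained by iterating on pairs.\<close>

lemma ucomp_rec:
  assumes "ucomp (UNIV :: (cantor \<times> nat) set) fst snd (\<lambda>w. h (fst w) (snd w))"
    and "ucomp W G I X" "ucomp W G I T"
  shows "ucomp W G I (\<lambda>w. (h (G w) ^^ T w) (X w))"
proof -
  obtain c where c: "\<And>p k. evals p c k (h p k)"
    using assms(1) unfolding ucomp_def by auto
  have last: "evals p (CComp CSnd CSnd) (pe x (pe k z)) z" for p x k z
    using evals.comp[OF evals.snd evals.snd, of p "pe x (pe k z)"] by simp
  have ident: "evals p (CPair CFst CSnd) n n" for p n
    using evals.pair[OF evals.fst evals.snd, of p n] by simp
  have "evals p (CPrec (CPair CFst CSnd) (CComp c (CComp CSnd CSnd))) (pe x k) ((h p ^^ k) x)"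
    for p x k
  proof (induction k)
    case 0
    show ?case using evals.prec_0[OF ident] by simp
  next
    case (Suc k)
    show ?case using evals.prec_Suc[OF Suc evals.comp[OF last c]] by simp
  qed
  then have "ucomp W G (\<lambda>w. pe (X w) (T w)) (\<lambda>w. (h (G w) ^^ T w) (X w))"
    unfolding ucomp_def by blast
  then show ?thesis
    by (rule ucomp_comp[OF ucomp_pair[OF assms(2,3)]])
qed

subsection \<open>Arithmetic\<close>

lemma ucomp_if0:
  assumes "ucomp W G I C" "ucomp W G I A" "ucomp W G I B"
  shows "ucomp W G I (\<lambda>w. if C w = 0 then A w else B w)"
proof -
  \<comment> \<open>One application overwrites the first component with the second, and further ones
    change nothing. So the first component remains \<open>A w\<close> exactly if the number of
    iterations is 0.\<close>
  define h :: "cantor \<Rightarrow> nat \<Rightarrow> nat" where "h p n = pe (psnd n) (psnd n)" for p n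
  have "ucomp UNIV fst snd (\<lambda>w. h (fst w) (snd w))"
    unfolding h_def by (intro ucomp_pair ucomp_psnd ucomp_input)
  then have 1: "ucomp W G I (\<lambda>w. pfst ((h (G w) ^^ C w) (pe (A w) (B w))))"
    by (intro ucomp_pfst ucomp_rec ucomp_pair assms)
  have "(h p ^^ Suc k) (pe x y) = pe y y" for p k x y
    by (induction k) (auto simp: h_def)
  then have "pfst ((h p ^^ k) (pe x y)) = (if k = 0 then x else y)" for p k x y
    by (cases k) auto
  with 1 show ?thesis by simp
qed

lemma ucomp_add:
  assumes "ucomp W G I A" "ucomp W G I B"
  shows "ucomp W G I (\<lambda>w. A w + B w)"
proof -
  have "ucomp UNIV fst snd (\<lambda>w :: cantor \<times> nat. (\<lambda>_ n. Suc n) (fst w) (snd w))"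
    by (intro ucomp_Suc ucomp_input)
  from ucomp_rec[OF this assms] show ?thesis by (simp add: add.commute)
qed

lemma ucomp_pred:
  assumes "ucomp W G I A"
  shows "ucomp W G I (\<lambda>w. A w - 1)"
proof -
  define h :: "cantor \<Rightarrow> nat \<Rightarrow> nat" where "h p n = pe (Suc (pfst n)) (pfst n)" for p n
  have "ucomp UNIV fst snd (\<lambda>w. h (fst w) (snd w))"
    unfolding h_def by (intro ucomp_pair ucomp_pfst ucomp_Suc ucomp_input)
  then have "ucomp W G I (\<lambda>w. psnd ((h (G w) ^^ A w) (pe 0 0)))"
    by (intro ucomp_psnd ucomp_rec assms ucomp_const)
  moreover have "(h p ^^ k) (pe 0 0) = pe k (k - 1)" for p k
    by (induction k) (auto simp: h_def)
  ultimately show ?thesis by simp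
qed

lemma ucomp_diff:
  assumes "ucomp W G I A" "ucomp W G I B"
  shows "ucomp W G I (\<lambda>w. A w - B w)"
proof -
  have "ucomp UNIV fst snd (\<lambda>w :: cantor \<times> nat. (\<lambda>_ n. n - 1) (fst w) (snd w))"
    by (intro ucomp_pred ucomp_input)
  moreover have "((\<lambda>n::nat. n - 1) ^^ k) x = x - k" for k x
    by (induction k) auto
  ultimately show ?thesis using ucomp_rec[OF _ assms, of "\<lambda>_ n. n - 1"] by simp
qed

lemma ucomp_mult:
  assumes "ucomp W G I A" "ucomp W G I B"
  shows "ucomp W G I (\<lambda>w. A w * B w)"
proof -
  define h :: "cantor \<Rightarrow> nat \<Rightarrow> nat" where "h p n = pe (pfst n) (pfst n + psnd n)" for p n
  have "ucomp UNIV fst snd (\<lambda>w. h (fst w) (snd w))"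
    unfolding h_def by (intro ucomp_pair ucomp_add ucomp_pfst ucomp_psnd ucomp_input)
  then have "ucomp W G I (\<lambda>w. psnd ((h (G w) ^^ B w) (pe (A w) 0)))"
    by (intro ucomp_psnd ucomp_rec ucomp_pair assms ucomp_const)
  moreover have "(h p ^^ k) (pe x 0) = pe x (x * k)" for p k x
    by (induction k) (auto simp: h_def)
  ultimately show ?thesis by simp
qed

lemma ucomp_power2:
  assumes "ucomp W G I A"
  shows "ucomp W G I (\<lambda>w. 2 ^ A w)"
proof -
  have "ucomp UNIV fst snd (\<lambda>w :: cantor \<times> nat. (\<lambda>_ n. n + n) (fst w) (snd w))"
    by (intro ucomp_add ucomp_input)
  moreover have "((\<lambda>n::nat. n + n) ^^ k) 1 = 2 ^ k" for k
    by (induction k) auto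
  ultimately show ?thesis
    using ucomp_rec[OF _ ucomp_const[of _ _ _ 1] assms, of "\<lambda>_ n. n + n"] by simp
qed

lemma ucomp_not:
  assumes "ucomp W G I (\<lambda>w. of_bool (P w))"
  shows "ucomp W G I (\<lambda>w. of_bool (\<not> P w))"
  using ucomp_diff[OF ucomp_const[of _ _ _ 1] assms] by (rule ucomp_cong) auto

lemma ucomp_conj:
  assumes "ucomp W G I (\<lambda>w. of_bool (P w))" "ucomp W G I (\<lambda>w. of_bool (Q w))"
  shows "ucomp W G I (\<lambda>w. of_bool (P w \<and> Q w))"
  using ucomp_mult[OF assms] by (rule ucomp_cong) auto

lemma ucomp_disj:
  assumes "ucomp W G I (\<lambda>w. of_bool (P w))" "ucomp W G I (\<lambda>w. of_bool (Q w))"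
  shows "ucomp W G I (\<lambda>w. of_bool (P w \<or> Q w))"
  using ucomp_not[OF ucomp_conj[OF ucomp_not[OF assms(1)] ucomp_not[OF assms(2)]]]
  by (rule ucomp_cong) auto

lemma ucomp_eq_0:
  assumes "ucomp W G I A"
  shows "ucomp W G I (\<lambda>w. of_bool (A w = 0))"
  using ucomp_if0[OF assms ucomp_const[of _ _ _ 1] ucomp_const[of _ _ _ 0]]
  by (rule ucomp_cong) auto

lemma ucomp_le:
  assumes "ucomp W G I A" "ucomp W G I B"
  shows "ucomp W G I (\<lambda>w. of_bool (A w \<le> B w))"
  using ucomp_eq_0[OF ucomp_diff[OF assms]] by (rule ucomp_cong) auto

lemma ucomp_less:
  assumes "ucomp W G I A" "ucomp W G I B"
  shows "ucomp W G I (\<lambda>w. of_bool (A w < B w))"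
  using ucomp_not[OF ucomp_le[OF assms(2,1)]] by (rule ucomp_cong) auto

lemma ucomp_eq:
  assumes "ucomp W G I A" "ucomp W G I B"
  shows "ucomp W G I (\<lambda>w. of_bool (A w = B w))"
  using ucomp_conj[OF ucomp_le[OF assms] ucomp_le[OF assms(2,1)]] by (rule ucomp_cong) auto

lemma ucomp_if:
  assumes "ucomp W G I (\<lambda>w. of_bool (P w))" "ucomp W G I A" "ucomp W G I B"
  shows "ucomp W G I (\<lambda>w. if P w then A w else B w)"
  using ucomp_if0[OF assms(1,3,2)] by (rule ucomp_cong) auto

lemma ucomp_divmod:
  assumes "ucomp W G I A" "m > 0"
  shows ucomp_div: "ucomp W G I (\<lambda>w. A w div m)" and ucomp_mod: "ucomp W G I (\<lambda>w. A w mod m)"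
proof -
  define h :: "cantor \<Rightarrow> nat \<Rightarrow> nat" where
    "h p n = (if Suc (psnd n) = m then pe (Suc (pfst n)) 0 else pe (pfst n) (Suc (psnd n)))" for p n
  have "ucomp UNIV fst snd (\<lambda>w. h (fst w) (snd w))"
    unfolding h_def
    by (intro ucomp_if ucomp_eq ucomp_pair ucomp_Suc ucomp_pfst ucomp_psnd ucomp_input ucomp_const)
  then have 1: "ucomp W G I (\<lambda>w. (h (G w) ^^ A w) (pe 0 0))"
    by (intro ucomp_rec assms ucomp_const)
  have 2: "(h p ^^ k) (pe 0 0) = pe (k div m) (k mod m)" for p k
  proof (induction k)
    case (Suc k)
    then show ?case by (simp add: h_def div_Suc mod_Suc)
  qed simp
  show "ucomp W G I (\<lambda>w. A w div m)" "ucomp W G I (\<lambda>w. A w mod m)"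
    using ucomp_pfst[OF 1] ucomp_psnd[OF 1] unfolding 2 by simp_all
qed

lemma ucomp_even:
  assumes "ucomp W G I A"
  shows "ucomp W G I (\<lambda>w. of_bool (even (A w)))"
  using ucomp_eq_0[OF ucomp_mod[OF assms, of 2]] by (simp add: even_iff_mod_2_eq_zero)

lemma ucomp_half:
  assumes "ucomp W G I A"
  shows "ucomp W G I (\<lambda>w. A w div 2)"
  using assms by (rule ucomp_div) simp

lemmas ucomp_Least = ucomp_least[OF _ _ ucomp_eq_0[OF ucomp_input]]

lemmas ucomp_intros = ucomp_const ucomp_pair ucomp_Suc ucomp_pfst ucomp_psnd ucomp_if
  ucomp_add ucomp_diff ucomp_mult ucomp_power2 ucomp_not ucomp_conj ucomp_disj ucomp_le
  ucomp_less ucomp_eq ucomp_even ucomp_half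

subsection \<open>Change of oracle\<close>

text \<open>\<open>P\<close> holds on a neighbourhood of \<open>p\<close> in Cantor space.\<close>

definition finite_use :: "cantor \<Rightarrow> (cantor \<Rightarrow> bool) \<Rightarrow> bool" where
  "finite_use p P \<longleftrightarrow> (\<exists>L. \<forall>q. (\<forall>k<L. q k = p k) \<longrightarrow> P q)"

lemma finite_use_always: "(\<And>q. P q) \<Longrightarrow> finite_use p P"
  unfolding finite_use_def by blast

lemma finite_use_mono:
  assumes "finite_use p P" "\<And>q. P q \<Longrightarrow> Q q"
  shows "finite_use p Q"
  using assms unfolding finite_use_def by blast

lemma finite_use_combine:
  assumes "finite_use p P" "finite_use p Q" and R: "\<And>q. P q \<Longrightarrow> Q q \<Longrightarrow> R q"
  shows "finite_use p R"
proof -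
  obtain L L' where "\<And>q. \<forall>k<L. q k = p k \<Longrightarrow> P q" "\<And>q. \<forall>k<L'. q k = p k \<Longrightarrow> Q q"
    using assms(1,2) unfolding finite_use_def by blast
  then have "R q" if "\<forall>k < max L L'. q k = p k" for q
    using that by (intro R) simp_all
  then show ?thesis unfolding finite_use_def by blast
qed

lemma finite_use_all_less:
  fixes k :: nat
  assumes "\<And>j. j < k \<Longrightarrow> finite_use p (P j)"
  shows "finite_use p (\<lambda>q. \<forall>j<k. P j q)"
  using assms
proof (induction k)
  case 0
  show ?case by (simp add: finite_use_def)
next
  case (Suc k)
  have "finite_use p (\<lambda>q. \<forall>j<k. P j q)" using Suc by simp
  then show ?case
    by (rule finite_use_combine[OF _ Suc.prems[OF lessI]]) (simp add: less_Suc_eq)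
qed

text \<open>A halting computation reads only finitely many bits of the oracle (the use principle). A
  minimisation has finitely many subcomputations, one for each candidate up to the result.\<close>

lemma evals_finite_use: "evals p c n m \<Longrightarrow> finite_use p (\<lambda>q. evals q c n m)"
proof (induction rule: evals.induct)
  case (query n)
  have "evals q COracle n (of_bool (p n))" if "q n = p n" for q
    using evals.query[of q n] that by (simp only:)
  then have "\<forall>q. (\<forall>k<Suc n. q k = p k) \<longrightarrow> evals q COracle n (of_bool (p n))"
    by simp
  then show ?case unfolding finite_use_def by (rule exI)
next
  case (pair f n x g y)
  show ?case by (rule finite_use_combine[OF pair.IH]) (rule evals.pair)
next
  case (comp g n x f y)
  show ?case by (rule finite_use_combine[OF comp.IH]) (rule evals.comp)
next
  case (prec_0 f x y g)
  show ?case by (rule finite_use_mono[OF prec_0.IH evals.prec_0])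
next
  case (prec_Suc f g x k z y)
  show ?case by (rule finite_use_combine[OF prec_Suc.IH]) (rule evals.prec_Suc)
next
  case (mu f n k)
  have "finite_use p (\<lambda>q. \<exists>y. y \<noteq> 0 \<and> evals q f (pe n j) y)" if j: "j < k" for j
  proof -
    obtain y where y: "y \<noteq> 0" "finite_use p (\<lambda>q. evals q f (pe n j) y)"
      using mu.IH(2)[OF j] by (elim exE conjE)
    show ?thesis by (rule finite_use_mono[OF y(2)]) (rule exI[of _ y], simp add: y(1))
  qed
  then have "finite_use p (\<lambda>q. \<forall>j<k. \<exists>y. y \<noteq> 0 \<and> evals q f (pe n j) y)"
    by (rule finite_use_all_less)
  then show ?case
    by (rule finite_use_combine[OF mu.IH(1)]) (rule evals.mu, assumption, elim allE impE)
next
  case (zero n)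
  show ?case by (rule finite_use_always) (rule evals.zero)
next
  case (succ n)
  show ?case by (rule finite_use_always) (rule evals.succ)
next
  case (fst n)
  show ?case by (rule finite_use_always) (rule evals.fst)
next
  case (snd n)
  show ?case by (rule finite_use_always) (rule evals.snd)
qed

text \<open>
  If \<open>o\<close> computes the bits of an oracle from a parameter, then \<open>relocate o c\<close> runs \<open>c\<close> with that
  oracle.  The parameter is the first component of every input.
\<close>

fun relocate :: "code \<Rightarrow> code \<Rightarrow> code" where
  "relocate o' CZero = CZero"
| "relocate o' CSucc = CComp CSucc CSnd"
| "relocate o' CFst = CComp CFst CSnd"
| "relocate o' CSnd = CComp CSnd CSnd"
| "relocate o' COracle = o'"
| "relocate o' (CPair f g) = CPair (relocate o' f) (relocate o' g)"
| "relocate o' (CComp f g) = CComp (relocate o' f) (CPair CFst (relocate o' g))"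
| "relocate o' (CPrec f g) = CComp
    (CPrec (relocate o' f) (CComp (relocate o' g)
      (CPair (CComp CFst CFst) (CPair (CComp CSnd CFst) CSnd))))
    (CPair (CPair CFst (CComp CFst CSnd)) (CComp CSnd CSnd))"
| "relocate o' (CMu f) = CMu (CComp (relocate o' f)
    (CPair (CComp CFst CFst) (CPair (CComp CSnd CFst) CSnd)))"

lemma evals_pe: "evals p CFst (pe x y) x" "evals p CSnd (pe x y) y"
  using evals.fst[of p "pe x y"] evals.snd[of p "pe x y"] by simp_all

lemma evals_CComp:
  assumes "evals p (CComp f g) n y"
  obtains x where "evals p g n x" "evals p f x y"
  using assms by cases auto

text \<open>\<open>CPrec\<close> and \<open>CMu\<close> append their counter on the right, while
  \<open>relocate\<close> wants the parameter to stay the first component. These programs change the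
  bracketing accordingly.\<close>

lemma evals_assoc:
  "evals p (CPair (CComp CFst CFst) (CPair (CComp CSnd CFst) CSnd)) (pe (pe i n) k) (pe i (pe n k))"
  "evals p (CPair (CPair CFst (CComp CFst CSnd)) (CComp CSnd CSnd)) (pe i (pe n k)) (pe (pe i n) k)"
  by (rule evals.pair evals.comp evals_pe)+

lemma evals_relocate:
  assumes "evals q c n m" "\<And>k. evals p o' (pe i k) (of_bool (q k))"
  shows "evals p (relocate o' c) (pe i n) m"
  using assms(1)
proof (induction rule: evals.induct)
  case (prec_0 f x y g)
  show ?case unfolding relocate.simps
    by (rule evals.comp[OF evals_assoc(2) evals.prec_0[OF prec_0.IH]])
next
  case (prec_Suc f g x k z y)
  let ?f = "relocate o' f" and
    ?g = "CComp (relocate o' g) (CPair (CComp CFst CFst) (CPair (CComp CSnd CFst) CSnd))"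
  obtain a where a: "evals p (CPair (CPair CFst (CComp CFst CSnd)) (CComp CSnd CSnd)) (pe i (pe x k)) a"
    "evals p (CPrec ?f ?g) a z"
    using prec_Suc.IH(1) unfolding relocate.simps by (blast elim: evals_CComp)
  have "a = pe (pe i x) k" using a(1) evals_assoc(2) by (rule evals_det)
  then have "evals p (CPrec ?f ?g) (pe (pe i x) (Suc k)) y"
    using a(2) evals.comp[OF evals_assoc(1) prec_Suc.IH(2)] by (auto intro: evals.prec_Suc)
  then show ?case unfolding relocate.simps by (rule evals.comp[OF evals_assoc(2)])
next
  case (mu f n k)
  show ?case unfolding relocate.simps
  proof (rule evals.mu)
    show "evals p (CComp (relocate o' f) (CPair (CComp CFst CFst) (CPair (CComp CSnd CFst) CSnd)))
        (pe (pe i n) k) 0"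
      by (rule evals.comp[OF evals_assoc(1) mu.IH(1)])
  next
    fix j assume "j < k"
    then show "\<exists>y. y \<noteq> 0 \<and> evals p (CComp (relocate o' f)
        (CPair (CComp CFst CFst) (CPair (CComp CSnd CFst) CSnd))) (pe (pe i n) j) y"
      using mu.IH(2) evals.comp[OF evals_assoc(1)] by blast
  qed
next
  case (pair f n x g y)
  then show ?case by (simp add: evals.pair)
next
  case (comp g n x f y)
  have "evals p (CPair CFst (relocate o' g)) (pe i n) (pe i x)"
    by (rule evals.pair[OF evals_pe(1) comp.IH(1)])
  then show ?case unfolding relocate.simps using comp.IH(2) by (rule evals.comp)
next
  case (query n)
  then show ?case using assms(2) by simp
next
  case (zero n)
  show ?case by (simp add: evals.zero)
next
  case (succ n)
  show ?case by (simp add: evals.comp[OF evals_pe(2) evals.succ])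
next
  case (fst n)
  show ?case by (simp add: evals.comp[OF evals_pe(2) evals.fst])
next
  case (snd n)
  show ?case by (simp add: evals.comp[OF evals_pe(2) evals.snd])
qed

text \<open>Each query to the new oracle is answered by computing the bit from \<open>I w\<close>,
  which serves as the parameter of \<open>relocate\<close>. This is how computed names become
  oracles of further machines.\<close>

lemma ucomp_oracle:
  assumes "ucomp V H J F" "\<And>w. w \<in> W \<Longrightarrow> \<phi> w \<in> V"
    and "bcomp W G I (\<lambda>w. H (\<phi> w))" "ucomp W G I (\<lambda>w. J (\<phi> w))"
  shows "ucomp W G I (\<lambda>w. F (\<phi> w))"
proof -
  obtain c where c: "\<And>v. v \<in> V \<Longrightarrow> evals (H v) c (J v) (F v)"
    using assms(1) unfolding ucomp_def by blast
  obtain o' where o': "\<And>w k. w \<in> W \<Longrightarrow> evals (G w) o' (pe (I w) k) (of_bool (H (\<phi> w) k))"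
    using assms(3) unfolding bcomp_def by blast
  have "ucomp W G (\<lambda>w. pe (I w) (J (\<phi> w))) (\<lambda>w. F (\<phi> w))"
    unfolding ucomp_def
    by (intro exI[of _ "relocate o' c"] ballI evals_relocate[OF c[OF assms(2)] o'])
  then show ?thesis
    by (rule ucomp_comp[OF ucomp_pair[OF ucomp_input assms(4)]])
qed

lemma bcompI:
  assumes "ucomp (W \<times> UNIV) (lift G) (lifti I) (\<lambda>v. of_bool (u (fst v) (snd v)))"
  shows "bcomp W G I u"
  using assms unfolding bcomp_iff .

lemma bcomp_index: "bcomp W G I u \<Longrightarrow> ucomp (W \<times> UNIV) (lift G) (lifti I) A \<Longrightarrow>
    ucomp (W \<times> UNIV) (lift G) (lifti I) (\<lambda>v. of_bool (u (fst v) (A v)))"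
  using bcomp_query[OF bcomp_lift] .

lemma bcomp_evens:
  assumes "bcomp W G I u"
  shows "bcomp W G I (\<lambda>w. evens (u w))"
  unfolding evens_def
  by (intro bcompI bcomp_index[OF assms] ucomp_intros ucomp_snd)

lemma bcomp_odds:
  assumes "bcomp W G I u"
  shows "bcomp W G I (\<lambda>w. odds (u w))"
  unfolding odds_def
  by (intro bcompI bcomp_index[OF assms] ucomp_intros ucomp_snd)

lemma bcomp_interleave:
  assumes "bcomp W G I u" "bcomp W G I v"
  shows "bcomp W G I (\<lambda>w. interleave (u w) (v w))"
proof (rule bcompI)
  have "ucomp (W \<times> UNIV) (lift G) (lifti I) (\<lambda>x. if even (snd x)
      then of_bool (u (fst x) (snd x div 2)) else of_bool (v (fst x) (snd x div 2)))"
    by (intro ucomp_if bcomp_index[OF assms(1)] bcomp_index[OF assms(2)] ucomp_even ucomp_half ucomp_snd)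
  then show "ucomp (W \<times> UNIV) (lift G) (lifti I)
      (\<lambda>x. of_bool (interleave (u (fst x)) (v (fst x)) (snd x)))"
    by (rule ucomp_cong) (simp add: interleave_def)
qed

lemma bcomp_unary_prefix:
  assumes "ucomp W G I N" "bcomp W G I u"
  shows "bcomp W G I (\<lambda>w. unary_prefix (N w) (u w))"
proof (rule bcompI)
  have "ucomp (W \<times> UNIV) (lift G) (lifti I) (\<lambda>x. of_bool (snd x = N (fst x) \<or>
      (N (fst x) < snd x \<and> u (fst x) (snd x - N (fst x) - 1))))"
    by (intro ucomp_intros bcomp_index[OF assms(2)] ucomp_snd ucomp_lift[OF assms(1)])
  then show "ucomp (W \<times> UNIV) (lift G) (lifti I)
      (\<lambda>x. of_bool (unary_prefix (N (fst x)) (u (fst x)) (snd x)))"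
    by (rule ucomp_cong) (simp add: unary_prefix_def)
qed

lemma bcomp_False: "bcomp W G I (\<lambda>w _. False)"
  by (intro bcompI) (simp add: ucomp_const)

lemma unary_prefix_Least: "(LEAST k. unary_prefix n q k) = n"
  by (rule Least_equality) (auto simp: unary_prefix_def split: if_splits intro: leI)

lemma ucomp_unary_prefix_Least:
  assumes "bcomp W G I (\<lambda>w. unary_prefix (N w) (u w))"
  shows "ucomp W G I N"
proof -
  have "unary_prefix n q n" for n q by (simp add: unary_prefix_def)
  then have "ucomp W G I (\<lambda>w. LEAST k. unary_prefix (N w) (u w) k)"
    by (intro ucomp_Least[OF assms]) auto
  then show ?thesis by (simp add: unary_prefix_Least)
qed

lemma bcomp_unary_prefix_tail:
  assumes "bcomp W G I (\<lambda>w. unary_prefix (N w) (u w))"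
  shows "bcomp W G I u"
proof (rule bcompI)
  have "ucomp (W \<times> UNIV) (lift G) (lifti I)
      (\<lambda>x. of_bool (unary_prefix (N (fst x)) (u (fst x)) (N (fst x) + 1 + snd x)))"
    by (intro ucomp_intros bcomp_index[OF assms] ucomp_snd
        ucomp_lift[OF ucomp_unary_prefix_Least[OF assms]])
  then show "ucomp (W \<times> UNIV) (lift G) (lifti I) (\<lambda>v. of_bool (u (fst v) (snd v)))"
    by (simp add: unary_prefix_def)
qed

section \<open>A universal machine\<close>

text \<open>An interpreter with an explicit stack: a frame is a context waiting for a value. A
  single step is then a simple operation on numbers, and a run is an iteration of it.\<close>

datatype frame =
    FPairL code nat | FPairR nat | FComp code | FPrec code nat nat | FMu code nat nat

datatype config = Ev code nat "frame list" | Rt nat "frame list"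

text \<open>Oracle queries at positions \<open>\<ge> L\<close> block the machine.\<close>

fun step :: "cantor \<Rightarrow> nat \<Rightarrow> config \<Rightarrow> config" where
  "step p L (Ev CZero n K) = Rt 0 K"
| "step p L (Ev CSucc n K) = Rt (Suc n) K"
| "step p L (Ev CFst n K) = Rt (pfst n) K"
| "step p L (Ev CSnd n K) = Rt (psnd n) K"
| "step p L (Ev COracle n K) = (if n < L then Rt (of_bool (p n)) K else Ev COracle n K)"
| "step p L (Ev (CPair f g) n K) = Ev f n (FPairL g n # K)"
| "step p L (Ev (CComp f g) n K) = Ev g n (FComp f # K)"
| "step p L (Ev (CPrec f g) n K) = (if psnd n = 0 then Ev f (pfst n) K
    else Ev (CPrec f g) (pe (pfst n) (psnd n - 1)) (FPrec g (pfst n) (psnd n - 1) # K))"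
| "step p L (Ev (CMu f) n K) = Ev f (pe n 0) (FMu f n 0 # K)"
| "step p L (Rt v []) = Rt v []"
| "step p L (Rt v (FPairL g n # K)) = Ev g n (FPairR v # K)"
| "step p L (Rt v (FPairR u # K)) = Rt (pe u v) K"
| "step p L (Rt v (FComp f # K)) = Ev f v K"
| "step p L (Rt v (FPrec g x k # K)) = Ev g (pe x (pe k v)) K"
| "step p L (Rt v (FMu f n k # K)) =
    (if v = 0 then Rt k K else Ev f (pe n (Suc k)) (FMu f n (Suc k) # K))"

text \<open>The number \<open>t\<close> bounds the steps and also the oracle positions that may be
  read, so the result depends only on the first \<open>t\<close> bits of \<open>p\<close>. A
  positive result is the output plus one; 0 means that there is no output yet.\<close>

definition brun :: "cantor \<Rightarrow> nat \<Rightarrow> code \<Rightarrow> nat \<Rightarrow> nat" where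
  "brun p t c n = (case (step p t ^^ t) (Ev c n []) of Rt v [] \<Rightarrow> Suc v | _ \<Rightarrow> 0)"

lemma step_local: "(\<And>k. k < L \<Longrightarrow> p k = q k) \<Longrightarrow> step p L s = step q L s"
  by (cases "(p, L, s)" rule: step.cases) auto

lemma brun_local:
  assumes "\<And>k. k < t \<Longrightarrow> p k = q k"
  shows "brun p t c n = brun q t c n"
proof -
  have "step p t = step q t"
    by (rule ext) (rule step_local[OF assms])
  then show ?thesis by (simp add: brun_def)
qed

subsection \<open>Completeness\<close>

text \<open>The number of steps must be the same for all large \<open>L\<close>: then runs can be
  concatenated, and in \<open>brun_complete\<close> a common value can be taken for bound and time,
  since \<open>Rt m []\<close> is stationary.\<close>

definition reach :: "cantor \<Rightarrow> config \<Rightarrow> config \<Rightarrow> bool" where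
  "reach p s s' \<longleftrightarrow> (\<exists>L0 t. \<forall>L\<ge>L0. (step p L ^^ t) s = s')"

lemma reach_trans [trans]:
  assumes "reach p s s'" "reach p s' s''"
  shows "reach p s s''"
proof -
  obtain L0 t L1 t' where "\<forall>L\<ge>L0. (step p L ^^ t) s = s'" "\<forall>L\<ge>L1. (step p L ^^ t') s' = s''"
    using assms unfolding reach_def by blast
  then have "\<forall>L\<ge>max L0 L1. (step p L ^^ (t' + t)) s = s''"
    by (simp add: funpow_add)
  then show ?thesis unfolding reach_def by blast
qed

lemma reach_step:
  assumes "\<And>L. B \<le> L \<Longrightarrow> step p L s = s'"
  shows "reach p s s'"
proof -
  have "\<forall>L\<ge>B. (step p L ^^ 1) s = s'" using assms by simp
  then show "reach p s s'" unfolding reach_def by blast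
qed

lemma evals_reach: "evals p c n m \<Longrightarrow> reach p (Ev c n K) (Rt m K)"
proof (induction arbitrary: K rule: evals.induct)
  case (query n)
  show ?case by (rule reach_step[where B = "Suc n"]) simp
next
  case (pair f n x g y)
  have "reach p (Ev (CPair f g) n K) (Ev f n (FPairL g n # K))" by (rule reach_step) simp
  also note pair.IH(1)
  also have "reach p (Rt x (FPairL g n # K)) (Ev g n (FPairR x # K))" by (rule reach_step) simp
  also note pair.IH(2)
  also have "reach p (Rt y (FPairR x # K)) (Rt (pe x y) K)" by (rule reach_step) simp
  finally show ?case .
next
  case (comp g n x f y)
  have "reach p (Ev (CComp f g) n K) (Ev g n (FComp f # K))" by (rule reach_step) simp
  also note comp.IH(1)
  also have "reach p (Rt x (FComp f # K)) (Ev f x K)" by (rule reach_step) simp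
  also note comp.IH(2)
  finally show ?case .
next
  case (prec_0 f x y g)
  have "reach p (Ev (CPrec f g) (pe x 0) K) (Ev f x K)" by (rule reach_step) simp
  also note prec_0.IH
  finally show ?case .
next
  case (prec_Suc f g x k z y)
  have "reach p (Ev (CPrec f g) (pe x (Suc k)) K) (Ev (CPrec f g) (pe x k) (FPrec g x k # K))"
    by (rule reach_step) simp
  also note prec_Suc.IH(1)
  also have "reach p (Rt z (FPrec g x k # K)) (Ev g (pe x (pe k z)) K)" by (rule reach_step) simp
  also note prec_Suc.IH(2)
  finally show ?case .
next
  case (mu f n k)
  have "j \<le> k \<Longrightarrow> reach p (Ev (CMu f) n K) (Ev f (pe n j) (FMu f n j # K))" for j
  proof (induction j)
    case 0
    show ?case by (rule reach_step) simp
  next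
    case (Suc j)
    then have "j < k" by simp
    from mu.IH(2)[OF this] obtain y where y: "y \<noteq> 0" "\<forall>K. reach p (Ev f (pe n j) K) (Rt y K)"
      by (elim exE conjE)
    have "reach p (Ev (CMu f) n K) (Ev f (pe n j) (FMu f n j # K))" using Suc by simp
    also note y(2)[rule_format]
    also have "reach p (Rt y (FMu f n j # K)) (Ev f (pe n (Suc j)) (FMu f n (Suc j) # K))"
      using y(1) by (intro reach_step) simp
    finally show ?case .
  qed
  from this[OF order_refl]
  have "reach p (Ev (CMu f) n K) (Ev f (pe n k) (FMu f n k # K))" .
  also note mu.IH(1)
  also have "reach p (Rt 0 (FMu f n k # K)) (Rt k K)" by (rule reach_step) simp
  finally show ?case .
next
  case (zero n)
  show ?case by (rule reach_step) simp
next
  case (succ n)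
  show ?case by (rule reach_step) simp
next
  case (fst n)
  show ?case by (rule reach_step) simp
next
  case (snd n)
  show ?case by (rule reach_step) simp
qed

lemma brun_complete:
  assumes "evals p c n m"
  shows "\<exists>t. brun p t c n = Suc m"
proof -
  obtain L0 t where t: "\<forall>L\<ge>L0. (step p L ^^ t) (Ev c n []) = Rt m []"
    using evals_reach[OF assms] unfolding reach_def by blast
  have "(step p L ^^ k) (Rt m []) = Rt m []" for L k by (induction k) auto
  then have "(step p (L0 + t) ^^ (L0 + t)) (Ev c n []) = Rt m []"
    using t by (simp add: funpow_add)
  then show ?thesis unfolding brun_def by (intro exI[of _ "L0 + t"]) simp
qed

subsection \<open>Soundness\<close>

text \<open>
  \<open>kden p K v m\<close>: the stack \<open>K\<close> turns the returned value \<open>v\<close> into the final value \<open>m\<close>.  Each step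
  of the machine reflects the denotation of configurations.
\<close>

fun kden :: "cantor \<Rightarrow> frame list \<Rightarrow> nat \<Rightarrow> nat \<Rightarrow> bool" where
  "kden p [] v m \<longleftrightarrow> v = m"
| "kden p (FPairL g n # K) v m \<longleftrightarrow> (\<exists>w. evals p g n w \<and> kden p K (pe v w) m)"
| "kden p (FPairR u # K) v m \<longleftrightarrow> kden p K (pe u v) m"
| "kden p (FComp f # K) v m \<longleftrightarrow> (\<exists>w. evals p f v w \<and> kden p K w m)"
| "kden p (FPrec g x k # K) v m \<longleftrightarrow> (\<exists>w. evals p g (pe x (pe k v)) w \<and> kden p K w m)"
| "kden p (FMu f n k # K) v m \<longleftrightarrow> (\<exists>k'. kden p K k' m \<and> (if v = 0 then k' = k
    else k < k' \<and> evals p f (pe n k') 0 \<and>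
      (\<forall>j. k < j \<and> j < k' \<longrightarrow> (\<exists>y. y \<noteq> 0 \<and> evals p f (pe n j) y))))"

fun den :: "cantor \<Rightarrow> config \<Rightarrow> nat \<Rightarrow> bool" where
  "den p (Ev c n K) m \<longleftrightarrow> (\<exists>v. evals p c n v \<and> kden p K v m)"
| "den p (Rt v K) m \<longleftrightarrow> kden p K v m"

lemma den_step: "den p (step p L s) m \<Longrightarrow> den p s m"
proof (cases "(p, L, s)" rule: step.cases)
  case (8 p' L' f g n K)
  moreover assume "den p (step p L s) m"
  moreover obtain x k where n: "n = pe x k" by (metis pe_pfst_psnd)
  ultimately show ?thesis
    by (cases k) (auto intro: evals.prec_0 evals.prec_Suc)
next
  case (9 p' L' f n K)
  moreover assume "den p (step p L s) m"
  ultimately obtain v k where v: "evals p f (pe n 0) v" and k: "kden p K k m"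
    "if v = 0 then k = 0 else 0 < k \<and> evals p f (pe n k) 0 \<and>
      (\<forall>j. 0 < j \<and> j < k \<longrightarrow> (\<exists>y. y \<noteq> 0 \<and> evals p f (pe n j) y))"
    by auto
  have "evals p (CMu f) n k"
  proof (rule evals.mu)
    show "evals p f (pe n k) 0" using v k(2) by (auto split: if_splits)
  next
    fix j assume "j < k"
    then show "\<exists>y. y \<noteq> 0 \<and> evals p f (pe n j) y"
      using v k(2) by (cases "j = 0") (auto split: if_splits)
  qed
  then show ?thesis using k(1) 9 by auto
next
  case (15 p' L' v f n k K)
  moreover assume den: "den p (step p L s) m"
  ultimately show ?thesis
  proof (cases "v = 0")
    case False
    then obtain v' k' where v': "evals p f (pe n (Suc k)) v'" and k': "kden p K k' m"
      "if v' = 0 then k' = Suc k else Suc k < k' \<and> evals p f (pe n k') 0 \<and>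
        (\<forall>j. Suc k < j \<and> j < k' \<longrightarrow> (\<exists>y. y \<noteq> 0 \<and> evals p f (pe n j) y))"
      using 15 den by auto
    have "\<exists>y. y \<noteq> 0 \<and> evals p f (pe n j) y" if "k < j" "j < k'" for j
      using v' k'(2) that by (cases "j = Suc k") (auto split: if_splits)
    then have "k < k' \<and> evals p f (pe n k') 0 \<and>
        (\<forall>j. k < j \<and> j < k' \<longrightarrow> (\<exists>y. y \<noteq> 0 \<and> evals p f (pe n j) y))"
      using v' k'(2) by (auto split: if_splits)
    then show ?thesis using False k'(1) 15 by auto
  qed auto
qed (auto intro: evals.intros split: if_splits)

text \<open>The denotation is trivial at the final configuration and is pulled back to the initial
  one along the run by \<open>den_step\<close>.\<close>

lemma brun_sound:
  assumes "brun p t c n = Suc m"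
  shows "evals p c n m"
proof -
  have "(step p L ^^ t) s = Rt m [] \<Longrightarrow> den p s m" for L s
  proof (induction t arbitrary: s)
    case (Suc t)
    have "den p (step p L s) m" using Suc.prems by (intro Suc.IH) (simp add: funpow_swap1)
    then show ?case by (rule den_step)
  qed simp
  moreover have "(step p t ^^ t) (Ev c n []) = Rt m []"
    using assms unfolding brun_def by (auto split: config.splits list.splits)
  ultimately have "den p (Ev c n []) m" .
  then show ?thesis by simp
qed

subsection \<open>The machine on numbers\<close>

text \<open>The tags start at 1, so that 0 codes the empty stack and nothing else;
  \<open>ucomp_brun\<close> recognises termination by this.\<close>

fun enc_stack :: "frame list \<Rightarrow> nat" where
  "enc_stack [] = 0"
| "enc_stack (FPairL g n # K) = pe 1 (pe (pe (code_index g) n) (enc_stack K))"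
| "enc_stack (FPairR u # K) = pe 2 (pe u (enc_stack K))"
| "enc_stack (FComp f # K) = pe 3 (pe (code_index f) (enc_stack K))"
| "enc_stack (FPrec g x k # K) = pe 4 (pe (pe (code_index g) (pe x k)) (enc_stack K))"
| "enc_stack (FMu f n k # K) = pe 5 (pe (pe (code_index f) (pe n k)) (enc_stack K))"

abbreviation nev :: "nat \<Rightarrow> nat \<Rightarrow> nat \<Rightarrow> nat" where
  "nev c n K \<equiv> pe 0 (pe c (pe n K))"

abbreviation nrt :: "nat \<Rightarrow> nat \<Rightarrow> nat" where
  "nrt v K \<equiv> pe 1 (pe v K)"

fun enc :: "config \<Rightarrow> nat" where
  "enc (Ev c n K) = nev (code_index c) n (enc_stack K)"
| "enc (Rt v K) = nrt v (enc_stack K)"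

text \<open>For a compound program with index \<open>c\<close>, the arguments are
  \<open>k = (c - 5) mod 4\<close>, which tells the constructor, and
  \<open>i = (c - 5) div 4\<close>, the index of its components. The whole index \<open>c\<close>
  reappears when \<open>CPrec\<close> calls itself.\<close>

definition ncompound :: "nat \<Rightarrow> nat \<Rightarrow> nat \<Rightarrow> nat \<Rightarrow> nat \<Rightarrow> nat" where
  "ncompound c k i n K =
    (if k = 0 then nev (pfst i) n (pe 1 (pe (pe (psnd i) n) K))
     else if k = 1 then nev (psnd i) n (pe 3 (pe (pfst i) K))
     else if k = 2 then (if psnd n = 0 then nev (pfst i) (pfst n) K
       else nev c (pe (pfst n) (psnd n - 1)) (pe 4 (pe (pe (psnd i) (pe (pfst n) (psnd n - 1))) K)))
     else nev i (pe n 0) (pe 5 (pe (pe i (pe n 0)) K)))"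

definition nev_step :: "cantor \<Rightarrow> nat \<Rightarrow> nat \<Rightarrow> nat \<Rightarrow> nat \<Rightarrow> nat" where
  "nev_step p L c n K =
    (if c = 0 then nrt 0 K else if c = 1 then nrt (Suc n) K else if c = 2 then nrt (pfst n) K
     else if c = 3 then nrt (psnd n) K
     else if c = 4 then (if n < L then nrt (of_bool (p n)) K else nev c n K)
     else ncompound c ((c - 5) mod 4) ((c - 5) div 4) n K)"

definition nrt_step :: "nat \<Rightarrow> nat \<Rightarrow> nat \<Rightarrow> nat \<Rightarrow> nat \<Rightarrow> nat" where
  "nrt_step v K k i R =
    (if k = 0 then nrt v K
     else if k = 1 then nev (pfst i) (psnd i) (pe 2 (pe v R))
     else if k = 2 then nrt (pe i v) R
     else if k = 3 then nev i v R
     else if k = 4 then nev (pfst i) (pe (pfst (psnd i)) (pe (psnd (psnd i)) v)) R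
     else if v = 0 then nrt (psnd (psnd i)) R
     else nev (pfst i) (pe (pfst (psnd i)) (Suc (psnd (psnd i))))
       (pe 5 (pe (pe (pfst i) (pe (pfst (psnd i)) (Suc (psnd (psnd i))))) R)))"

definition nstep :: "cantor \<Rightarrow> nat \<Rightarrow> nat \<Rightarrow> nat" where
  "nstep p L s =
    (if pfst s = 0 then nev_step p L (pfst (psnd s)) (pfst (psnd (psnd s))) (psnd (psnd (psnd s)))
     else nrt_step (pfst (psnd s)) (psnd (psnd s)) (pfst (psnd (psnd s)))
       (pfst (psnd (psnd (psnd s)))) (psnd (psnd (psnd (psnd s)))))"

lemma prod_decode_0: "prod_decode 0 = (0, 0)"
  by (metis prod_encode_inverse prod_encode_prod_decode_aux triangle_0 add_0 prod_decode_aux.simps prod_decode_def zero_le diff_zero)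

lemma nstep_enc: "nstep p L (enc s) = enc (step p L s)"
proof (cases "(p, L, s)" rule: step.cases)
  case (6 p L f g n K)
  have "(code_index (CPair f g) - 5) mod 4 = 0" "(code_index (CPair f g) - 5) div 4 = pe (code_index f) (code_index g)"
    by simp_all
  then show ?thesis using 6 by (simp add: nstep_def nev_step_def ncompound_def del: code_index.simps(6)) simp
next
  case (7 p L f g n K)
  have "(code_index (CComp f g) - 5) mod 4 = 1" "(code_index (CComp f g) - 5) div 4 = pe (code_index f) (code_index g)"
    by simp_all
  then show ?thesis using 7 by (simp add: nstep_def nev_step_def ncompound_def del: code_index.simps(7)) simp
next
  case (8 p L f g n K)
  have "(code_index (CPrec f g) - 5) mod 4 = 2" "(code_index (CPrec f g) - 5) div 4 = pe (code_index f) (code_index g)"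
    by (simp_all, presburger)
  then show ?thesis using 8 by (simp add: nstep_def nev_step_def ncompound_def del: code_index.simps(8)) simp
next
  case (9 p L f n K)
  have "(code_index (CMu f) - 5) mod 4 = 3" "(code_index (CMu f) - 5) div 4 = code_index f"
    by simp_all
  then show ?thesis using 9 by (simp add: nstep_def nev_step_def ncompound_def del: code_index.simps(9)) simp
qed (auto simp: nstep_def nev_step_def nrt_step_def prod_decode_0)

lemma ucomp_ncompound:
  assumes "ucomp W G I C" "ucomp W G I k" "ucomp W G I i" "ucomp W G I N" "ucomp W G I K"
  shows "ucomp W G I (\<lambda>w. ncompound (C w) (k w) (i w) (N w) (K w))"
  unfolding ncompound_def by (intro ucomp_intros assms)

lemma ucomp_nev_step:
  assumes "ucomp W G I L" "ucomp W G I C" "ucomp W G I N" "ucomp W G I K"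
  shows "ucomp W G I (\<lambda>w. nev_step (G w) (L w) (C w) (N w) (K w))"
  unfolding nev_step_def
  by (intro ucomp_intros ucomp_query ucomp_ncompound ucomp_mod ucomp_div assms) auto

lemma ucomp_nrt_step:
  assumes "ucomp W G I v" "ucomp W G I K" "ucomp W G I k" "ucomp W G I i" "ucomp W G I R"
  shows "ucomp W G I (\<lambda>w. nrt_step (v w) (K w) (k w) (i w) (R w))"
  unfolding nrt_step_def by (intro ucomp_intros assms)

lemma ucomp_nstep:
  assumes "ucomp W G I L" "ucomp W G I S"
  shows "ucomp W G I (\<lambda>w. nstep (G w) (L w) (S w))"
  unfolding nstep_def by (intro ucomp_intros ucomp_nev_step ucomp_nrt_step assms)

lemma ucomp_brun:
  assumes "ucomp W G I T" "ucomp W G I (\<lambda>w. code_index (c w))" "ucomp W G I N"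
  shows "ucomp W G I (\<lambda>w. brun (G w) (T w) (c w) (N w))"
proof -
  define h where "h p s = pe (pfst s) (nstep p (pfst s) (psnd s))" for p s
  have "ucomp UNIV fst snd (\<lambda>w. h (fst w) (snd w))"
    unfolding h_def by (intro ucomp_pair ucomp_nstep ucomp_pfst ucomp_psnd ucomp_input)
  then have 1: "ucomp W G I (\<lambda>w. psnd ((h (G w) ^^ T w)
      (pe (T w) (nev (code_index (c w)) (N w) 0))))"
    by (intro ucomp_psnd ucomp_rec ucomp_pair ucomp_const assms)
  have "(h p ^^ k) (pe L (enc s)) = pe L (enc ((step p L ^^ k) s))" for p k L s
    by (induction k) (simp_all add: h_def nstep_enc)
  from this[of _ _ _ "Ev _ _ []"]
  have 2: "psnd ((h p ^^ k) (pe k (nev (code_index c) n 0))) = enc ((step p k ^^ k) (Ev c n []))" for p k c n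
    by simp
  have 3: "ucomp W G I (\<lambda>w. enc ((step (G w) (T w) ^^ T w) (Ev (c w) (N w) [])))"
    (is "ucomp W G I ?S")
    using 1 unfolding 2 .
  have "ucomp W G I (\<lambda>w. if pfst (?S w) = 1 \<and> psnd (psnd (?S w)) = 0
      then Suc (pfst (psnd (?S w))) else 0)"
    by (intro ucomp_intros 3)
  moreover have "pe x y = 0 \<longleftrightarrow> x = 0 \<and> y = 0" for x y
    by (metis prod_decode_0 prod_encode_inverse prod.inject prod_decode_inverse)
  then have "enc_stack K = 0 \<longleftrightarrow> K = []" for K
    by (cases K rule: enc_stack.cases) auto
  then have "(if pfst (enc s) = 1 \<and> psnd (psnd (enc s)) = 0 then Suc (pfst (psnd (enc s))) else 0) =
      (case s of Rt v [] \<Rightarrow> Suc v | _ \<Rightarrow> 0)" for s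
    by (cases s) (auto split: list.splits)
  ultimately show ?thesis unfolding brun_def by simp
qed

text \<open>The program may vary with the world as long as its index is computable: search for a
  time at which the bounded run has halted, and read off the result.\<close>

lemma ucomp_universal:
  assumes code: "ucomp W G I (\<lambda>w. code_index (c w))" and N: "ucomp W G I N"
    and evals: "\<And>w. w \<in> W \<Longrightarrow> evals (G w) (c w) (N w) (F w)"
  shows "ucomp W G I F"
proof -
  let ?halt = "\<lambda>w t. brun (G w) t (c w) (N w) \<noteq> 0"
  have B: "bcomp W G I ?halt"
    by (intro bcompI ucomp_not ucomp_eq_0 ucomp_brun[where G = "lift G"] ucomp_snd
        ucomp_lift[OF code] ucomp_lift[OF N])
  have ex: "\<exists>t. ?halt w t" if w: "w \<in> W" for w
  proof -
    obtain t where "brun (G w) t (c w) (N w) = Suc (F w)"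
      using brun_complete[OF evals[OF w]] ..
    then show ?thesis by (intro exI[of _ t]) simp
  qed
  have "ucomp W G I (\<lambda>w. brun (G w) (LEAST t. ?halt w t) (c w) (N w) - 1)"
    by (intro ucomp_pred ucomp_brun ucomp_Least[OF B ex] code N)
  then show ?thesis
  proof (rule ucomp_cong)
    fix w assume w: "w \<in> W"
    define m where "m = brun (G w) (LEAST t. ?halt w t) (c w) (N w)"
    have "m \<noteq> 0" unfolding m_def using LeastI_ex[OF ex[OF w]] .
    then have "m = Suc (m - 1)" by simp
    from trans[OF m_def[symmetric] this] have "evals (G w) (c w) (N w) (m - 1)"
      by (rule brun_sound)
    then have "F w = m - 1" using evals[OF w] by (rule evals_det[symmetric])
    then show "F w = brun (G w) (LEAST t. ?halt w t) (c w) (N w) - 1"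
      by (simp only: m_def)
  qed
qed

section \<open>Names\<close>

text \<open>Application of a function name to an argument name, detached from the represented
  spaces.\<close>

definition app :: "cantor \<Rightarrow> cantor \<Rightarrow> cantor \<Rightarrow> bool" where
  "app u r s \<longleftrightarrow> (\<exists>c q. u = unary_prefix (code_index c) q \<and> computes c (interleave r q) s)"

text \<open>Evaluation is uniformly computable: the index is read from the prefix of
  \<open>u w\<close> and handed to the universal machine, whose oracle is then replaced by means of
  \<open>ucomp_oracle\<close>. The machines hidden in names need never be mentioned again.\<close>

lemma bcomp_app:
  assumes u: "bcomp W G I u" and r: "bcomp W G I r"
    and app: "\<And>w. w \<in> W \<Longrightarrow> app (u w) (r w) (s w)"
  shows "bcomp W G I s"
proof -
  have "\<forall>w\<in>W. \<exists>c q. u w = unary_prefix (code_index c) q \<and> computes c (interleave (r w) q) (s w)"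
    using app unfolding app_def by blast
  from bchoice[OF this] obtain c where "\<forall>w\<in>W. \<exists>q. u w = unary_prefix (code_index (c w)) q \<and>
      computes (c w) (interleave (r w) q) (s w)" ..
  from bchoice[OF this] obtain q where cq: "\<forall>w\<in>W. u w = unary_prefix (code_index (c w)) (q w) \<and>
      computes (c w) (interleave (r w) (q w)) (s w)" ..
  have "bcomp W G I (\<lambda>w. unary_prefix (code_index (c w)) (q w))"
    by (rule bcomp_cong[OF u]) (simp add: cq)
  then have c: "ucomp W G I (\<lambda>w. code_index (c w))" and q: "bcomp W G I q"
    by (rule ucomp_unary_prefix_Least, rule bcomp_unary_prefix_tail)
  let ?H = "\<lambda>v. interleave (r (fst v)) (q (fst v))"
  let ?J = "\<lambda>v. pe (code_index (c (fst v))) (snd v)"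
  have *: "ucomp (W \<times> UNIV) ?H ?J (\<lambda>v. of_bool (s (fst v) (snd v)))"
  proof (rule ucomp_universal)
    show "ucomp (W \<times> UNIV) ?H ?J (\<lambda>v. code_index (c (fst v)))"
      using ucomp_pfst[OF ucomp_input, of "W \<times> UNIV" ?H ?J] by simp
    show "ucomp (W \<times> UNIV) ?H ?J snd"
      using ucomp_psnd[OF ucomp_input, of "W \<times> UNIV" ?H ?J] by simp
    show "evals (?H v) (c (fst v)) (snd v) (of_bool (s (fst v) (snd v)))"
      if "v \<in> W \<times> UNIV" for v
    proof -
      have "fst v \<in> W" using that by auto
      then have "computes (c (fst v)) (?H v) (s (fst v))" by (rule conjunct2[OF bspec[OF cq]])
      then show ?thesis unfolding computes_def by (rule spec)
    qed
  qed
  show ?thesis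
  proof (rule bcompI, rule ucomp_oracle[where \<phi> = "\<lambda>v. v", OF *])
    show "bcomp (W \<times> UNIV) (lift G) (lifti I) ?H"
      by (rule bcomp_lift[OF bcomp_interleave[OF r q]])
    show "ucomp (W \<times> UNIV) (lift G) (lifti I) ?J"
      by (rule ucomp_pair[OF ucomp_lift[OF c] ucomp_snd])
  qed
qed

lemma bcomp_computes:
  assumes "bcomp W G (\<lambda>_. 0) s"
  shows "\<exists>c. \<forall>w\<in>W. computes c (G w) (s w)"
proof -
  obtain c where c: "\<And>w k. w \<in> W \<Longrightarrow> evals (G w) c (pe 0 k) (of_bool (s w k))"
    using assms unfolding bcomp_def by blast
  have ident: "evals p (CPair CFst CSnd) n n" for p n
    using evals.pair[OF evals.fst evals.snd, of p n] by simp
  have "computes (CComp c (CPair CZero (CPair CFst CSnd))) (G w) (s w)" if "w \<in> W" for w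
    unfolding computes_def
    by (intro allI evals.comp[OF evals.pair[OF evals.zero ident] c[OF that]])
  then show ?thesis by blast
qed

abbreviation unat :: "nat \<Rightarrow> cantor" where
  "unat n \<equiv> unary_prefix n (\<lambda>_. False)"

lemma pointsI: "X p = Some x \<Longrightarrow> x \<in> points X"
  by (auto simp: ran_def)

lemma fun_rep_app:
  assumes "fun_rep X Z p = Some f" "X r = Some x"
  shows "\<exists>s. app p r s \<and> Z s = Some (f x)"
  using assms unfolding fun_rep_eq_Some_iff names_fun_def app_def by blast

lemma fun_rep_intro:
  assumes "f \<in> extensional (points X)"
    and "\<And>r x. X r = Some x \<Longrightarrow> \<exists>s. computes c (interleave r q) s \<and> Z s = Some (f x)"
  shows "fun_rep X Z (unary_prefix (code_index c) q) = Some f"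
  unfolding fun_rep_eq_Some_iff names_fun_def
proof (intro conjI)
  have "f x \<in> points Z" if "x \<in> points X" for x
    using that assms(2) pointsI by (fastforce simp: ran_def)
  then show "f \<in> points X \<rightarrow>\<^sub>E points Z" using assms(1) by (simp add: PiE_iff)
qed (use assms(2) in blast)

lemma fun_rep_nat_app:
  assumes "fun_rep nat_rep Z p = Some s"
  shows "\<exists>t. app p (unat n) t \<and> Z t = Some (s n)"
  using assms by (rule fun_rep_app) (simp add: nat_rep_eq_Some_iff)

lemma points_nat_rep: "points nat_rep = UNIV"
proof -
  have "nat_rep (unat n) = Some n" for n by (simp add: nat_rep_eq_Some_iff)
  then show ?thesis by (auto intro: pointsI)
qed

lemma fun_rep_nat_intro:
  assumes "\<And>n. \<exists>t. computes c (interleave (unat n) q) t \<and> Z t = Some (s n)"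
  shows "fun_rep nat_rep Z (unary_prefix (code_index c) q) = Some s"
  by (rule fun_rep_intro) (use assms in \<open>auto simp: nat_rep_eq_Some_iff points_nat_rep\<close>)

lemma open_rep_app:
  assumes "open_rep X p = Some U" "X r = Some x"
  shows "\<exists>s. app p r s \<and> (x \<in> U \<longleftrightarrow> (\<exists>n. s n))"
proof -
  obtain h where h: "fun_rep X sierpinski_rep p = Some h" "U = {x \<in> points X. h x}"
    using assms(1) unfolding open_rep_def by auto
  from fun_rep_app[OF h(1) assms(2)] show ?thesis
    using pointsI[of X, OF assms(2)] by (auto simp: sierpinski_rep_def h(2))
qed

lemma open_rep_intro:
  assumes "U \<subseteq> points X"
    and "\<And>r x. X r = Some x \<Longrightarrow> \<exists>s. computes c (interleave r q) s \<and> (x \<in> U \<longleftrightarrow> (\<exists>n. s n))"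
  shows "open_rep X (unary_prefix (code_index c) q) = Some U"
proof -
  have "\<exists>s. computes c (interleave r q) s \<and> sierpinski_rep s = Some ((\<lambda>x\<in>points X. x \<in> U) x)"
    if x: "X r = Some x" for r x
  proof -
    obtain s where s: "computes c (interleave r q) s" "x \<in> U \<longleftrightarrow> (\<exists>n. s n)"
      using assms(2)[OF x] by blast
    show ?thesis
      by (intro exI[of _ s]) (use s pointsI[of X, OF x] in \<open>simp add: sierpinski_rep_def\<close>)
  qed
  then have "fun_rep X sierpinski_rep (unary_prefix (code_index c) q) = Some (\<lambda>x\<in>points X. x \<in> U)"
    by (intro fun_rep_intro) auto
  then show ?thesis using assms(1) by (auto simp: open_rep_def)
qed

lemma closed_rep_app:
  assumes "closed_rep X p = Some A" "X r = Some x"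
  shows "\<exists>s. app p r s \<and> (x \<notin> A \<longleftrightarrow> (\<exists>n. s n))"
proof -
  obtain U where U: "open_rep X p = Some U" "A = points X - U"
    using assms(1) unfolding closed_rep_def by auto
  show ?thesis using open_rep_app[OF U(1) assms(2)] pointsI[of X, OF assms(2)] U(2) by auto
qed

lemma closed_rep_intro:
  assumes "A \<subseteq> points X"
    and "\<And>r x. X r = Some x \<Longrightarrow> \<exists>s. computes c (interleave r q) s \<and> (x \<notin> A \<longleftrightarrow> (\<exists>n. s n))"
  shows "closed_rep X (unary_prefix (code_index c) q) = Some A"
proof -
  have "open_rep X (unary_prefix (code_index c) q) = Some (points X - A)"
  proof (rule open_rep_intro)
    fix r x assume x: "X r = Some x"
    show "\<exists>s. computes c (interleave r q) s \<and> (x \<in> points X - A \<longleftrightarrow> (\<exists>n. s n))"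
      using assms(2)[OF x] pointsI[of X, OF x] by simp
  qed blast
  then show ?thesis using assms(1) by (auto simp: closed_rep_def)
qed

lemma prod_rep_eq_Some_iff:
  "prod_rep X Y p = Some z \<longleftrightarrow> X (evens p) = Some (fst z) \<and> Y (odds p) = Some (snd z)"
  by (cases z) (auto simp: prod_rep_def split: option.splits)

subsection \<open>Words\<close>

text \<open>A number is read as an endlessly nested pair of head and tail. No length is stored;
  whoever uses a word keeps its length separately.\<close>

definition seqn :: "nat \<Rightarrow> nat \<Rightarrow> nat" where
  "seqn S j = pfst ((psnd ^^ j) S)"

lemma ucomp_seqn:
  assumes "ucomp W G I S" "ucomp W G I J"
  shows "ucomp W G I (\<lambda>w. seqn (S w) (J w))"
proof -
  have "ucomp UNIV fst snd (\<lambda>w :: cantor \<times> nat. (\<lambda>_. psnd) (fst w) (snd w))"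
    by (intro ucomp_psnd ucomp_input)
  from ucomp_pfst[OF ucomp_rec[OF this assms]] show ?thesis unfolding seqn_def .
qed

lemma seqn_exists: "\<exists>S. \<forall>j<n. seqn S j = g j"
proof (induction n arbitrary: g)
  case (Suc n)
  obtain S where S: "\<forall>j<n. seqn S j = g (Suc j)" using Suc.IH[of "\<lambda>j. g (Suc j)"] ..
  have "seqn (pe (g 0) S) 0 = g 0" "\<And>j. seqn (pe (g 0) S) (Suc j) = seqn S j"
    by (simp_all add: seqn_def funpow_swap1 del: funpow.simps(2) add: funpow_Suc_right)
  then have "seqn (pe (g 0) S) j = g j" if "j < Suc n" for j
    using S that by (cases j) auto
  then show ?case by blast
qed simp

subsection \<open>Semidecidable sets\<close>

text \<open>Stages turn a semidecidable set into the projection of a decidable relation, the form in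
  which the searches below consume it.\<close>

definition stage :: "code \<Rightarrow> nat \<Rightarrow> nat \<Rightarrow> bool" where
  "stage c n t \<longleftrightarrow> brun (\<lambda>_. False) t c n \<noteq> 0"

lemma semidecidable_stage:
  assumes "semidecidable S"
  shows "\<exists>c. \<forall>n. n \<in> S \<longleftrightarrow> (\<exists>t. stage c n t)"
proof -
  obtain c where c: "\<And>n. n \<in> S \<longleftrightarrow> (\<exists>m. evals (\<lambda>_. False) c n m)"
    using assms unfolding semidecidable_def by blast
  have "(\<exists>m. evals (\<lambda>_. False) c n m) \<longleftrightarrow> (\<exists>t. stage c n t)" for n
  proof
    assume "\<exists>m. evals (\<lambda>_. False) c n m"
    then obtain m where "evals (\<lambda>_. False) c n m" ..
    then obtain t where "brun (\<lambda>_. False) t c n = Suc m" using brun_complete by blast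
    then show "\<exists>t. stage c n t" unfolding stage_def by (intro exI[of _ t]) simp
  next
    assume "\<exists>t. stage c n t"
    then obtain t where "brun (\<lambda>_. False) t c n \<noteq> 0" unfolding stage_def ..
    then obtain m where "brun (\<lambda>_. False) t c n = Suc m" using not0_implies_Suc by blast
    then show "\<exists>m. evals (\<lambda>_. False) c n m" using brun_sound by blast
  qed
  then show ?thesis using c by blast
qed

lemma ucomp_stage:
  assumes "ucomp W G I A" "ucomp W G I T"
  shows "ucomp W G I (\<lambda>w. of_bool (stage c (A w) (T w)))"
proof -
  let ?H = "\<lambda>v :: nat \<times> nat. (\<lambda>_. False)" and ?J = "\<lambda>v. pe (fst v) (snd v)"
  have "ucomp UNIV ?H ?J snd" "ucomp UNIV ?H ?J fst"
    using ucomp_psnd[OF ucomp_input, of UNIV ?H ?J] ucomp_pfst[OF ucomp_input, of UNIV ?H ?J]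
    by simp_all
  then have "ucomp UNIV ?H ?J (\<lambda>v. of_bool (stage c (fst v) (snd v)))"
    unfolding stage_def by (intro ucomp_not ucomp_eq_0 ucomp_brun[where G = ?H] ucomp_const)
  from ucomp_oracle[OF this, of W "\<lambda>w. (A w, T w)" G I] show ?thesis
    using ucomp_pair[OF assms] bcomp_False[of W G I] by simp
qed

section \<open>Effective balls\<close>

text \<open>A lower bound below every distance: with it, the two-sided semidecision
  \<open>computable_dist\<close> can be asked for an upper bound alone.\<close>

definition neg_index :: nat where
  "neg_index = pe 1 0"

text \<open>\<open>int_decode\<close> maps even numbers to the nonnegative integers, hence the
  factor 2 in the numerator; denominators are stored minus one.\<close>

definition sum_index :: "nat \<Rightarrow> nat \<Rightarrow> nat" where
  "sum_index m i = pe (2 * (2 ^ m + 2 ^ i)) (2 ^ (m + i) - 1)"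

definition diff_index :: "nat \<Rightarrow> nat \<Rightarrow> nat" where
  "diff_index m i = pe (2 * (2 ^ i - 2 ^ m)) (2 ^ (m + i) - 1)"

lemma rat_of_nat_neg: "rat_of_nat neg_index = -1"
  by (simp add: neg_index_def rat_of_nat_def int_decode_def sum_decode_def)

lemma rat_of_nat_pos: "rat_of_nat (pe (2 * n) m) = real n / real (Suc m)"
  by (simp add: rat_of_nat_def int_decode_def sum_decode_def)

lemma rat_of_nat_exists: "\<exists>w. x < rat_of_nat w"
proof -
  obtain n where "x < real n" using reals_Archimedean2 by blast
  then show ?thesis using rat_of_nat_pos[of n 0] by (intro exI[of _ "pe (2 * n) 0"]) simp
qed

lemma rat_of_nat_pow_sum:
  "rat_of_nat (sum_index m i) = (1/2) ^ m + (1/2) ^ i"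
proof -
  have "Suc (2 ^ (m + i) - 1) = (2::nat) ^ (m + i)" by simp
  then show ?thesis unfolding sum_index_def rat_of_nat_pos by (simp add: field_simps power_add)
qed

lemma rat_of_nat_pow_diff:
  assumes "m \<le> i"
  shows "rat_of_nat (diff_index m i) = (1/2) ^ m - (1/2) ^ i"
proof -
  have "Suc (2 ^ (m + i) - 1) = (2::nat) ^ (m + i)" by simp
  moreover have "real (2 ^ i - 2 ^ m) = 2 ^ i - 2 ^ m" using assms by (simp add: of_nat_diff)
  ultimately show ?thesis unfolding diff_index_def rat_of_nat_pos by (simp add: field_simps power_add)
qed

context computable_metric_space
begin

definition dist_code :: code where
  "dist_code = (SOME c. \<forall>n. n \<in> {pe t (pe u (pe v w)) | t u v w.
      rat_of_nat t < d (a u) (a v) \<and> d (a u) (a v) < rat_of_nat w} \<longleftrightarrow> (\<exists>s. stage c n s))"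

lemma dist_code:
  "(\<exists>s. stage dist_code (pe t (pe u (pe v w))) s) \<longleftrightarrow>
    rat_of_nat t < d (a u) (a v) \<and> d (a u) (a v) < rat_of_nat w"
proof -
  have "\<forall>n. n \<in> {pe t (pe u (pe v w)) | t u v w.
      rat_of_nat t < d (a u) (a v) \<and> d (a u) (a v) < rat_of_nat w} \<longleftrightarrow> (\<exists>s. stage dist_code n s)"
    unfolding dist_code_def by (rule someI_ex) (rule semidecidable_stage[OF computable_dist])
  from this[rule_format, of "pe t (pe u (pe v w))"] show ?thesis by simp
qed

text \<open>Without the guard the subtraction in \<open>diff_index\<close> would truncate a negative
  bound.\<close>

definition near_at :: "nat \<Rightarrow> nat \<Rightarrow> nat \<Rightarrow> nat \<Rightarrow> nat \<Rightarrow> bool" where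
  "near_at u m v i t \<longleftrightarrow> m \<le> i \<and>
    stage dist_code (pe neg_index (pe u (pe v (diff_index m i)))) t"

text \<open>Since the semidecision is two-sided, \<open>t\<close> also carries a guess
  \<open>pfst t\<close> for a rational upper bound of the distance.\<close>

definition far_at :: "nat \<Rightarrow> nat \<Rightarrow> nat \<Rightarrow> nat \<Rightarrow> nat \<Rightarrow> bool" where
  "far_at u m v i t \<longleftrightarrow>
    stage dist_code (pe (sum_index m i) (pe u (pe v (pfst t)))) (psnd t)"

lemma near_at: "(\<exists>t. near_at u m v i t) \<longleftrightarrow> d (a u) (a v) < (1/2) ^ m - (1/2) ^ i"
proof (cases "m \<le> i")
  case True
  have "-1 < d (a u) (a v)" using nonneg[of "a u" "a v"] by linarith
  then show ?thesis
    using True dist_code by (simp add: near_at_def rat_of_nat_neg rat_of_nat_pow_diff)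
next
  case False
  then have "(1/2::real) ^ m \<le> (1/2) ^ i" by (intro power_decreasing) auto
  then have "\<not> d (a u) (a v) < (1/2) ^ m - (1/2) ^ i" using nonneg[of "a u" "a v"] by linarith
  then show ?thesis using False by (simp add: near_at_def)
qed

lemma far_at: "(\<exists>t. far_at u m v i t) \<longleftrightarrow> (1/2) ^ m + (1/2) ^ i < d (a u) (a v)"
proof -
  have "(\<exists>t. far_at u m v i t) \<longleftrightarrow> (\<exists>w s. far_at u m v i (pe w s))"
    by (metis pe_pfst_psnd)
  also have "\<dots> \<longleftrightarrow> (\<exists>w. (1/2) ^ m + (1/2) ^ i < d (a u) (a v) \<and> d (a u) (a v) < rat_of_nat w)"
    using dist_code[of _ u v] by (simp add: far_at_def rat_of_nat_pow_sum)
  also have "\<dots> \<longleftrightarrow> (1/2) ^ m + (1/2) ^ i < d (a u) (a v)"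
    using rat_of_nat_exists by blast
  finally show ?thesis .
qed

lemma ucomp_near_at:
  assumes "ucomp W G I u" "ucomp W G I m" "ucomp W G I v" "ucomp W G I i" "ucomp W G I t"
  shows "ucomp W G I (\<lambda>w. of_bool (near_at (u w) (m w) (v w) (i w) (t w)))"
  unfolding near_at_def diff_index_def by (intro ucomp_intros ucomp_stage assms)

lemma ucomp_far_at:
  assumes "ucomp W G I u" "ucomp W G I m" "ucomp W G I v" "ucomp W G I i" "ucomp W G I t"
  shows "ucomp W G I (\<lambda>w. of_bool (far_at (u w) (m w) (v w) (i w) (t w)))"
  unfolding far_at_def sum_index_def by (intro ucomp_intros ucomp_stage assms)

lemma a_in: "a n \<in> M"
  using dense_in by auto

subsection \<open>Cauchy names\<close>

lemma cauchy_name_approx: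
  assumes "cauchy_rep M d a r = Some x"
  obtains g where "r = graph_of g" "x \<in> M" "\<And>i. d (a (g i)) x \<le> (1/2) ^ i"
proof -
  obtain g where g: "r = graph_of g"
    and cauchy: "\<And>i k. i < k \<Longrightarrow> d (a (g i)) (a (g k)) \<le> (1/2) ^ i"
    and lim: "limitin mtopology (\<lambda>n. a (g n)) x sequentially"
    using assms unfolding cauchy_rep_eq_Some_iff names_cauchy_def by blast
  have x: "x \<in> M" using lim by (rule limitin_mspace)
  have "d (a (g i)) x \<le> (1/2) ^ i" for i
  proof (rule field_le_epsilon)
    fix e :: real assume "e > 0"
    then have "\<forall>\<^sub>F n in sequentially. d (a (g n)) x < e"
      using lim unfolding limitin_metric by (auto elim: eventually_mono)
    then have "\<forall>\<^sub>F n in sequentially. d (a (g n)) x < e \<and> i < n"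
      using eventually_gt_at_top[of i] by (rule eventually_conj)
    then obtain n where "d (a (g n)) x < e" "i < n"
      using eventually_happens trivial_limit_sequentially by blast
    then show "d (a (g i)) x \<le> (1/2) ^ i + e"
      using triangle[OF a_in[of "g i"] a_in[of "g n"] x] cauchy[of i n] by linarith
  qed
  then show thesis using that g x by blast
qed

text \<open>Two errors of half the permitted size add up to at most the permitted size. This is the
  origin of \<open>Suc i\<close> in the approximations constructed below.\<close>

lemma cauchy_name_intro:
  assumes x: "x \<in> M" and g: "\<And>i. d (a (g i)) x \<le> (1/2) ^ Suc i"
  shows "cauchy_rep M d a (graph_of g) = Some x"
  unfolding cauchy_rep_eq_Some_iff names_cauchy_def
proof (intro exI[of _ g] conjI refl allI impI)
  fix i k :: nat assume "i < k"
  have "d (a (g i)) (a (g k)) \<le> d (a (g i)) x + d (a (g k)) x"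
    using triangle[OF a_in[of "g i"] x a_in[of "g k"]] commute[of x] by simp
  also have "\<dots> \<le> (1/2) ^ Suc i + (1/2) ^ Suc k"
    using g[of i] g[of k] by linarith
  also have "(1/2::real) ^ Suc k \<le> (1/2) ^ Suc i"
    using \<open>i < k\<close> by (intro power_decreasing) auto
  finally show "d (a (g i)) (a (g k)) \<le> (1/2) ^ i" by simp
next
  show "limitin mtopology (\<lambda>n. a (g n)) x sequentially"
    unfolding limitin_metric
  proof (intro conjI x allI impI)
    fix e :: real assume "e > 0"
    then obtain n where n: "(1/2) ^ n < e" using real_arch_pow_inv[of e "1/2"] by auto
    show "\<forall>\<^sub>F k in sequentially. a (g k) \<in> M \<and> d (a (g k)) x < e"
    proof (rule eventually_sequentiallyI[of n], intro conjI a_in)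
      fix k assume "n \<le> k"
      then have "(1/2::real) ^ Suc k \<le> (1/2) ^ n" by (intro power_decreasing) auto
      then show "d (a (g k)) x < e" using g[of k] n by linarith
    qed
  qed
qed

lemma approx_exists:
  assumes "x \<in> M" "e > 0"
  shows "\<exists>n. d (a n) x < e"
proof -
  have "\<exists>n. d x (a n) < e" using dense assms unfolding metric_closure_of by fastforce
  then show ?thesis using commute[of x] by simp
qed

lemma cauchy_name_exists:
  assumes "x \<in> M"
  obtains g where "\<And>i. d (a (g i)) x \<le> (1/2) ^ Suc i"
proof -
  have "\<forall>i. \<exists>n. d (a n) x \<le> (1/2) ^ Suc i"
  proof
    fix i
    obtain n where "d (a n) x < (1/2) ^ Suc i" using approx_exists[OF assms, of "(1/2) ^ Suc i"] by auto
    then show "\<exists>n. d (a n) x \<le> (1/2) ^ Suc i" by (intro exI[of _ n]) simp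
  qed
  from choice[OF this] show thesis using that by blast
qed

lemma gap_exists:
  assumes "(x::real) < y"
  obtains i where "x + (1/2) ^ i + (1/2) ^ i < y"
proof -
  obtain i where "(1/2) ^ i < (y - x) / 2"
    using real_arch_pow_inv[of "(y - x) / 2" "1/2"] assms by auto
  then have "x + (1/2) ^ i + (1/2) ^ i < y" by (simp add: field_simps)
  then show thesis by (rule that)
qed

text \<open>
  Stages of the semidecision whether the point named \<open>r\<close> has distance less, respectively greater,
  than \<open>(1/2)\<^sup>m\<close> from \<open>a c\<close>.
\<close>

definition inside_at :: "cantor \<Rightarrow> nat \<Rightarrow> nat \<Rightarrow> nat \<Rightarrow> bool" where
  "inside_at r c m t \<longleftrightarrow> r (pfst t) \<and> near_at c m (psnd (pfst t)) (pfst (pfst t)) (psnd t)"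

definition outside_at :: "cantor \<Rightarrow> nat \<Rightarrow> nat \<Rightarrow> nat \<Rightarrow> bool" where
  "outside_at r c m t \<longleftrightarrow> r (pfst t) \<and> far_at c m (psnd (pfst t)) (pfst (pfst t)) (psnd t)"

lemma ex_graph_of:
  "(\<exists>t. graph_of g (pfst t) \<and> P (psnd (pfst t)) (pfst (pfst t)) (psnd t)) \<longleftrightarrow> (\<exists>i t. P (g i) i t)"
proof
  assume "\<exists>t. graph_of g (pfst t) \<and> P (psnd (pfst t)) (pfst (pfst t)) (psnd t)"
  then obtain t where t: "graph_of g (pfst t)" "P (psnd (pfst t)) (pfst (pfst t)) (psnd t)"
    by blast
  have "g (pfst (pfst t)) = psnd (pfst t)" using t(1) by (simp add: graph_of_def case_prod_beta)
  then show "\<exists>i t. P (g i) i t" using t(2) by (intro exI[of _ "pfst (pfst t)"] exI) simp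
next
  assume "\<exists>i t. P (g i) i t"
  then obtain i t where "P (g i) i t" by blast
  then show "\<exists>t. graph_of g (pfst t) \<and> P (psnd (pfst t)) (pfst (pfst t)) (psnd t)"
    by (intro exI[of _ "pe (pe i (g i)) t"]) (simp add: graph_of_def)
qed

lemma inside_at:
  assumes "cauchy_rep M d a r = Some x"
  shows "(\<exists>t. inside_at r c m t) \<longleftrightarrow> d (a c) x < (1/2) ^ m"
proof -
  obtain g where g: "r = graph_of g" and x: "x \<in> M" and approx: "\<And>i. d (a (g i)) x \<le> (1/2) ^ i"
    using cauchy_name_approx[OF assms] by blast
  have "(\<exists>t. inside_at r c m t) \<longleftrightarrow> (\<exists>i. d (a c) (a (g i)) < (1/2) ^ m - (1/2) ^ i)"
    unfolding inside_at_def g ex_graph_of using near_at by simp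
  also have "\<dots> \<longleftrightarrow> d (a c) x < (1/2) ^ m"
  proof
    assume "\<exists>i. d (a c) (a (g i)) < (1/2) ^ m - (1/2) ^ i"
    then obtain i where "d (a c) (a (g i)) < (1/2) ^ m - (1/2) ^ i" ..
    then show "d (a c) x < (1/2) ^ m"
      using triangle[OF a_in[of c] a_in[of "g i"] x] approx[of i] by linarith
  next
    assume "d (a c) x < (1/2) ^ m"
    then obtain i where i: "d (a c) x + (1/2) ^ i + (1/2) ^ i < (1/2) ^ m" by (rule gap_exists)
    have "d (a c) (a (g i)) \<le> d (a c) x + d (a (g i)) x"
      using triangle[OF a_in[of c] x a_in[of "g i"]] commute[of x "a (g i)"] by simp
    then have "d (a c) (a (g i)) < (1/2) ^ m - (1/2) ^ i" using approx[of i] i by linarith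
    then show "\<exists>i. d (a c) (a (g i)) < (1/2) ^ m - (1/2) ^ i" ..
  qed
  finally show ?thesis .
qed

lemma outside_at:
  assumes "cauchy_rep M d a r = Some x"
  shows "(\<exists>t. outside_at r c m t) \<longleftrightarrow> (1/2) ^ m < d (a c) x"
proof -
  obtain g where g: "r = graph_of g" and x: "x \<in> M" and approx: "\<And>i. d (a (g i)) x \<le> (1/2) ^ i"
    using cauchy_name_approx[OF assms] by blast
  have "(\<exists>t. outside_at r c m t) \<longleftrightarrow> (\<exists>i. (1/2) ^ m + (1/2) ^ i < d (a c) (a (g i)))"
    unfolding outside_at_def g ex_graph_of using far_at by simp
  also have "\<dots> \<longleftrightarrow> (1/2) ^ m < d (a c) x"
  proof
    assume "\<exists>i. (1/2) ^ m + (1/2) ^ i < d (a c) (a (g i))"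
    then obtain i where i: "(1/2) ^ m + (1/2) ^ i < d (a c) (a (g i))" ..
    have "d (a c) (a (g i)) \<le> d (a c) x + d (a (g i)) x"
      using triangle[OF a_in[of c] x a_in[of "g i"]] commute[of x "a (g i)"] by simp
    then show "(1/2) ^ m < d (a c) x" using approx[of i] i by linarith
  next
    assume "(1/2) ^ m < d (a c) x"
    then obtain i where i: "(1/2) ^ m + (1/2) ^ i + (1/2) ^ i < d (a c) x" by (rule gap_exists)
    then have "(1/2) ^ m + (1/2) ^ i < d (a c) (a (g i))"
      using triangle[OF a_in[of c] a_in[of "g i"] x] approx[of i] by linarith
    then show "\<exists>i. (1/2) ^ m + (1/2) ^ i < d (a c) (a (g i))" ..
  qed
  finally show ?thesis .
qed

lemma ucomp_inside_at:
  assumes "bcomp W G I r" "ucomp W G I c" "ucomp W G I m" "ucomp W G I t"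
  shows "ucomp W G I (\<lambda>w. of_bool (inside_at (r w) (c w) (m w) (t w)))"
  unfolding inside_at_def
  by (intro ucomp_conj bcomp_query[OF assms(1)] ucomp_near_at ucomp_pfst ucomp_psnd assms)

lemma ucomp_outside_at:
  assumes "bcomp W G I r" "ucomp W G I c" "ucomp W G I m" "ucomp W G I t"
  shows "ucomp W G I (\<lambda>w. of_bool (outside_at (r w) (c w) (m w) (t w)))"
  unfolding outside_at_def
  by (intro ucomp_conj bcomp_query[OF assms(1)] ucomp_far_at ucomp_pfst ucomp_psnd assms)

subsection \<open>Unions of balls\<close>

text \<open>
  Every ball has infinitely many indices, because the second component of the index is ignored.
\<close>

definition centre :: "nat \<Rightarrow> nat" where
  "centre k = pfst (pfst k)"

definition radius :: "nat \<Rightarrow> nat" where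
  "radius k = psnd (pfst k)"

definition balls :: "cantor \<Rightarrow> 'a set" where
  "balls q = {x \<in> M. \<exists>k. q k \<and> d (a (centre k)) x < (1/2) ^ radius k}"

lemma ball_index_exists: "\<exists>k\<ge>n. centre k = c \<and> radius k = m"
proof (intro exI conjI)
  show "n \<le> pe (pe c m) n" by (rule le_prod_encode_2)
qed (simp_all add: centre_def radius_def)

lemma ucomp_centre: "ucomp W G I k \<Longrightarrow> ucomp W G I (\<lambda>w. centre (k w))"
  unfolding centre_def by (intro ucomp_pfst)

lemma ucomp_radius: "ucomp W G I k \<Longrightarrow> ucomp W G I (\<lambda>w. radius (k w))"
  unfolding radius_def by (intro ucomp_pfst ucomp_psnd)

text \<open>The sequence \<open>q\<close> itself is the oracle part of the name, so a finite part of
  the name involves only a finite part of \<open>q\<close>. This lets the Baire argument take place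
  in the space of sequences.\<close>

lemma balls_open:
  "\<exists>c. \<forall>q. open_rep (cauchy_rep M d a) (unary_prefix (code_index c) q) = Some (balls q)"
proof -
  let ?s = "\<lambda>w t. snd w (pfst t) \<and>
    inside_at (fst w) (centre (pfst t)) (radius (pfst t)) (psnd t)"
  let ?G = "\<lambda>w. interleave (fst w) (snd w)"
  have G: "bcomp UNIV ?G (\<lambda>_. 0) ?G" by (rule bcomp_oracle)
  have r: "bcomp UNIV ?G (\<lambda>_. 0) fst" and q: "bcomp UNIV ?G (\<lambda>_. 0) snd"
    using bcomp_evens[OF G] bcomp_odds[OF G] by simp_all
  have "bcomp UNIV ?G (\<lambda>_. 0) ?s"
    by (rule bcompI, intro ucomp_conj bcomp_index[OF q] ucomp_inside_at bcomp_lift[OF r]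
        ucomp_centre ucomp_radius ucomp_pfst ucomp_psnd ucomp_snd)
  from bcomp_computes[OF this] obtain c where c: "\<And>r q. computes c (interleave r q) (?s (r, q))"
    by auto
  have "open_rep (cauchy_rep M d a) (unary_prefix (code_index c) q) = Some (balls q)" for q
  proof (rule open_rep_intro)
    fix r x assume x: "cauchy_rep M d a r = Some x"
    have "x \<in> M" using x pointsI points_cauchy_rep by metis
    then have "x \<in> balls q \<longleftrightarrow> (\<exists>k t. q k \<and> inside_at r (centre k) (radius k) t)"
      using inside_at[OF x] by (simp add: balls_def)
    also have "\<dots> \<longleftrightarrow> (\<exists>t. ?s (r, q) t)" by simp (metis pe_pfst_psnd fst_conv snd_conv prod_encode_inverse)
    finally show "\<exists>s. computes c (interleave r q) s \<and> (x \<in> balls q \<longleftrightarrow> (\<exists>n. s n))"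
      using c by blast
  qed (auto simp: balls_def points_cauchy_rep)
  then show ?thesis by blast
qed

end

section \<open>From \<open>\<Delta>\<^sub>2\<close>-functions to closed pieces\<close>

lemma computable_map_points:
  assumes "computable_map X Y f"
  shows "f \<in> points X \<rightarrow> points Y"
proof
  fix x assume "x \<in> points X"
  then obtain p where "X p = Some x" by (auto simp: ran_def)
  then show "f x \<in> points Y" using assms unfolding computable_map_def by (blast intro: pointsI)
qed

text \<open>The test \<open>c\<close> with number \<open>i\<close> accepts the name \<open>r\<close> at stage \<open>t\<close>.\<close>

definition mem :: "code \<Rightarrow> cantor \<Rightarrow> cantor \<Rightarrow> nat \<Rightarrow> cantor \<Rightarrow> nat \<Rightarrow> bool" where
  "mem c p q i r t \<longleftrightarrow> evals (interleave r (interleave q p)) c (pe i t) 1"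

lemma mem_iff:
  assumes "evals (interleave r (interleave q p)) c (pe i t) (of_bool b)"
  shows "mem c p q i r t \<longleftrightarrow> b"
proof
  assume "mem c p q i r t"
  then have "of_bool b = (1::nat)" unfolding mem_def by (rule evals_det[OF assms])
  then show b by (cases b) auto
next
  assume b
  then show "mem c p q i r t" using assms unfolding mem_def by simp
qed

text \<open>Halting with output 1 is in general only semidecidable; it becomes decidable where the
  test is total.\<close>

lemma ucomp_mem:
  assumes p: "bcomp W G I p" and q: "bcomp W G I q" and r: "bcomp W G I r"
    and i: "ucomp W G I i" and t: "ucomp W G I t"
    and total: "\<And>w i t. w \<in> W \<Longrightarrow>
      evals (interleave (r w) (interleave (q w) (p w))) c (pe i t) (of_bool (mem c (p w) (q w) i (r w) t))"
  shows "ucomp W G I (\<lambda>w. of_bool (mem c (p w) (q w) (i w) (r w) (t w)))"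
proof -
  let ?H = "\<lambda>w. interleave (r w) (interleave (q w) (p w))"
  let ?K = "\<lambda>w. pe (i w) (t w)"
  have "ucomp W ?H ?K (\<lambda>w. of_bool (mem c (p w) (q w) (i w) (r w) (t w)))"
    unfolding ucomp_def using total by blast
  then show ?thesis
  proof (rule ucomp_oracle[where \<phi> = "\<lambda>w. w"])
    show "bcomp W G I ?H" by (intro bcomp_interleave p q r)
    show "ucomp W G I ?K" by (intro ucomp_pair i t)
  qed
qed

lemma Delta2_rep_app:
  assumes "Delta2_rep X z = Some B"
  obtains U where "B = (\<Inter>i. U i)"
    "\<And>i. \<exists>y. app z (unat i) y \<and> open_rep X (odds y) = Some (U i)"
proof -
  obtain S where S: "fun_rep nat_rep (prod_rep (closed_rep X) (open_rep X)) z = Some S"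
    and B: "(\<Union>i. fst (S i)) = (\<Inter>i. snd (S i))" "B = (\<Union>i. fst (S i))"
    using assms unfolding Delta2_rep_def by (auto split: option.splits if_splits)
  have "\<exists>y. app z (unat i) y \<and> open_rep X (odds y) = Some (snd (S i))" for i
    using fun_rep_nat_app[OF S, of i] by (auto simp: prod_rep_eq_Some_iff)
  then show thesis using that[of "\<lambda>i. snd (S i)"] B by auto
qed

definition query_set :: "nat \<Rightarrow> nat \<Rightarrow> nat \<Rightarrow> cantor" where
  "query_set n S k j \<longleftrightarrow> j = k \<or> (j < n \<and> seqn S j = 1)"

lemma bcomp_query_set:
  assumes "ucomp W G I n" "ucomp W G I S" "ucomp W G I k"
  shows "bcomp W G I (\<lambda>w. query_set (n w) (S w) (k w))"
  unfolding query_set_def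
  by (rule bcompI, intro ucomp_disj ucomp_conj ucomp_eq ucomp_less ucomp_seqn ucomp_const ucomp_snd
      ucomp_lift[OF assms(1)] ucomp_lift[OF assms(2)] ucomp_lift[OF assms(3)])

text \<open>
  An index \<open>J\<close> of a piece stands for \<open>(n, S, i)\<close>: the word \<open>S\<close> codes a finite set of balls with
  indices below \<open>n\<close>, and \<open>i\<close> selects one of the open sets in the \<open>\<Delta>\<^sub>2\<close>-name of a preimage.
\<close>

abbreviation (input) bound :: "nat \<Rightarrow> nat" where
  "bound J \<equiv> pfst J"

abbreviation (input) level :: "nat \<Rightarrow> nat" where
  "level J \<equiv> psnd (psnd J)"

definition extend :: "nat \<Rightarrow> nat \<Rightarrow> cantor" where
  "extend J k = query_set (pfst J) (pfst (psnd J)) k"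

definition member_at :: "code \<Rightarrow> cantor \<Rightarrow> cantor \<Rightarrow> nat \<Rightarrow> nat \<Rightarrow> nat \<Rightarrow> bool" where
  "member_at c p r J k t \<longleftrightarrow> bound J \<le> k \<and> mem c p (extend J k) (level J) r t"

lemma ucomp_member_at:
  assumes p: "bcomp W G I p" and r: "bcomp W G I r"
    and J: "ucomp W G I J" and k: "ucomp W G I k" and t: "ucomp W G I t"
    and total: "\<And>w q i t. w \<in> W \<Longrightarrow>
      evals (interleave (r w) (interleave q (p w))) c (pe i t) (of_bool (mem c (p w) q i (r w) t))"
  shows "ucomp W G I (\<lambda>w. of_bool (member_at c (p w) (r w) (J w) (k w) (t w)))"
  unfolding member_at_def extend_def
  by (intro ucomp_conj ucomp_le ucomp_mem bcomp_query_set ucomp_pfst ucomp_psnd p r J k t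
      total)

section \<open>Uniform tests for the preimages of unions of balls\<close>

context computable_metric_space
begin

lemma Delta2_membership_sets:
  assumes name: "names_Delta2_fun X (cauchy_rep M d a) p f"
    and U: "open_rep (cauchy_rep M d a) u = Some (balls q)"
  shows "\<exists>D. {x \<in> points X. f x \<in> balls q} = (\<Inter>i. D i) \<and>
    (\<forall>i. \<exists>z y. app p u z \<and> app z (unat i) y \<and> open_rep X (odds y) = Some (D i))"
proof -
  let ?pre = "preimage_map X (cauchy_rep M d a) f"
  have F: "fun_rep (open_rep (cauchy_rep M d a)) (Delta2_rep X) p = Some ?pre"
    using name unfolding names_Delta2_fun_def by blast
  obtain z where z: "app p u z" "Delta2_rep X z = Some (?pre (balls q))"
    using fun_rep_app[OF F U] by blast
  obtain D where D: "?pre (balls q) = (\<Inter>i. D i)"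
    "\<forall>i. \<exists>y. app z (unat i) y \<and> open_rep X (odds y) = Some (D i)"
    using Delta2_rep_app[OF z(2)] by blast
  have "?pre (balls q) = {x \<in> points X. f x \<in> balls q}"
    using pointsI[of "open_rep (cauchy_rep M d a)", OF U] by (simp add: preimage_map_def)
  then have "{x \<in> points X. f x \<in> balls q} = (\<Inter>i. D i)" using D(1) by simp
  then show ?thesis using D(2) z(1) by (intro exI[of _ D]) blast
qed

text \<open>Three evaluations in a row: the preimage map at the name of the open set, the resulting
  sequence at \<open>i\<close>, and its open set at \<open>r\<close>. The worlds carry the
  intermediate names, which \<open>bcomp_app\<close> shows to be computable.\<close>

lemma membership_code:
  "\<exists>c. \<forall>p q i r z y s t. app p (unary_prefix n q) z \<longrightarrow> app z (unat i) y \<longrightarrow> app (odds y) r s \<longrightarrow>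
    evals (interleave r (interleave q p)) c (pe i t) (of_bool (s t))"
proof -
  define U where "U q = unary_prefix n q" for q
  define W where "W = {(p, q, i, r, z, y, s). app p (U q) z \<and> app z (unat i) y \<and> app (odds y) r s}"
  define P Q R Z Y S :: "cantor \<times> cantor \<times> nat \<times> cantor \<times> cantor \<times> cantor \<times> cantor \<Rightarrow> cantor"
    where "P = (\<lambda>(p, q, i, r, z, y, s). p)" and "Q = (\<lambda>(p, q, i, r, z, y, s). q)"
    and "R = (\<lambda>(p, q, i, r, z, y, s). r)" and "Z = (\<lambda>(p, q, i, r, z, y, s). z)"
    and "Y = (\<lambda>(p, q, i, r, z, y, s). y)" and "S = (\<lambda>(p, q, i, r, z, y, s). s)"
  define I :: "cantor \<times> cantor \<times> nat \<times> cantor \<times> cantor \<times> cantor \<times> cantor \<Rightarrow> nat"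
    where "I = (\<lambda>(p, q, i, r, z, y, s). i)"
  note proj = P_def Q_def R_def Z_def Y_def S_def I_def
  have W: "app (P w) (U (Q w)) (Z w)" "app (Z w) (unat (I w)) (Y w)" "app (odds (Y w)) (R w) (S w)"
    if "w \<in> W" for w
    using that by (cases w; simp add: W_def proj)+
  let ?G = "\<lambda>w. interleave (R w) (interleave (Q w) (P w))"
  have G: "bcomp W ?G I ?G" by (rule bcomp_oracle)
  have R: "bcomp W ?G I R" using bcomp_evens[OF G] by simp
  have Q: "bcomp W ?G I Q" using bcomp_evens[OF bcomp_odds[OF G]] by simp
  have P: "bcomp W ?G I P" using bcomp_odds[OF bcomp_odds[OF G]] by simp
  have "bcomp W ?G I (\<lambda>w. U (Q w))"
    unfolding U_def by (rule bcomp_unary_prefix[OF ucomp_const Q])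
  from bcomp_app[OF P this W(1)] have "bcomp W ?G I Z" .
  from bcomp_app[OF this bcomp_unary_prefix[OF ucomp_input bcomp_False] W(2)]
  have "bcomp W ?G I Y" .
  from bcomp_app[OF bcomp_odds[OF this] R W(3)] have "bcomp W ?G I S" .
  then obtain c where c: "\<forall>w\<in>W. \<forall>t. evals (?G w) c (pe (I w) t) (of_bool (S w t))"
    unfolding bcomp_def ..
  have "evals (interleave r (interleave q p)) c (pe i t) (of_bool (s t))"
    if "app p (unary_prefix n q) z" "app z (unat i) y" "app (odds y) r s" for p q i r z y s t
  proof -
    have "(p, q, i, r, z, y, s) \<in> W" using that by (simp add: W_def U_def)
    from c[rule_format, OF this] show ?thesis by (simp only: proj prod.case)
  qed
  then show ?thesis by (intro exI[of _ c] allI impI)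
qed

text \<open>The program \<open>c\<close> is chosen before \<open>p\<close> and \<open>f\<close>, as
  a uniform translation of names demands. Single stages \<open>mem\<close> are decidable, and their
  projection is membership in the open set.\<close>

lemma Delta2_membership:
  "\<exists>c. \<forall>p f. names_Delta2_fun X (cauchy_rep M d a) p f \<longrightarrow> (\<exists>D.
    (\<forall>q. {x \<in> points X. f x \<in> balls q} = (\<Inter>i. D q i)) \<and>
    (\<forall>q i r x. X r = Some x \<longrightarrow>
      (\<forall>t. evals (interleave r (interleave q p)) c (pe i t) (of_bool (mem c p q i r t))) \<and>
      (x \<in> D q i \<longleftrightarrow> (\<exists>t. mem c p q i r t))))"
proof -
  obtain cU where cU: "\<forall>q. open_rep (cauchy_rep M d a) (unary_prefix (code_index cU) q) = Some (balls q)"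
    using balls_open ..
  let ?U = "unary_prefix (code_index cU)"
  obtain c where c: "\<forall>p q i r z y s t. app p (?U q) z \<longrightarrow> app z (unat i) y \<longrightarrow> app (odds y) r s \<longrightarrow>
    evals (interleave r (interleave q p)) c (pe i t) (of_bool (s t))"
    using membership_code ..
  show ?thesis
  proof (intro exI[of _ c] allI impI)
    fix p f assume name: "names_Delta2_fun X (cauchy_rep M d a) p f"
    have "\<forall>q. \<exists>D. {x \<in> points X. f x \<in> balls q} = (\<Inter>i. D i) \<and>
      (\<forall>i. \<exists>z y. app p (?U q) z \<and> app z (unat i) y \<and> open_rep X (odds y) = Some (D i))"
      using Delta2_membership_sets[OF name cU[rule_format]] by (intro allI)
    from choice[OF this] obtain D
      where D: "\<forall>q. {x \<in> points X. f x \<in> balls q} = (\<Inter>i. D q i) \<and>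
        (\<forall>i. \<exists>z y. app p (?U q) z \<and> app z (unat i) y \<and> open_rep X (odds y) = Some (D q i))" ..
    show "\<exists>D. (\<forall>q. {x \<in> points X. f x \<in> balls q} = (\<Inter>i. D q i)) \<and>
      (\<forall>q i r x. X r = Some x \<longrightarrow>
        (\<forall>t. evals (interleave r (interleave q p)) c (pe i t) (of_bool (mem c p q i r t))) \<and>
        (x \<in> D q i \<longleftrightarrow> (\<exists>t. mem c p q i r t)))"
    proof (rule exI[of _ D], rule conjI, rule allI, rule conjunct1[OF D[rule_format]], intro allI impI)
      fix q i r x assume x: "X r = Some x"
      obtain z y where z: "app p (?U q) z" "app z (unat i) y" "open_rep X (odds y) = Some (D q i)"
        using D by blast
      obtain s where s: "app (odds y) r s" "x \<in> D q i \<longleftrightarrow> (\<exists>t. s t)"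
        using open_rep_app[OF z(3) x] by blast
      have ev: "evals (interleave r (interleave q p)) c (pe i t) (of_bool (s t))" for t
        using c[rule_format, OF z(1,2) s(1)] .
      have "mem c p q i r t \<longleftrightarrow> s t" for t using ev by (rule mem_iff)
      then have "mem c p q i r = s" by (rule ext)
      then show "(\<forall>t. evals (interleave r (interleave q p)) c (pe i t) (of_bool (mem c p q i r t))) \<and>
          (x \<in> D q i \<longleftrightarrow> (\<exists>t. mem c p q i r t))"
        using ev s(2) by (intro conjI allI) (simp_all only:)
    qed
  qed
qed

section \<open>The closed pieces, their accuracy, and why they cover the space\<close>

text \<open>
  The piece with index \<open>J\<close> consists of the points for which the balls \<open>k\<close> with \<open>x \<in> E J k\<close> are
  compatible.
\<close>

definition piece :: "'c set \<Rightarrow> (nat \<Rightarrow> nat \<Rightarrow> 'c set) \<Rightarrow> nat \<Rightarrow> 'c set" where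
  "piece V E J = {x \<in> V. \<not> (\<exists>k k'. bound J \<le> k \<and> x \<in> E J k \<and> bound J \<le> k' \<and> x \<in> E J k' \<and>
    radius k = radius k' \<and>
    (1/2) ^ radius k + (1/2) ^ radius k < d (a (centre k)) (a (centre k')))}"

text \<open>Were ball \<open>k\<close> farther off, a ball of the same radius with centre close to
  \<open>f x\<close> would contain \<open>f x\<close>, hence be hit, and would clash with
  \<open>k\<close>.\<close>

lemma piece_accuracy:
  assumes x: "x \<in> piece V E J" and fx: "f x \<in> M"
    and hit: "\<And>k. d (a (centre k)) (f x) < (1/2) ^ radius k \<Longrightarrow> x \<in> E J k"
    and k: "bound J \<le> k" "x \<in> E J k"
  shows "d (a (centre k)) (f x) \<le> (1/2) ^ radius k + (1/2) ^ radius k"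
proof (rule ccontr)
  define h :: real where "h = (1/2) ^ radius k"
  assume "\<not> ?thesis"
  then have gap: "0 < min h (d (a (centre k)) (f x) - (h + h))" by (simp add: h_def)
  \<comment> \<open>The centre is so close that its ball of radius \<open>h\<close> contains
    \<open>f x\<close>, and that it still lies more than \<open>h + h\<close> away from the centre
    of \<open>k\<close>.\<close>
  obtain c where c: "d (a c) (f x) < min h (d (a (centre k)) (f x) - (h + h))"
    using approx_exists[OF fx gap] by blast
  obtain k' where k': "bound J \<le> k'" "centre k' = c" "radius k' = radius k"
    using ball_index_exists by blast
  have "x \<in> E J k'" using c k' by (intro hit) (simp add: h_def)
  moreover have "h + h < d (a (centre k)) (a (centre k'))"
    using c triangle[OF a_in[of "centre k"] a_in[of c] fx] unfolding k'(2) by linarith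
  ultimately show False using x k k'(1) k'(3)[symmetric] unfolding piece_def h_def by blast
qed

text \<open>
  A Baire category argument: if \<open>x\<close> is in no piece, then a ball that misses \<open>f x\<close> can be added to any
  finite set of balls so that \<open>x\<close> enters the next open set.  In the limit \<open>x\<close> is in all the open
  sets, although no ball of the union contains \<open>f x\<close>.
\<close>

lemma piece_cover:
  fixes D :: "cantor \<Rightarrow> nat \<Rightarrow> 'c set"
  assumes x: "x \<in> V" and fx: "f x \<in> M"
    and balls: "\<And>q. (\<forall>i. x \<in> D q i) \<Longrightarrow> f x \<in> balls q"
    and use: "\<And>q i. x \<in> D q i \<Longrightarrow> finite_use q (\<lambda>q'. x \<in> D q' i)"
  shows "\<exists>J. x \<in> piece V (\<lambda>J k. D (extend J k) (level J)) J"
proof (rule ccontr)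
  assume none: "\<not> ?thesis"
  let ?miss = "\<lambda>k. \<not> d (a (centre k)) (f x) < (1/2) ^ radius k"
  let ?ext = "\<lambda>n B k j. j = k \<or> (j < n \<and> B j)"
  have step: "\<exists>k. \<exists>n'. n \<le> k \<and> k < n' \<and> ?miss k \<and>
      (\<forall>q. (\<forall>j<n'. q j = ?ext n B k j) \<longrightarrow> x \<in> D q i)" for n i and B :: cantor
  proof -
    obtain S where S: "\<forall>j<n. seqn S j = of_bool (B j)"
      using seqn_exists[of n "\<lambda>j. of_bool (B j)"] ..
    define J where "J = pe n (pe S i)"
    have "of_bool b = Suc 0 \<longleftrightarrow> b" for b by (cases b) auto
    then have J: "bound J = n" "level J = i" "extend J k = ?ext n B k" for k
      using S by (auto simp: J_def extend_def query_set_def fun_eq_iff)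
    have "x \<notin> piece V (\<lambda>J k. D (extend J k) (level J)) J" using none by blast
    then obtain k k' where kk: "n \<le> k" "x \<in> D (?ext n B k) i" "n \<le> k'" "x \<in> D (?ext n B k') i"
      "radius k = radius k'" "(1/2) ^ radius k + (1/2) ^ radius k < d (a (centre k)) (a (centre k'))"
      using x unfolding piece_def J by auto
    \<comment> \<open>Balls of equal radius whose centres are more than two radii apart are
      disjoint, so one of the two misses \<open>f x\<close>.\<close>
    have "?miss k \<or> ?miss k'"
      using kk(5,6) triangle[OF a_in[of "centre k"] fx a_in[of "centre k'"]]
        commute[of "f x" "a (centre k')"] by auto
    then obtain l where l: "n \<le> l" "x \<in> D (?ext n B l) i" "?miss l" using kk by blast
    obtain L where L: "\<forall>q. (\<forall>j<L. q j = ?ext n B l j) \<longrightarrow> x \<in> D q i"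
      using use[OF l(2)] unfolding finite_use_def by blast
    \<comment> \<open>The new bound must cover the bits used by the test, which end at
      \<open>L\<close>, and also the ball \<open>l\<close> that was just added.\<close>
    show ?thesis
      by (rule exI[of _ l], rule exI[of _ "max L (Suc l)"]) (use l L in auto)
  qed
  obtain K N where KN: "\<And>n B i. n \<le> K n B i \<and> K n B i < N n B i \<and> ?miss (K n B i) \<and>
      (\<forall>q. (\<forall>j<N n B i. q j = ?ext n B (K n B i) j) \<longrightarrow> x \<in> D q i)"
    using step by metis
  \<comment> \<open>A state \<open>(n, B)\<close> is a finite condition: the bits of
    \<open>B\<close> below \<open>n\<close> are frozen. Step \<open>i\<close> forces
    \<open>x\<close> into the open set of level \<open>i\<close>.\<close>
  define st where "st = rec_nat (0, \<lambda>_. False)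
    (\<lambda>i (n, B). (N n B i, ?ext n B (K n B i)))"
  define n B where "n i = fst (st i)" and "B i = snd (st i)" for i
  have n: "n 0 = 0" "n (Suc i) = N (n i) (B i) i"
    and B: "B 0 = (\<lambda>_. False)" "B (Suc i) = ?ext (n i) (B i) (K (n i) (B i) i)" for i
    by (simp_all add: n_def B_def st_def case_prod_beta)
  have grow: "n i < n (Suc i)" "n i \<le> K (n i) (B i) i" "K (n i) (B i) i < n (Suc i)" for i
    using KN[of "n i" "B i" i] unfolding n by auto
  have below: "j < n i" if "B i j" for i j
  proof (cases i)
    case (Suc l)
    then show ?thesis using that B(2)[of l] grow(1,3)[of l] by auto
  qed (use that B(1) in simp)
  have miss: "B i j \<Longrightarrow> ?miss j" for i j
    by (induction i) (use B KN in auto)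
  have stable: "j < n i \<Longrightarrow> B (i + k) j = B i j" for i j k
  proof (induction k)
    case (Suc k)
    have "n i \<le> n (i + k)" by (rule lift_Suc_mono_le[of n]) (use grow(1) less_imp_le in auto)
    then have "j < n (i + k)" using Suc.prems by simp
    then show ?case using Suc B(2)[of "i + k"] grow(2)[of "i + k"] by auto
  qed simp
  define q where "q j \<longleftrightarrow> (\<exists>i. B i j)" for j
  have q: "q j = B i j" if "j < n i" for i j
  proof
    assume "q j"
    then obtain i' where i': "B i' j" unfolding q_def ..
    show "B i j"
    proof (cases "i \<le> i'")
      case True
      then show ?thesis using stable[OF that, of "i' - i"] i' by simp
    next
      case False
      then show ?thesis using stable[OF below[OF i'], of "i - i'"] i' by simp
    qed
  qed (auto simp: q_def)
  have "x \<in> D q i" for i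
  proof -
    have "\<forall>j<N (n i) (B i) i. q j = ?ext (n i) (B i) (K (n i) (B i) i) j"
      using q[of _ "Suc i"] unfolding n B by blast
    then show ?thesis using KN by blast
  qed
  then have "f x \<in> balls q" by (intro balls) blast
  then obtain k where k: "q k" "d (a (centre k)) (f x) < (1/2) ^ radius k"
    unfolding balls_def by blast
  from k(1) obtain i where "B i k" unfolding q_def ..
  from miss[OF this] k(2) show False by blast
qed

end

text \<open>Stated for an arbitrary family \<open>D\<close>, because it serves again for the
  complements of given closed sets, a family that is constant in \<open>q\<close>.\<close>

definition membership_test :: "'c rep \<Rightarrow> code \<Rightarrow> cantor \<Rightarrow> (cantor \<Rightarrow> nat \<Rightarrow> 'c set) \<Rightarrow> bool" where
  "membership_test X c p D \<longleftrightarrow> (\<forall>q i r x. X r = Some x \<longrightarrow>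
    (\<forall>t. evals (interleave r (interleave q p)) c (pe i t) (of_bool (mem c p q i r t))) \<and>
    (x \<in> D q i \<longleftrightarrow> (\<exists>t. mem c p q i r t)))"

lemma membership_test_total:
  "membership_test X c p D \<Longrightarrow> X r = Some x \<Longrightarrow>
    evals (interleave r (interleave q p)) c (pe i t) (of_bool (mem c p q i r t))"
  unfolding membership_test_def by blast

lemma membership_test_iff:
  "membership_test X c p D \<Longrightarrow> X r = Some x \<Longrightarrow> x \<in> D q i \<longleftrightarrow> (\<exists>t. mem c p q i r t)"
  unfolding membership_test_def by blast

text \<open>An accepting run reads finitely many bits of the combined oracle, and
  \<open>interleave\<close> moves no bit of \<open>q\<close> to a smaller position. This is the
  continuity in \<open>q\<close> required by \<open>piece_cover\<close>.\<close>

lemma membership_test_finite_use: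
  assumes D: "membership_test X c p D" and x: "x \<in> points X" "x \<in> D q i"
  shows "finite_use q (\<lambda>q'. x \<in> D q' i)"
proof -
  obtain r where r: "X r = Some x" using x(1) by (auto simp: ran_def)
  obtain t where "mem c p q i r t" using x(2) membership_test_iff[OF D r] by blast
  then have "finite_use (interleave r (interleave q p))
      (\<lambda>o'. evals o' c (pe i t) 1)"
    unfolding mem_def by (rule evals_finite_use)
  then obtain L where L: "\<And>o'. \<forall>k<L. o' k = interleave r (interleave q p) k \<Longrightarrow> evals o' c (pe i t) 1"
    unfolding finite_use_def by blast
  have "x \<in> D q' i" if q': "\<forall>k<L. q' k = q k" for q'
  proof -
    have "interleave r (interleave q' p) k = interleave r (interleave q p) k" if "k < L" for k
    proof -
      have "k div 2 div 2 < L" using that by linarith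
      then show ?thesis using q' by (simp add: interleave_def)
    qed
    then have "mem c p q' i r t" unfolding mem_def by (intro L) blast
    then show ?thesis using membership_test_iff[OF D r] by blast
  qed
  then show ?thesis unfolding finite_use_def by blast
qed

lemma member_at_iff:
  assumes "membership_test X c p D" "X r = Some x"
  shows "(\<exists>t. member_at c p r J k t) \<longleftrightarrow> bound J \<le> k \<and> x \<in> D (extend J k) (level J)"
  using membership_test_iff[OF assms] unfolding member_at_def by simp

lemma bcomp_piece_oracle:
  assumes "\<And>w. w \<in> W \<Longrightarrow> G w = interleave (r w) (unary_prefix (J w) (p w))"
  shows "bcomp W G I p" and "bcomp W G I r" and "ucomp W G I J"
proof -
  have G: "bcomp W G I (\<lambda>w. interleave (r w) (unary_prefix (J w) (p w)))"
    by (rule bcomp_cong[OF bcomp_oracle]) (simp add: assms)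
  show "bcomp W G I r" using bcomp_evens[OF G] by simp
  have U: "bcomp W G I (\<lambda>w. unary_prefix (J w) (p w))" using bcomp_odds[OF G] by simp
  show "bcomp W G I p" "ucomp W G I J"
    by (rule bcomp_unary_prefix_tail[OF U], rule ucomp_unary_prefix_Least[OF U])
qed

lemma points_subspace_rep: "points (subspace_rep X A) = points X \<inter> A"
  by (auto simp: ran_def subspace_rep_def split: option.splits if_splits)

lemma subspace_rep_eq_Some_iff: "subspace_rep X A r = Some x \<longleftrightarrow> X r = Some x \<and> x \<in> A"
  by (auto simp: subspace_rep_def split: option.splits)

lemma closed_piece_rep_intro:
  "closed_rep X p = Some A \<Longrightarrow> fun_rep (subspace_rep X A) Y q = Some g \<Longrightarrow>
    closed_piece_rep X Y (interleave p q) = Some (A, g)"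
  by (simp add: closed_piece_rep_def)

section \<open>Names of the pieces and of the function on each piece\<close>

context computable_metric_space
begin

abbreviation (input) test_piece :: "'c rep \<Rightarrow> (cantor \<Rightarrow> nat \<Rightarrow> 'c set) \<Rightarrow> nat \<Rightarrow> 'c set" where
  "test_piece X D \<equiv> piece (points X) (\<lambda>J k. D (extend J k) (level J))"

definition clash_at :: "code \<Rightarrow> cantor \<Rightarrow> cantor \<Rightarrow> nat \<Rightarrow> nat \<Rightarrow> nat \<Rightarrow> nat \<Rightarrow> nat \<Rightarrow> nat \<Rightarrow> bool" where
  "clash_at c p r J k k' t t' s \<longleftrightarrow> member_at c p r J k t \<and> member_at c p r J k' t' \<and>
    radius k = radius k' \<and> far_at (centre k) (radius k) (centre k') (radius k) s"

lemma clash_at_iff: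
  assumes D: "membership_test X c p D" and x: "X r = Some x"
  shows "x \<in> test_piece X D J \<longleftrightarrow> \<not> (\<exists>k k' t t' s. clash_at c p r J k k' t t' s)"
proof -
  have "(\<exists>k k' t t' s. clash_at c p r J k k' t t' s) \<longleftrightarrow>
      (\<exists>k k'. (\<exists>t. member_at c p r J k t) \<and> (\<exists>t. member_at c p r J k' t) \<and> radius k = radius k' \<and>
        (\<exists>s. far_at (centre k) (radius k) (centre k') (radius k) s))"
    unfolding clash_at_def by blast
  also have "\<dots> \<longleftrightarrow> (\<exists>k k'. bound J \<le> k \<and> x \<in> D (extend J k) (level J) \<and> bound J \<le> k' \<and>
      x \<in> D (extend J k') (level J) \<and> radius k = radius k' \<and>
      (1/2) ^ radius k + (1/2) ^ radius k < d (a (centre k)) (a (centre k')))"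
    unfolding member_at_iff[OF D x] far_at by (simp only: conj_assoc)
  finally show ?thesis
    unfolding piece_def using pointsI[of X, OF x] by blast
qed

text \<open>The complement is found by searching for a clash; one number packs the two balls
  together with the stages of the three tests.\<close>

lemma piece_closed:
  "\<exists>c'. \<forall>p D J. membership_test X c p D \<longrightarrow>
    closed_rep X (unary_prefix (code_index c') (unary_prefix J p)) = Some (test_piece X D J)"
proof -
  define W :: "(cantor \<times> nat \<times> cantor) set" where "W = {w. \<exists>D x. membership_test X c (fst w) D \<and> X (snd (snd w)) = Some x}"
  let ?p = "\<lambda>w. fst w" and ?J = "\<lambda>w. fst (snd w)" and ?r = "\<lambda>w. snd (snd w)"
  let ?G = "\<lambda>w. interleave (?r w) (unary_prefix (?J w) (?p w))"
  let ?s = "\<lambda>w t. clash_at c (?p w) (?r w) (?J w) (pfst (pfst t)) (psnd (pfst t))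
    (pfst (psnd t)) (pfst (psnd (psnd t))) (psnd (psnd (psnd t)))"
  have p: "bcomp W ?G (\<lambda>_. 0) ?p" and r: "bcomp W ?G (\<lambda>_. 0) ?r" and J: "ucomp W ?G (\<lambda>_. 0) ?J"
    by (rule bcomp_piece_oracle[where r = ?r and J = ?J and p = ?p], simp)+
  have total: "evals (interleave (?r w) (interleave q (?p w))) c (pe i t)
      (of_bool (mem c (?p w) q i (?r w) t))" if w: "w \<in> W" for w q i t
  proof -
    obtain D x where "membership_test X c (?p w) D" "X (?r w) = Some x"
      using w unfolding W_def by blast
    then show ?thesis by (rule membership_test_total)
  qed
  have total': "evals (interleave (?r (fst v)) (interleave q (?p (fst v)))) c (pe i t)
      (of_bool (mem c (?p (fst v)) q i (?r (fst v)) t))" if "v \<in> W \<times> UNIV" for v :: "(cantor \<times> nat \<times> cantor) \<times> nat" and q i t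
    using that by (intro total) auto
  have "bcomp W ?G (\<lambda>_. 0) ?s"
    unfolding clash_at_def
    by (rule bcompI, intro ucomp_conj ucomp_eq ucomp_member_at[OF bcomp_lift[OF p] bcomp_lift[OF r] ucomp_lift[OF J]]
        ucomp_far_at ucomp_centre ucomp_radius ucomp_pfst ucomp_psnd ucomp_snd total')
  from bcomp_computes[OF this] obtain c' where c': "\<forall>w\<in>W. computes c' (?G w) (?s w)" by blast
  have "closed_rep X (unary_prefix (code_index c') (unary_prefix J p)) = Some (test_piece X D J)"
    if D: "membership_test X c p D" for p D J
  proof (rule closed_rep_intro)
    fix r x assume x: "X r = Some x"
    have "(p, J, r) \<in> W" using D x unfolding W_def by auto
    then have "computes c' (interleave r (unary_prefix J p)) (?s (p, J, r))" using c' by fastforce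
    moreover have "x \<notin> test_piece X D J \<longleftrightarrow> (\<exists>t. ?s (p, J, r) t)"
    proof -
      have "(\<exists>k k' t t' s. clash_at c p r J k k' t t' s) \<longleftrightarrow> (\<exists>t. ?s (p, J, r) t)"
      proof
        assume "\<exists>k k' t t' s. clash_at c p r J k k' t t' s"
        then obtain k k' t t' s where "clash_at c p r J k k' t t' s" by blast
        then show "\<exists>t. ?s (p, J, r) t"
          by (intro exI[of _ "pe (pe k k') (pe t (pe t' s))"]) simp
      next
        assume "\<exists>t. ?s (p, J, r) t"
        then show "\<exists>k k' t t' s. clash_at c p r J k k' t t' s"
          unfolding fst_conv snd_conv by (elim exE) (rule exI)+
      qed
      then show ?thesis using clash_at_iff[OF D x] by blast
    qed
    ultimately show "\<exists>s. computes c' (interleave r (unary_prefix J p)) s \<and>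
        (x \<notin> test_piece X D J \<longleftrightarrow> (\<exists>n. s n))" by blast
  qed (auto simp: piece_def)
  then show ?thesis by blast
qed

text \<open>A ball of radius \<open>(1/2) ^ Suc (Suc i)\<close> locates the value up to twice that
  radius, which is the accuracy that \<open>cauchy_name_intro\<close> expects.\<close>

definition approx_at :: "code \<Rightarrow> cantor \<Rightarrow> cantor \<Rightarrow> nat \<Rightarrow> nat \<Rightarrow> nat \<Rightarrow> bool" where
  "approx_at c p r J i t \<longleftrightarrow> member_at c p r J (pfst t) (psnd t) \<and> radius (pfst t) = Suc (Suc i)"

definition approx :: "code \<Rightarrow> cantor \<Rightarrow> cantor \<Rightarrow> nat \<Rightarrow> nat \<Rightarrow> nat" where
  "approx c p r J i = centre (pfst (LEAST t. approx_at c p r J i t))"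

text \<open>A small ball around \<open>f x\<close> with a large enough index is accepted, so the
  search ends. It may end at another ball, even one that misses \<open>f x\<close>; on the piece the
  error is bounded all the same by \<open>piece_accuracy\<close>.\<close>

lemma
  assumes D: "membership_test X c p D" and f: "f \<in> points X \<rightarrow> M"
    and pre: "\<And>q. {x \<in> points X. f x \<in> balls q} = (\<Inter>i. D q i)"
    and x: "X r = Some x" "x \<in> test_piece X D J"
  shows approx_at_exists: "\<exists>t. approx_at c p r J i t"
    and approx_close: "d (a (approx c p r J i)) (f x) \<le> (1/2) ^ Suc i"
proof -
  have xX: "x \<in> points X" using pointsI[of X, OF x(1)] .
  then have fx: "f x \<in> M" using f by blast
  have hit: "x \<in> D (extend J k) (level J)" if "d (a (centre k)) (f x) < (1/2) ^ radius k" for k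
  proof -
    have "extend J k k" by (simp add: extend_def query_set_def)
    then have "f x \<in> balls (extend J k)" using that fx unfolding balls_def by blast
    then show ?thesis using pre[of "extend J k"] xX by blast
  qed
  show ex: "\<exists>t. approx_at c p r J i t"
  proof -
    obtain n where n: "d (a n) (f x) < (1/2) ^ Suc (Suc i)"
      using approx_exists[OF fx, of "(1/2) ^ Suc (Suc i)"] by auto
    obtain k where k: "bound J \<le> k" "centre k = n" "radius k = Suc (Suc i)"
      using ball_index_exists by blast
    have "x \<in> D (extend J k) (level J)" using n k by (intro hit) simp
    then obtain t where "member_at c p r J k t" using member_at_iff[OF D x(1)] k(1) by blast
    then show ?thesis using k(3) by (intro exI[of _ "pe k t"]) (simp add: approx_at_def)
  qed
  define k where "k = pfst (LEAST t. approx_at c p r J i t)"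
  have "approx_at c p r J i (LEAST t. approx_at c p r J i t)" using ex by (rule LeastI_ex)
  then have rad: "radius k = Suc (Suc i)" and "\<exists>t. member_at c p r J k t"
    unfolding approx_at_def k_def by blast+
  then have "bound J \<le> k" "x \<in> D (extend J k) (level J)" using member_at_iff[OF D x(1)] by blast+
  with x(2) fx hit
  have "d (a (centre k)) (f x) \<le> (1/2) ^ radius k + (1/2) ^ radius k" by (rule piece_accuracy)
  then show "d (a (approx c p r J i)) (f x) \<le> (1/2) ^ Suc i"
    unfolding approx_def k_def[symmetric] rad by simp
qed

lemma piece_function:
  "\<exists>c'. \<forall>p D J f. membership_test X c p D \<and> f \<in> points X \<rightarrow> M \<and>
      (\<forall>q. {x \<in> points X. f x \<in> balls q} = (\<Inter>i. D q i)) \<longrightarrow>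
    fun_rep (subspace_rep X (test_piece X D J)) (cauchy_rep M d a)
      (unary_prefix (code_index c') (unary_prefix J p)) = Some (restrict f (test_piece X D J))"
proof -
  define good where "good p D f \<longleftrightarrow> membership_test X c p D \<and> f \<in> points X \<rightarrow> M \<and>
    (\<forall>q. {x \<in> points X. f x \<in> balls q} = (\<Inter>i. D q i))" for p D f
  define W :: "(cantor \<times> nat \<times> cantor) set" where "W = {w. \<exists>D f x. good (fst w) D f \<and>
      X (snd (snd w)) = Some x \<and> x \<in> test_piece X D (fst (snd w))}"
  let ?p = "\<lambda>w. fst w" and ?J = "\<lambda>w. fst (snd w)" and ?r = "\<lambda>w. snd (snd w)"
  let ?G = "\<lambda>w. interleave (?r w) (unary_prefix (?J w) (?p w))"
  let ?W = "W \<times> (UNIV :: nat set)" and ?I = "lifti (\<lambda>_. 0)"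
  have p: "bcomp W ?G (\<lambda>_. 0) ?p" and r: "bcomp W ?G (\<lambda>_. 0) ?r" and J: "ucomp W ?G (\<lambda>_. 0) ?J"
    by (rule bcomp_piece_oracle[where r = ?r and J = ?J and p = ?p], simp)+
  have total: "evals (interleave (?r w) (interleave q (?p w))) c (pe i t)
      (of_bool (mem c (?p w) q i (?r w) t))" if w: "w \<in> W" for w q i t
  proof -
    obtain D x where "membership_test X c (?p w) D" "X (?r w) = Some x"
      using w unfolding W_def good_def by blast
    then show ?thesis by (rule membership_test_total)
  qed
  have total': "evals (interleave (?r (fst (fst v))) (interleave q (?p (fst (fst v))))) c (pe i t)
      (of_bool (mem c (?p (fst (fst v))) q i (?r (fst (fst v))) t))" if "v \<in> (W \<times> UNIV) \<times> UNIV"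
    for v :: "((cantor \<times> nat \<times> cantor) \<times> nat) \<times> nat" and q i t
    using that by (intro total) auto
  have "bcomp ?W (lift ?G) ?I
      (\<lambda>v t. approx_at c (?p (fst v)) (?r (fst v)) (?J (fst v)) (pfst (snd v)) t)"
    unfolding approx_at_def
    by (rule bcompI, intro ucomp_conj ucomp_eq
        ucomp_member_at[OF bcomp_lift[OF bcomp_lift[OF p]] bcomp_lift[OF bcomp_lift[OF r]] ucomp_lift[OF ucomp_lift[OF J]]]
        ucomp_radius ucomp_pfst ucomp_psnd ucomp_snd ucomp_lift[OF ucomp_snd] ucomp_Suc total')
  moreover have "\<exists>t. approx_at c (?p (fst v)) (?r (fst v)) (?J (fst v)) (pfst (snd v)) t"
    if v: "v \<in> ?W" for v
  proof -
    obtain D f x where "good (?p (fst v)) D f" "X (?r (fst v)) = Some x"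
      "x \<in> test_piece X D (?J (fst v))" using v unfolding W_def mem_Times_iff by blast
    then show ?thesis unfolding good_def by (intro approx_at_exists) auto
  qed
  ultimately have "ucomp ?W (lift ?G) ?I
      (\<lambda>v. approx c (?p (fst v)) (?r (fst v)) (?J (fst v)) (pfst (snd v)))"
    unfolding approx_def by (intro ucomp_centre ucomp_pfst ucomp_Least)
  then have "bcomp W ?G (\<lambda>_. 0) (\<lambda>w. graph_of (approx c (?p w) (?r w) (?J w)))"
    unfolding graph_of_def case_prod_beta by (intro bcompI ucomp_eq ucomp_psnd ucomp_snd)
  from bcomp_computes[OF this] obtain c' where
    c': "\<forall>w\<in>W. computes c' (?G w) (graph_of (approx c (?p w) (?r w) (?J w)))" by blast
  have "fun_rep (subspace_rep X (test_piece X D J)) (cauchy_rep M d a)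
      (unary_prefix (code_index c') (unary_prefix J p)) = Some (restrict f (test_piece X D J))"
    if g: "good p D f" for p D J f
  proof (rule fun_rep_intro)
    have "test_piece X D J \<subseteq> points X" by (auto simp: piece_def)
    then show "restrict f (test_piece X D J) \<in> extensional (points (subspace_rep X (test_piece X D J)))"
      by (simp add: points_subspace_rep Int_absorb1)
  next
    fix r x assume "subspace_rep X (test_piece X D J) r = Some x"
    then have x: "X r = Some x" "x \<in> test_piece X D J" by (simp_all add: subspace_rep_eq_Some_iff)
    have w: "(p, J, r) \<in> W" using g x unfolding W_def by auto
    have "f x \<in> M" using g pointsI[of X, OF x(1)] unfolding good_def by blast
    moreover have "d (a (approx c p r J i)) (f x) \<le> (1/2) ^ Suc i" for i
      using g x unfolding good_def by (intro approx_close) auto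
    ultimately have "cauchy_rep M d a (graph_of (approx c p r J)) = Some (f x)"
      by (rule cauchy_name_intro)
    moreover have "computes c' (interleave r (unary_prefix J p)) (graph_of (approx c p r J))"
      using bspec[OF c' w] by simp
    ultimately show "\<exists>s. computes c' (interleave r (unary_prefix J p)) s \<and>
        cauchy_rep M d a s = Some (restrict f (test_piece X D J) x)"
      using x(2) by auto
  qed
  then show ?thesis unfolding good_def by (intro exI[of _ c']) blast
qed

text \<open>A function name may contain any oracle, so the realizer merely prepends the index
  \<open>cS\<close> to \<open>p\<close>. The real work is left to \<open>cA\<close> and
  \<open>cF\<close>, which receive the number of the piece together with \<open>p\<close>.\<close>

lemma Delta2_fun_to_closed_pw:
  "computable_map (Delta2_fun_rep X (cauchy_rep M d a)) (closed_pw_rep X (cauchy_rep M d a)) id"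
proof -
  let ?Y = "cauchy_rep M d a"
  obtain c where c: "\<forall>p f. names_Delta2_fun X ?Y p f \<longrightarrow> (\<exists>D.
      (\<forall>q. {x \<in> points X. f x \<in> balls q} = (\<Inter>i. D q i)) \<and> membership_test X c p D)"
    using Delta2_membership[of X] unfolding membership_test_def ..
  obtain cA where cA: "\<And>p D J. membership_test X c p D \<Longrightarrow>
      closed_rep X (unary_prefix (code_index cA) (unary_prefix J p)) = Some (test_piece X D J)"
    using piece_closed by blast
  obtain cF where cF: "\<forall>p D J f. membership_test X c p D \<and> f \<in> points X \<rightarrow> M \<and>
      (\<forall>q. {x \<in> points X. f x \<in> balls q} = (\<Inter>i. D q i)) \<longrightarrow>
      fun_rep (subspace_rep X (test_piece X D J)) ?Y (unary_prefix (code_index cF) (unary_prefix J p)) =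
        Some (restrict f (test_piece X D J))"
    using piece_function[of X c] ..
  let ?name = "\<lambda>J p. interleave (unary_prefix (code_index cA) (unary_prefix J p))
      (unary_prefix (code_index cF) (unary_prefix J p))"
  let ?G = "\<lambda>w :: nat \<times> cantor. interleave (unat (fst w)) (snd w)"
  have G: "bcomp UNIV ?G (\<lambda>_. 0) ?G" by (rule bcomp_oracle)
  have "bcomp UNIV ?G (\<lambda>_. 0) (\<lambda>w. unat (fst w))" and p: "bcomp UNIV ?G (\<lambda>_. 0) snd"
    using bcomp_evens[OF G] bcomp_odds[OF G] by simp_all
  then have "ucomp UNIV ?G (\<lambda>_. 0) fst" by (intro ucomp_unary_prefix_Least)
  then have "bcomp UNIV ?G (\<lambda>_. 0) (\<lambda>w. ?name (fst w) (snd w))"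
    by (intro bcomp_interleave bcomp_unary_prefix ucomp_const p)
  from bcomp_computes[OF this] obtain cS where cS: "\<And>J p. computes cS (interleave (unat J) p) (?name J p)"
    by auto
  have "bcomp UNIV (\<lambda>p. p) (\<lambda>_. 0) (\<lambda>p. unary_prefix (code_index cS) p)"
    by (intro bcomp_unary_prefix ucomp_const bcomp_oracle)
  from bcomp_computes[OF this] obtain cP where cP: "\<And>p. computes cP p (unary_prefix (code_index cS) p)"
    by auto
  have "closed_pw_rep X ?Y (unary_prefix (code_index cS) p) = Some f"
    if f: "names_Delta2_fun X ?Y p f" for p f
  proof -
    have fXM: "f \<in> points X \<rightarrow>\<^sub>E points ?Y" using f unfolding names_Delta2_fun_def by blast
    then have fM: "f \<in> points X \<rightarrow> M" unfolding points_cauchy_rep by (auto simp: PiE_iff)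
    obtain D where pre: "\<forall>q. {x \<in> points X. f x \<in> balls q} = (\<Inter>i. D q i)"
      and D: "membership_test X c p D" using c[rule_format, OF f] by blast
    let ?A = "test_piece X D"
    have "fun_rep (subspace_rep X (?A J)) ?Y (unary_prefix (code_index cF) (unary_prefix J p)) =
        Some (restrict f (?A J))" for J
      using D fM pre by (intro cF[rule_format] conjI)
    from closed_piece_rep_intro[OF cA[OF D] this]
    have "fun_rep nat_rep (closed_piece_rep X ?Y) (unary_prefix (code_index cS) p) =
        Some (\<lambda>J. (?A J, restrict f (?A J)))"
      using cS by (intro fun_rep_nat_intro) blast
    moreover have "(\<Union>J. ?A J) = points X"
    proof
      show "(\<Union>J. ?A J) \<subseteq> points X" by (auto simp: piece_def)
      show "points X \<subseteq> (\<Union>J. ?A J)"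
      proof
        fix x assume x: "x \<in> points X"
        have "f x \<in> M" using fM x by blast
        moreover have "f x \<in> balls q" if "\<forall>i. x \<in> D q i" for q
          using that pre[rule_format, of q] by blast
        ultimately have "\<exists>J. x \<in> ?A J"
          using x membership_test_finite_use[OF D x] by (intro piece_cover)
        then show "x \<in> (\<Union>J. ?A J)" by blast
      qed
    qed
    ultimately show ?thesis
      unfolding closed_pw_rep_eq_Some_iff names_closed_pw_def using fXM by auto
  qed
  then have "\<forall>p f. Delta2_fun_rep X ?Y p = Some f \<longrightarrow>
      (\<exists>q. computes cP p q \<and> closed_pw_rep X ?Y q = Some (id f))"
    unfolding Delta2_fun_rep_eq_Some_iff using cP by auto
  then show ?thesis unfolding computable_map_def by blast
qed

end

section \<open>From closed pieces to \<open>\<Delta>\<^sub>2\<close>-functions\<close>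

lemma ucomp_brun_oracle:
  assumes "bcomp W G I q" "ucomp W G I T" "ucomp W G I N"
  shows "ucomp W G I (\<lambda>w. brun (q w) (T w) c (N w))"
proof -
  let ?J = "\<lambda>v :: cantor \<times> nat \<times> nat. pe (fst (snd v)) (snd (snd v))"
  have "ucomp UNIV fst ?J (\<lambda>v. fst (snd v))" "ucomp UNIV fst ?J (\<lambda>v. snd (snd v))"
    using ucomp_pfst[OF ucomp_input, of UNIV fst ?J] ucomp_psnd[OF ucomp_input, of UNIV fst ?J]
    by simp_all
  then have "ucomp UNIV fst ?J (\<lambda>v. brun (fst v) (fst (snd v)) c (snd (snd v)))"
    by (intro ucomp_brun[where G = fst] ucomp_const)
  from ucomp_oracle[OF this, of W "\<lambda>w. (q w, T w, N w)" G I] show ?thesis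
    using ucomp_pair[OF assms(2,3)] assms(1) by simp
qed

text \<open>The oracle has the shape fixed by \<open>mem\<close>, with the name \<open>u\<close> of
  an open set in the place of a sequence of balls, so that the facts about \<open>mem\<close> apply
  again.\<close>

lemma closed_test_code:
  "\<exists>c. \<forall>p u j y r s k. app p (unat j) y \<longrightarrow> app (evens y) r s \<longrightarrow>
    evals (interleave r (interleave u p)) c (pe j k) (of_bool (s k))"
proof -
  define W where "W = {(p, u :: cantor, j, y, r, s). app p (unat j) y \<and> app (evens y) r s}"
  define P U Y R S :: "cantor \<times> cantor \<times> nat \<times> cantor \<times> cantor \<times> cantor \<Rightarrow> cantor"
    where "P = (\<lambda>(p, u, j, y, r, s). p)" and "U = (\<lambda>(p, u, j, y, r, s). u)"
    and "Y = (\<lambda>(p, u, j, y, r, s). y)" and "R = (\<lambda>(p, u, j, y, r, s). r)"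
    and "S = (\<lambda>(p, u, j, y, r, s). s)"
  define I :: "cantor \<times> cantor \<times> nat \<times> cantor \<times> cantor \<times> cantor \<Rightarrow> nat"
    where "I = (\<lambda>(p, u, j, y, r, s). j)"
  note proj = P_def U_def Y_def R_def S_def I_def
  have W: "app (P w) (unat (I w)) (Y w)" "app (evens (Y w)) (R w) (S w)" if "w \<in> W" for w
    using that by (cases w; simp add: W_def proj)+
  let ?G = "\<lambda>w. interleave (R w) (interleave (U w) (P w))"
  have G: "bcomp W ?G I ?G" by (rule bcomp_oracle)
  have R: "bcomp W ?G I R" using bcomp_evens[OF G] by simp
  have P: "bcomp W ?G I P" using bcomp_odds[OF bcomp_odds[OF G]] by simp
  from bcomp_app[OF P bcomp_unary_prefix[OF ucomp_input bcomp_False] W(1)] have "bcomp W ?G I Y" .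
  from bcomp_app[OF bcomp_evens[OF this] R W(2)] have "bcomp W ?G I S" .
  then obtain c where c: "\<forall>w\<in>W. \<forall>k. evals (?G w) c (pe (I w) k) (of_bool (S w k))"
    unfolding bcomp_def ..
  have "evals (interleave r (interleave u p)) c (pe j k) (of_bool (s k))"
    if "app p (unat j) y" "app (evens y) r s" for p u j y r s k
  proof -
    have "(p, u, j, y, r, s) \<in> W" using that by (simp add: W_def)
    from c[rule_format, OF this] show ?thesis by (simp only: proj prod.case)
  qed
  then show ?thesis by (intro exI[of _ c] allI impI)
qed

lemma function_test_code:
  "\<exists>c. \<forall>p u j y r s v k. app p (unat j) y \<longrightarrow> app (odds y) r s \<longrightarrow> app u s v \<longrightarrow>
    evals (interleave r (interleave u p)) c (pe j k) (of_bool (v k))"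
proof -
  define W where "W = {(p, u, j, y, r, s, v). app p (unat j) y \<and> app (odds y) r s \<and> app u s v}"
  define P U Y R S V :: "cantor \<times> cantor \<times> nat \<times> cantor \<times> cantor \<times> cantor \<times> cantor \<Rightarrow> cantor"
    where "P = (\<lambda>(p, u, j, y, r, s, v). p)" and "U = (\<lambda>(p, u, j, y, r, s, v). u)"
    and "Y = (\<lambda>(p, u, j, y, r, s, v). y)" and "R = (\<lambda>(p, u, j, y, r, s, v). r)"
    and "S = (\<lambda>(p, u, j, y, r, s, v). s)" and "V = (\<lambda>(p, u, j, y, r, s, v). v)"
  define I :: "cantor \<times> cantor \<times> nat \<times> cantor \<times> cantor \<times> cantor \<times> cantor \<Rightarrow> nat"
    where "I = (\<lambda>(p, u, j, y, r, s, v). j)"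
  note proj = P_def U_def Y_def R_def S_def V_def I_def
  have W: "app (P w) (unat (I w)) (Y w)" "app (odds (Y w)) (R w) (S w)" "app (U w) (S w) (V w)"
    if "w \<in> W" for w
    using that by (cases w; simp add: W_def proj)+
  let ?G = "\<lambda>w. interleave (R w) (interleave (U w) (P w))"
  have G: "bcomp W ?G I ?G" by (rule bcomp_oracle)
  have R: "bcomp W ?G I R" using bcomp_evens[OF G] by simp
  have U: "bcomp W ?G I U" using bcomp_evens[OF bcomp_odds[OF G]] by simp
  have P: "bcomp W ?G I P" using bcomp_odds[OF bcomp_odds[OF G]] by simp
  from bcomp_app[OF P bcomp_unary_prefix[OF ucomp_input bcomp_False] W(1)] have "bcomp W ?G I Y" .
  from bcomp_app[OF bcomp_odds[OF this] R W(2)] have "bcomp W ?G I S" .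
  from bcomp_app[OF U this W(3)] have "bcomp W ?G I V" .
  then obtain c where c: "\<forall>w\<in>W. \<forall>k. evals (?G w) c (pe (I w) k) (of_bool (V w k))"
    unfolding bcomp_def ..
  have "evals (interleave r (interleave u p)) c (pe j k) (of_bool (v k))"
    if "app p (unat j) y" "app (odds y) r s" "app u s v" for p u j y r s v k
  proof -
    have "(p, u, j, y, r, s, v) \<in> W" using that by (simp add: W_def)
    from c[rule_format, OF this] show ?thesis by (simp only: proj prod.case)
  qed
  then show ?thesis by (intro exI[of _ c] allI impI)
qed

lemma ex_pair_iff: "(\<exists>n. P (pfst n) (psnd n)) \<longleftrightarrow> (\<exists>i j. P i j)"
proof
  assume "\<exists>i j. P i j"
  then obtain i j where "P i j" by blast
  then show "\<exists>n. P (pfst n) (psnd n)" by (intro exI[of _ "pe i j"]) simp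
qed blast

text \<open>Off \<open>A j\<close> the machine for the piece may diverge or answer anything. The
  test is therefore constrained on \<open>A j\<close> only, and below it is run through
  \<open>brun\<close> instead of being treated as a decidable bit.\<close>

definition function_test ::
    "'c rep \<Rightarrow> code \<Rightarrow> cantor \<Rightarrow> (nat \<Rightarrow> 'c set) \<Rightarrow> cantor \<Rightarrow> 'c set \<Rightarrow> bool" where
  "function_test X c p A u B \<longleftrightarrow> (\<forall>j r x. X r = Some x \<longrightarrow> x \<in> A j \<longrightarrow>
    (x \<in> B \<longleftrightarrow> (\<exists>k. mem c p u j r k)))"

abbreviation (input) closed_test :: "'c rep \<Rightarrow> code \<Rightarrow> cantor \<Rightarrow> (nat \<Rightarrow> 'c set) \<Rightarrow> bool" where
  "closed_test X c p A \<equiv> membership_test X c p (\<lambda>_ j. points X - A j)"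

lemma closed_piece_rep_eq_Some:
  assumes "closed_piece_rep X Y y = Some z"
  shows "closed_rep X (evens y) = Some (fst z)"
    and "fun_rep (subspace_rep X (fst z)) Y (odds y) = Some (snd z)"
  using assms unfolding closed_piece_rep_def by (auto split: option.splits)

lemma closed_pw_tests:
  "\<exists>cA cF. \<forall>p f. names_closed_pw X Y p f \<longrightarrow> (\<exists>A. (\<Union>j. A j) = points X \<and> closed_test X cA p A \<and>
    (\<forall>u U. open_rep Y u = Some U \<longrightarrow> function_test X cF p A u {x \<in> points X. f x \<in> U}))"
proof -
  obtain cA where cA: "\<forall>p u j y r s k. app p (unat j) y \<longrightarrow> app (evens y) r s \<longrightarrow>
      evals (interleave r (interleave u p)) cA (pe j k) (of_bool (s k))"
    using closed_test_code ..
  obtain cF where cF: "\<forall>p u j y r s v k. app p (unat j) y \<longrightarrow> app (odds y) r s \<longrightarrow> app u s v \<longrightarrow>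
      evals (interleave r (interleave u p)) cF (pe j k) (of_bool (v k))"
    using function_test_code ..
  have "(\<exists>A. (\<Union>j. A j) = points X \<and> closed_test X cA p A \<and>
      (\<forall>u U. open_rep Y u = Some U \<longrightarrow> function_test X cF p A u {x \<in> points X. f x \<in> U}))"
    if name: "names_closed_pw X Y p f" for p f
  proof -
    obtain s where s: "fun_rep nat_rep (closed_piece_rep X Y) p = Some s"
      and cover: "(\<Union>j. fst (s j)) = points X" and f: "\<forall>j. snd (s j) = restrict f (fst (s j))"
      using name unfolding names_closed_pw_def by blast
    define A where "A j = fst (s j)" for j
    have y: "\<exists>y. app p (unat j) y \<and> closed_rep X (evens y) = Some (A j) \<and>
        fun_rep (subspace_rep X (A j)) Y (odds y) = Some (restrict f (A j))" for j
      using fun_rep_nat_app[OF s, of j] closed_piece_rep_eq_Some f unfolding A_def by metis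
    have "closed_test X cA p A"
      unfolding membership_test_def
    proof (intro allI impI)
      fix q i r x assume x: "X r = Some x"
      obtain y where y: "app p (unat i) y" "closed_rep X (evens y) = Some (A i)" using y by blast
      obtain v where v: "app (evens y) r v" "x \<notin> A i \<longleftrightarrow> (\<exists>n. v n)"
        using closed_rep_app[OF y(2) x] by blast
      note ev = cA[rule_format, OF y(1) v(1)]
      show "(\<forall>t. evals (interleave r (interleave q p)) cA (pe i t) (of_bool (mem cA p q i r t))) \<and>
          (x \<in> points X - A i \<longleftrightarrow> (\<exists>t. mem cA p q i r t))"
        unfolding mem_iff[OF ev] using ev v(2) pointsI[of X, OF x] by blast
    qed
    moreover have "function_test X cF p A u {x \<in> points X. f x \<in> U}" if u: "open_rep Y u = Some U" for u U
      unfolding function_test_def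
    proof (intro allI impI)
      fix j r x assume x: "X r = Some x" "x \<in> A j"
      obtain y where y: "app p (unat j) y"
        "fun_rep (subspace_rep X (A j)) Y (odds y) = Some (restrict f (A j))" using y by blast
      have "subspace_rep X (A j) r = Some x" using x by (simp add: subspace_rep_eq_Some_iff)
      from fun_rep_app[OF y(2) this] obtain t where t: "app (odds y) r t" "Y t = Some (f x)"
        using x(2) by auto
      obtain v where v: "app u t v" "f x \<in> U \<longleftrightarrow> (\<exists>n. v n)"
        using open_rep_app[OF u t(2)] by blast
      show "x \<in> {x \<in> points X. f x \<in> U} \<longleftrightarrow> (\<exists>k. mem cF p u j r k)"
        unfolding mem_iff[OF cF[rule_format, OF y(1) t(1) v(1)]]
        using v(2) pointsI[of X, OF x(1)] by simp
    qed
    ultimately show ?thesis using cover unfolding A_def by blast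
  qed
  then show ?thesis by blast
qed

subsection \<open>The open sets\<close>

text \<open>\<open>brun\<close> returns the output plus one, so 2 stands for acceptance.\<close>

lemma brun_eq_2_iff:
  "(\<exists>t. brun (interleave r (interleave q p)) t c (pe i k) = 2) \<longleftrightarrow> mem c p q i r k"
  unfolding mem_def using brun_complete[of _ c _ 1] brun_sound[of _ _ c _ 1]
  by (auto simp: numeral_2_eq_2)

lemma bcomp_test_oracle:
  assumes "\<And>w. w \<in> W \<Longrightarrow> G w = interleave (r w) (unary_prefix (J w) (interleave (u w) (p w)))"
  shows "bcomp W G I u" and "bcomp W G I p" and "bcomp W G I r" and "ucomp W G I J"
proof -
  note * = bcomp_piece_oracle[where J = J and r = r and p = "\<lambda>w. interleave (u w) (p w)", OF assms]
  show "bcomp W G I u" "bcomp W G I p" using bcomp_evens[OF *(1)] bcomp_odds[OF *(1)] by simp_all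
  show "bcomp W G I r" by (rule *(2))
  show "ucomp W G I J" by (rule *(3))
qed

text \<open>False acceptance by the function test off \<open>A (pfst J)\<close> is harmless, because
  those points belong to the set anyway.\<close>

lemma open_piece_test:
  "\<exists>c. \<forall>p A u B J. closed_test X cA p A \<and> function_test X cF p A u B \<and> B \<subseteq> points X \<longrightarrow>
    open_rep X (unary_prefix (code_index c) (unary_prefix J (interleave u p))) =
      Some (points X - A (pfst J) \<union> B)"
proof -
  define W :: "(cantor \<times> cantor \<times> nat \<times> cantor) set"
    where "W = {w. \<exists>A x. closed_test X cA (fst (snd w)) A \<and> X (snd (snd (snd w))) = Some x}"
  let ?u = "\<lambda>w. fst w" and ?p = "\<lambda>w. fst (snd w)" and ?J = "\<lambda>w. fst (snd (snd w))"
    and ?r = "\<lambda>w. snd (snd (snd w))"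
  let ?G = "\<lambda>w. interleave (?r w) (unary_prefix (?J w) (interleave (?u w) (?p w)))"
  let ?s = "\<lambda>w n. mem cA (?p w) (?u w) (pfst (?J w)) (?r w) n \<or>
    brun (interleave (?r w) (interleave (?u w) (?p w))) (psnd n) cF (pe (pfst (?J w)) (pfst n)) = 2"
  have u: "bcomp W ?G (\<lambda>_. 0) ?u" and p: "bcomp W ?G (\<lambda>_. 0) ?p" and r: "bcomp W ?G (\<lambda>_. 0) ?r"
    and J: "ucomp W ?G (\<lambda>_. 0) ?J"
    by (rule bcomp_test_oracle[where u = ?u and r = ?r and J = ?J and p = ?p], simp)+
  have total: "evals (interleave (?r w) (interleave q (?p w))) cA (pe i t)
      (of_bool (mem cA (?p w) q i (?r w) t))" if w: "w \<in> W" for w q i t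
  proof -
    obtain A x where "closed_test X cA (?p w) A" "X (?r w) = Some x" using w unfolding W_def by blast
    then show ?thesis by (rule membership_test_total)
  qed
  have "ucomp (W \<times> UNIV) (lift ?G) (lifti (\<lambda>_. 0))
      (\<lambda>v. of_bool (mem cA (?p (fst v)) (?u (fst v)) (pfst (?J (fst v))) (?r (fst v)) (snd v)))"
    by (intro ucomp_mem bcomp_lift[OF u] bcomp_lift[OF p] bcomp_lift[OF r] ucomp_lift[OF J]
        ucomp_pfst ucomp_snd total) auto
  then have "bcomp W ?G (\<lambda>_. 0) ?s"
    by (intro bcompI ucomp_disj ucomp_eq ucomp_brun_oracle bcomp_interleave bcomp_lift[OF u]
        bcomp_lift[OF p] bcomp_lift[OF r] ucomp_lift[OF J] ucomp_pair ucomp_pfst ucomp_psnd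
        ucomp_snd ucomp_const)
  from bcomp_computes[OF this] obtain c where c: "\<forall>w\<in>W. computes c (?G w) (?s w)" by blast
  have "open_rep X (unary_prefix (code_index c) (unary_prefix J (interleave u p))) =
      Some (points X - A (pfst J) \<union> B)"
    if A: "closed_test X cA p A" and B: "function_test X cF p A u B" "B \<subseteq> points X" for p A u B J
  proof (rule open_rep_intro)
    fix r x assume x: "X r = Some x"
    have "(u, p, J, r) \<in> W" using A x unfolding W_def by auto
    from bspec[OF c this]
    have "computes c (interleave r (unary_prefix J (interleave u p))) (?s (u, p, J, r))" by simp
    moreover have "x \<in> points X - A (pfst J) \<union> B \<longleftrightarrow> (\<exists>n. ?s (u, p, J, r) n)"
    proof -
      have mA: "x \<in> points X - A (pfst J) \<longleftrightarrow> (\<exists>n. mem cA p u (pfst J) r n)"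
        by (rule membership_test_iff[OF A x])
      have "x \<in> points X - A (pfst J) \<union> B \<longleftrightarrow>
          x \<in> points X - A (pfst J) \<or> (\<exists>k. mem cF p u (pfst J) r k)"
        using B x pointsI[of X, OF x] unfolding function_test_def by blast
      also have "\<dots> \<longleftrightarrow> (\<exists>n. mem cA p u (pfst J) r n) \<or>
          (\<exists>n. brun (interleave r (interleave u p)) (psnd n) cF (pe (pfst J) (pfst n)) = 2)"
        unfolding mA brun_eq_2_iff[of r u p cF "pfst J", symmetric]
          ex_pair_iff[where P = "\<lambda>k t. brun _ t _ (pe _ k) = 2"] ..
      finally show ?thesis by simp blast
    qed
    ultimately show "\<exists>s. computes c (interleave r (unary_prefix J (interleave u p))) s \<and>
        (x \<in> points X - A (pfst J) \<union> B \<longleftrightarrow> (\<exists>n. s n))" by blast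
  qed (use B(2) in blast)
  then show ?thesis by blast
qed

subsection \<open>The closed sets\<close>

text \<open>
  An index \<open>J\<close> of a closed set stands for \<open>(j, S, k, t)\<close>: the test of the function on the piece \<open>j\<close>
  accepts at \<open>k\<close>, after at most \<open>t\<close> steps, every name that begins with the first \<open>t\<close> entries of \<open>S\<close>.
\<close>

abbreviation (input) prefix_at :: "nat \<Rightarrow> nat \<Rightarrow> nat" where
  "prefix_at J \<equiv> seqn (pfst (psnd J))"

abbreviation (input) time :: "nat \<Rightarrow> nat" where
  "time J \<equiv> psnd (psnd (psnd J))"

definition accepted :: "code \<Rightarrow> cantor \<Rightarrow> nat \<Rightarrow> bool" where
  "accepted c q J \<longleftrightarrow>
    brun (interleave (graph_of (prefix_at J)) q) (time J) c (pe (pfst J) (pfst (psnd (psnd J)))) = 2"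

lemma ucomp_accepted:
  assumes q: "bcomp W G I q" and J: "ucomp W G I J"
  shows "ucomp W G I (\<lambda>w. of_bool (accepted c (q w) (J w)))"
proof -
  have "bcomp W G I (\<lambda>w. graph_of (prefix_at (J w)))"
    unfolding graph_of_def case_prod_beta
    by (intro bcompI ucomp_eq ucomp_seqn ucomp_pfst ucomp_psnd ucomp_snd ucomp_lift[OF J])
  then show ?thesis
    unfolding accepted_def
    by (intro ucomp_eq ucomp_brun_oracle bcomp_interleave ucomp_pair ucomp_pfst ucomp_psnd ucomp_const q J)
qed

context computable_metric_space
begin

text \<open>
  The points of the piece \<open>j\<close> that have a name beginning with the word \<open>S\<close>, provided that this
  word alone makes the test of the function accept.
\<close>

definition certified :: "(nat \<Rightarrow> 'a set) \<Rightarrow> code \<Rightarrow> cantor \<Rightarrow> nat \<Rightarrow> 'a set" where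
  "certified A c q J = {x \<in> A (pfst J). accepted c q J \<and>
    (\<forall>i<time J. d (a (prefix_at J i)) x \<le> (1/2) ^ Suc i)}"

text \<open>The code of \<open>(i, n)\<close> is at least \<open>i\<close>, so a position below
  \<open>t\<close> can only concern an entry below \<open>t\<close>. This matches the bound on
  oracle positions in \<open>brun\<close>.\<close>

lemma graph_of_prefix:
  assumes "\<And>i. i < t \<Longrightarrow> g i = h i" "k < t"
  shows "interleave (graph_of g) q k = interleave (graph_of h) q k"
proof -
  obtain i n where k: "k div 2 = pe i n" by (metis pe_pfst_psnd)
  then have "i \<le> k div 2" using le_prod_encode_1[of i n] by simp
  then have "i < t" using assms(2) by linarith
  then show ?thesis using assms(1) by (simp add: interleave_def graph_of_def k)
qed

text \<open>A certified point has a name that begins with the word: prolong the word by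
  approximations of the point. The bounded run cannot tell the difference and still accepts.
  Conversely, an accepting run on some name with halved errors uses only a beginning of it, which
  yields the word and the time.\<close>

lemma Union_certified:
  assumes A: "\<And>j. A j \<subseteq> M" and F: "function_test (cauchy_rep M d a) c p A u B"
    and cover: "B \<subseteq> (\<Union>j. A j)"
  shows "(\<Union>J. certified A c (interleave u p) J) = B"
proof (intro equalityI subsetI)
  fix x assume "x \<in> (\<Union>J. certified A c (interleave u p) J)"
  then obtain J where x: "x \<in> A (pfst J)" "accepted c (interleave u p) J"
    "\<And>i. i < time J \<Longrightarrow> d (a (prefix_at J i)) x \<le> (1/2) ^ Suc i"
    unfolding certified_def by blast
  have xM: "x \<in> M" using A x(1) by blast
  obtain h where h: "\<And>i. d (a (h i)) x \<le> (1/2) ^ Suc i"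
    using cauchy_name_exists[OF xM] by blast
  define g where "g i = (if i < time J then prefix_at J i else h i)" for i
  have name: "cauchy_rep M d a (graph_of g) = Some x"
    by (rule cauchy_name_intro[OF xM]) (use x(3) h in \<open>auto simp: g_def\<close>)
  have "brun (interleave (graph_of g) (interleave u p)) (time J) c
      (pe (pfst J) (pfst (psnd (psnd J)))) = 2"
    using x(2) unfolding accepted_def
    by (subst brun_local[OF graph_of_prefix[where h = "prefix_at J"]]) (auto simp: g_def)
  then have "mem c p u (pfst J) (graph_of g) (pfst (psnd (psnd J)))"
    using brun_eq_2_iff by blast
  then show "x \<in> B" using F name x(1) unfolding function_test_def by blast
next
  fix x assume xB: "x \<in> B"
  then obtain j where j: "x \<in> A j" using cover by blast
  then have xM: "x \<in> M" using A by blast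
  obtain g where g: "\<And>i. d (a (g i)) x \<le> (1/2) ^ Suc i"
    using cauchy_name_exists[OF xM] by blast
  have "cauchy_rep M d a (graph_of g) = Some x" by (rule cauchy_name_intro[OF xM g])
  then obtain k where "mem c p u j (graph_of g) k" using F j xB unfolding function_test_def by blast
  then obtain t where t: "brun (interleave (graph_of g) (interleave u p)) t c (pe j k) = 2"
    using brun_eq_2_iff by blast
  obtain S where S: "\<forall>i<t. seqn S i = g i" using seqn_exists ..
  have "brun (interleave (graph_of (seqn S)) (interleave u p)) t c (pe j k) = 2"
    using S by (subst brun_local[OF graph_of_prefix[where h = g]]) (auto simp: t)
  then have "x \<in> certified A c (interleave u p) (pe j (pe S (pe k t)))"
    using j S g unfolding certified_def accepted_def by simp
  then show "x \<in> (\<Union>J. certified A c (interleave u p) J)" by blast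
qed

text \<open>Each condition is closed: \<open>A (pfst J)\<close> is closed, acceptance is decidable
  and does not mention \<open>x\<close>, and the bounds on distances are non-strict, so that their
  failure is semidecidable.\<close>

lemma certified_closed:
  "\<exists>c. \<forall>p A u J. closed_test (cauchy_rep M d a) cA p A \<and> (\<forall>j. A j \<subseteq> M) \<longrightarrow>
    closed_rep (cauchy_rep M d a) (unary_prefix (code_index c) (unary_prefix J (interleave u p))) =
      Some (certified A cF (interleave u p) J)"
proof -
  let ?X = "cauchy_rep M d a"
  define W :: "(cantor \<times> cantor \<times> nat \<times> cantor) set"
    where "W = {w. \<exists>A x. closed_test ?X cA (fst (snd w)) A \<and> ?X (snd (snd (snd w))) = Some x}"
  let ?u = "\<lambda>w. fst w" and ?p = "\<lambda>w. fst (snd w)" and ?J = "\<lambda>w. fst (snd (snd w))"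
    and ?r = "\<lambda>w. snd (snd (snd w))"
  let ?G = "\<lambda>w. interleave (?r w) (unary_prefix (?J w) (interleave (?u w) (?p w)))"
  let ?s = "\<lambda>w n. mem cA (?p w) (?u w) (pfst (?J w)) (?r w) n \<or>
    \<not> accepted cF (interleave (?u w) (?p w)) (?J w) \<or>
    (pfst n < time (?J w) \<and>
      outside_at (?r w) (prefix_at (?J w) (pfst n)) (Suc (pfst n)) (psnd n))"
  have u: "bcomp W ?G (\<lambda>_. 0) ?u" and p: "bcomp W ?G (\<lambda>_. 0) ?p" and r: "bcomp W ?G (\<lambda>_. 0) ?r"
    and J: "ucomp W ?G (\<lambda>_. 0) ?J"
    by (rule bcomp_test_oracle[where u = ?u and r = ?r and J = ?J and p = ?p], simp)+
  have total: "evals (interleave (?r w) (interleave q (?p w))) cA (pe i t)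
      (of_bool (mem cA (?p w) q i (?r w) t))" if w: "w \<in> W" for w q i t
  proof -
    obtain A x where "closed_test ?X cA (?p w) A" "?X (?r w) = Some x" using w unfolding W_def by blast
    then show ?thesis by (rule membership_test_total)
  qed
  have "ucomp (W \<times> UNIV) (lift ?G) (lifti (\<lambda>_. 0))
      (\<lambda>v. of_bool (mem cA (?p (fst v)) (?u (fst v)) (pfst (?J (fst v))) (?r (fst v)) (snd v)))"
    by (intro ucomp_mem bcomp_lift[OF u] bcomp_lift[OF p] bcomp_lift[OF r] ucomp_lift[OF J]
        ucomp_pfst ucomp_snd total) auto
  then have "bcomp W ?G (\<lambda>_. 0) ?s"
    by (intro bcompI ucomp_disj ucomp_conj ucomp_not ucomp_less ucomp_accepted ucomp_outside_at
        ucomp_seqn bcomp_interleave bcomp_lift[OF u] bcomp_lift[OF p] bcomp_lift[OF r]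
        ucomp_lift[OF J] ucomp_Suc ucomp_pfst ucomp_psnd ucomp_snd)
  from bcomp_computes[OF this] obtain c where c: "\<forall>w\<in>W. computes c (?G w) (?s w)" by blast
  have "closed_rep ?X (unary_prefix (code_index c) (unary_prefix J (interleave u p))) =
      Some (certified A cF (interleave u p) J)"
    if A: "closed_test ?X cA p A" "\<forall>j. A j \<subseteq> M" for p A u J
  proof (rule closed_rep_intro)
    show "certified A cF (interleave u p) J \<subseteq> points ?X"
      using A(2) unfolding certified_def points_cauchy_rep by blast
  next
    fix r x assume x: "?X r = Some x"
    have "(u, p, J, r) \<in> W" using A x unfolding W_def by auto
    from bspec[OF c this]
    have "computes c (interleave r (unary_prefix J (interleave u p))) (?s (u, p, J, r))" by simp
    moreover have "x \<notin> certified A cF (interleave u p) J \<longleftrightarrow> (\<exists>n. ?s (u, p, J, r) n)"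
    proof -
      have mA: "x \<in> points ?X - A (pfst J) \<longleftrightarrow> (\<exists>n. mem cA p u (pfst J) r n)"
        by (rule membership_test_iff[OF A(1) x])
      have "x \<notin> certified A cF (interleave u p) J \<longleftrightarrow> x \<in> points ?X - A (pfst J) \<or>
          \<not> accepted cF (interleave u p) J \<or>
          (\<exists>i<time J. (1/2) ^ Suc i < d (a (prefix_at J i)) x)"
        using pointsI[of ?X, OF x] unfolding certified_def by (auto simp: not_le)
      also have "\<dots> \<longleftrightarrow> (\<exists>n. mem cA p u (pfst J) r n) \<or> \<not> accepted cF (interleave u p) J \<or>
          (\<exists>n. pfst n < time J \<and> outside_at r (prefix_at J (pfst n)) (Suc (pfst n)) (psnd n))"
        unfolding mA outside_at[OF x, symmetric]
          ex_pair_iff[where P = "\<lambda>i t. i < _ \<and> outside_at _ (_ i) (Suc i) t"] by blast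
      finally show ?thesis by simp blast
    qed
    ultimately show "\<exists>s. computes c (interleave r (unary_prefix J (interleave u p))) s \<and>
        (x \<notin> certified A cF (interleave u p) J \<longleftrightarrow> (\<exists>n. s n))" by blast
  qed
  then show ?thesis by blast
qed

text \<open>Names are nested: \<open>cU\<close> for the preimage map, \<open>cS\<close> for the
  sequence of pairs, \<open>cC\<close> and \<open>cV\<close> for the closed and open members. The
  outer machines only prepend an index to the data they receive; the argument \<open>u\<close> of
  the preimage map joins \<open>p\<close> as the oracle \<open>interleave u p\<close>.\<close>

lemma closed_pw_to_Delta2_fun:
  "\<exists>c. \<forall>p f. names_closed_pw (cauchy_rep M d a) Y p f \<longrightarrow>
    (\<exists>q. computes c p q \<and> names_Delta2_fun (cauchy_rep M d a) Y q f)"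
proof -
  let ?X = "cauchy_rep M d a"
  obtain cA cF where tests: "\<forall>p f. names_closed_pw ?X Y p f \<longrightarrow>
      (\<exists>A. (\<Union>j. A j) = points ?X \<and> closed_test ?X cA p A \<and>
        (\<forall>u U. open_rep Y u = Some U \<longrightarrow> function_test ?X cF p A u {x \<in> points ?X. f x \<in> U}))"
    using closed_pw_tests[of ?X Y] by (elim exE) (rule that)
  obtain cV where cV: "\<forall>p A u B J.
      closed_test ?X cA p A \<and> function_test ?X cF p A u B \<and> B \<subseteq> points ?X \<longrightarrow>
      open_rep ?X (unary_prefix (code_index cV) (unary_prefix J (interleave u p))) =
        Some (points ?X - A (pfst J) \<union> B)"
    using open_piece_test ..
  obtain cC where cC: "\<forall>p A u J. closed_test ?X cA p A \<and> (\<forall>j. A j \<subseteq> M) \<longrightarrow>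
      closed_rep ?X (unary_prefix (code_index cC) (unary_prefix J (interleave u p))) =
        Some (certified A cF (interleave u p) J)"
    using certified_closed ..
  let ?name = "\<lambda>J q. interleave (unary_prefix (code_index cC) (unary_prefix J q))
      (unary_prefix (code_index cV) (unary_prefix J q))"
  let ?G = "\<lambda>w :: nat \<times> cantor. interleave (unat (fst w)) (snd w)"
  have G: "bcomp UNIV ?G (\<lambda>_. 0) ?G" by (rule bcomp_oracle)
  have "bcomp UNIV ?G (\<lambda>_. 0) (\<lambda>w. unat (fst w))" and q: "bcomp UNIV ?G (\<lambda>_. 0) snd"
    using bcomp_evens[OF G] bcomp_odds[OF G] by simp_all
  then have "ucomp UNIV ?G (\<lambda>_. 0) fst" by (intro ucomp_unary_prefix_Least)
  then have "bcomp UNIV ?G (\<lambda>_. 0) (\<lambda>w. ?name (fst w) (snd w))"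
    by (intro bcomp_interleave bcomp_unary_prefix ucomp_const q)
  from bcomp_computes[OF this] obtain cS
    where cS: "\<And>J q. computes cS (interleave (unat J) q) (?name J q)" by auto
  have prefix: "\<exists>c'. \<forall>q. computes c' q (unary_prefix (code_index c) q)" for c
    using bcomp_computes[OF bcomp_unary_prefix[OF ucomp_const bcomp_oracle, of UNIV "\<lambda>q. q"]]
    by simp
  obtain cU where cU: "\<forall>q. computes cU q (unary_prefix (code_index cS) q)" using prefix ..
  obtain cP where cP: "\<forall>q. computes cP q (unary_prefix (code_index cU) q)" using prefix ..
  have "names_Delta2_fun ?X Y (unary_prefix (code_index cU) p) f"
    if f: "names_closed_pw ?X Y p f" for p f
    unfolding names_Delta2_fun_def
  proof (intro conjI fun_rep_intro)
    show "f \<in> points ?X \<rightarrow>\<^sub>E points Y" using f unfolding names_closed_pw_def by blast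
    show "preimage_map ?X Y f \<in> extensional (points (open_rep Y))"
      unfolding preimage_map_def by (rule restrict_extensional)
  next
    fix u U assume u: "open_rep Y u = Some U"
    obtain A where cover: "(\<Union>j. A j) = points ?X" and A: "closed_test ?X cA p A"
      and tests: "\<forall>u U. open_rep Y u = Some U \<longrightarrow>
        function_test ?X cF p A u {x \<in> points ?X. f x \<in> U}"
      using tests[rule_format, OF f] by (elim exE conjE) (rule that)
    note F = tests[rule_format, OF u]
    let ?B = "{x \<in> points ?X. f x \<in> U}" and ?q = "interleave u p"
    let ?C = "certified A cF ?q" and ?V = "\<lambda>J. points ?X - A (pfst J) \<union> ?B"
    have AM: "A j \<subseteq> M" for j using cover points_cauchy_rep by blast
    have C: "closed_rep ?X (unary_prefix (code_index cC) (unary_prefix J ?q)) = Some (?C J)" for J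
      using A AM by (intro cC[rule_format]) blast
    have V: "open_rep ?X (unary_prefix (code_index cV) (unary_prefix J ?q)) = Some (?V J)" for J
      using A F by (intro cV[rule_format]) blast
    have "fun_rep nat_rep (prod_rep (closed_rep ?X) (open_rep ?X)) (unary_prefix (code_index cS) ?q) =
        Some (\<lambda>J. (?C J, ?V J))"
    proof (rule fun_rep_nat_intro, intro exI conjI)
      fix J
      show "computes cS (interleave (unat J) ?q) (?name J ?q)" by (rule cS)
      show "prod_rep (closed_rep ?X) (open_rep ?X) (?name J ?q) = Some (?C J, ?V J)"
        by (simp add: prod_rep_eq_Some_iff C V)
    qed
    moreover have "(\<Union>J. ?C J) = ?B" by (rule Union_certified[OF AM F]) (use cover in blast)
    moreover have "(\<Inter>J. ?V J) = ?B"
    proof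
      show "(\<Inter>J. ?V J) \<subseteq> ?B"
      proof
        fix x assume x: "x \<in> (\<Inter>J. ?V J)"
        \<comment> \<open>Both parts of \<open>?V J\<close> lie in \<open>points ?X\<close>, so one
          member of the intersection already makes \<open>x\<close> a point of the space; only then
          does the cover supply \<open>j\<close>.\<close>
        then have "x \<in> ?V 0" by blast
        then have "x \<in> points ?X" by blast
        then obtain j where j: "x \<in> A j" using cover by blast
        have "x \<in> ?V (pe j 0)" using x by blast
        then show "x \<in> ?B" using j by simp
      qed
    qed blast
    moreover have "preimage_map ?X Y f U = ?B"
      using pointsI[of "open_rep Y", OF u] by (simp add: preimage_map_def)
    ultimately have "Delta2_rep ?X (unary_prefix (code_index cS) ?q) = Some (preimage_map ?X Y f U)"
      by (simp add: Delta2_rep_def)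
    then show "\<exists>s. computes cU ?q s \<and> Delta2_rep ?X s = Some (preimage_map ?X Y f U)"
      using cU by blast
  qed
  then show ?thesis using cP by blast
qed

end

theorem theorem10:
  fixes M :: "'a set" and d :: "'a \<Rightarrow> 'a \<Rightarrow> real" and a :: "nat \<Rightarrow> 'a"
    and N :: "'b set" and e :: "'b \<Rightarrow> 'b \<Rightarrow> real" and b :: "nat \<Rightarrow> 'b"
    and X :: "'a rep" and Y :: "'b rep"
  assumes "computable_metric_space M d a" and "X = cauchy_rep M d a"
    and "computable_metric_space N e b" and "Y = cauchy_rep N e b"
  shows "(id \<in> points (Delta2_fun_rep X Y) \<rightarrow> points (closed_pw_rep X Y) \<and>
          computable_map (Delta2_fun_rep X Y) (closed_pw_rep X Y) id) \<and>
         (id \<in> points (closed_pw_rep X Y) \<rightarrow> points (Delta2_fun_rep X Y) \<and>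
          computable_map (closed_pw_rep X Y) (Delta2_fun_rep X Y) id)"
proof -
  interpret X: computable_metric_space M d a by fact
  interpret Y: computable_metric_space N e b by fact
  have 1: "computable_map (Delta2_fun_rep X Y) (closed_pw_rep X Y) id"
    unfolding assms(4) by (rule Y.Delta2_fun_to_closed_pw)
  have 2: "computable_map (closed_pw_rep X Y) (Delta2_fun_rep X Y) id"
    using X.closed_pw_to_Delta2_fun[of Y]
    unfolding computable_map_def assms(2,4) closed_pw_rep_eq_Some_iff Y.Delta2_fun_rep_eq_Some_iff
    by simp
  show ?thesis
    using 1 2 computable_map_points by blast
qed

end
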